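(* Let $\kappa\in(0,2]$, and for each $d$ let $\mathbb{P}_\kappa$ be the law of $W\sim\mathrm{GOE}(d)$ conditioned on the event $\|W\|_{\mathrm{op}}\le\kappa$. If $W\sim\mathbb{P}_\kappa$ (for each $d$), then, almost surely, the empirical spectral distribution $\mu_W$ converges weakly as $d\to\infty$ to the probability measure $\mu_\kappa(\mathrm dx)=\rho_\kappa(x)\,\mathrm dx$ supported on $[-\kappa,\kappa]$ with density, for $x\in(-\kappa,\kappa)$, $$\rho_\kappa(x)=\frac{4+\kappa^2-2x^2}{4\pi\sqrt{\kappa^2-x^2}} .$$
   Context: $\mathrm{GOE}(d)$ is the law of a random real symmetric $d\times d$ matrix $Y$ whose entries $(Y_{ij})_{i\le j}$ are independent with $Y_{ij}\sim\mathcal N(0,(1+\delta_{ij})/d)$. $\|\cdot\|_{\mathrm{op}}$ is the operator (spectral) norm. For a symmetric $d\times d$ matrix $W$ with eigenvalues $\lambda_1,\dots,\lambda_d$, $\mu_W=\frac1d\sum_{i=1}^d\delta_{\lambda_i}$. For the almost sure statement, the matrices for different $d$ are defined on a common probability space. *)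

theory Defs
  imports "HOL-Probability.Probability" "Jordan_Normal_Form.Char_Poly"
begin

definition sym_mats :: "nat \<Rightarrow> real mat set" where
  "sym_mats d = {A \<in> carrier_mat d d. transpose_mat A = A}"

(* The sigma-algebra on the symmetric d x d matrices is the one generated by the entries,
   i.e. the Borel sigma-algebra. *)
definition sym_mat_algebra :: "nat \<Rightarrow> real mat measure" where
  "sym_mat_algebra d = vimage_algebra (sym_mats d)
     (\<lambda>A. \<lambda>(i, j) \<in> {..<d} \<times> {..<d}. A $$ (i, j))
     (\<Pi>\<^sub>M p \<in> {..<d} \<times> {..<d}. borel)"

definition upper_indices :: "nat \<Rightarrow> (nat \<times> nat) set" where
  "upper_indices d = {(i, j). i \<le> j \<and> j < d}"

definition sym_mat_of_upper :: "nat \<Rightarrow> (nat \<times> nat \<Rightarrow> real) \<Rightarrow> real mat" where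
  "sym_mat_of_upper d y = mat d d (\<lambda>(i, j). y (min i j, max i j))"

(* normal_density takes the standard deviation, not the variance. *)
definition GOE :: "nat \<Rightarrow> real mat measure" where
  "GOE d = distr
     (\<Pi>\<^sub>M (i, j) \<in> upper_indices d.
        density lborel (normal_density 0 (sqrt ((1 + of_bool (i = j)) / real d))))
     (sym_mat_algebra d) (sym_mat_of_upper d)"

definition euclid_norm :: "real Matrix.vec \<Rightarrow> real" where
  "euclid_norm v = sqrt (scalar_prod v v)"

(* This mirrors onorm; the zero vector contributes 0 / 0 = 0. *)
definition op_norm :: "real mat \<Rightarrow> real" where
  "op_norm A = (SUP v \<in> carrier_vec (dim_col A). euclid_norm (A *\<^sub>v v) / euclid_norm v)"

(* uniform_measure M E is M conditioned on the event E. *)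
definition P_cond :: "real \<Rightarrow> nat \<Rightarrow> real mat measure" where
  "P_cond \<kappa> d = uniform_measure (GOE d) {A \<in> space (GOE d). op_norm A \<le> \<kappa>}"

definition eigenvalue_mset :: "real mat \<Rightarrow> real multiset" where
  "eigenvalue_mset A = proots (char_poly A)"

(* A multiple eigenvalue is an atom whose mass is its multiplicity divided by d. *)
definition esd :: "real mat \<Rightarrow> real measure" where
  "esd A = distr
     (point_measure (set_mset (eigenvalue_mset A))
        (\<lambda>x. ennreal (real (count (eigenvalue_mset A) x) / real (dim_row A))))
     borel (\<lambda>x. x)"

definition rho :: "real \<Rightarrow> real \<Rightarrow> real" where
  "rho \<kappa> x = (4 + \<kappa>\<^sup>2 - 2 * x\<^sup>2) / (4 * pi * sqrt (\<kappa>\<^sup>2 - x\<^sup>2))"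

definition mu_limit :: "real \<Rightarrow> real measure" where
  "mu_limit \<kappa> = density lborel (\<lambda>x. ennreal (indicator {-\<kappa><..<\<kappa>} x * rho \<kappa> x))"

end

theory Submission
  imports Defs "Jordan_Normal_Form.Schur_Decomposition" "HOL-Computational_Algebra.Computational_Algebra"
begin

text \<open>
  The law of \<open>W\<close> has density proportional to exp (- d tr (W^2) / 4) on the symmetric matrices of
  operator norm at most \<open>\<kappa>\<close>. The proof combines
  the loop (Schwinger-Dyson) equations of this law with a uniqueness theorem for their limit.

  \<^bold>\<open>Loop equations.\<close> The vector field H(W) = (\<open>\<kappa>\<close>^2 - W^2) W^k moves each eigenvalue x with speed
  (\<open>\<kappa>\<close>^2 - x^2) x^k, which vanishes at \<open>\<kappa>\<close> and -\<open>\<kappa>\<close>. Its flow therefore preserves the operator norm ball,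
  and integration by parts on the ball leaves no boundary term: for every smooth observable F,
  E [F (div H - (d/2) tr (W H)) + H . grad F] = 0. The bracket div H - (d/2) tr (W H) equals
  (d^2/2) X, where X (\<open>loop_obs\<close>) is a quadratic polynomial in the normalized traces tr (W^m) / d.
  The choice F = X gives E [X^2] = - (2/d^2) E [H . grad X], and H . grad X is bounded on the ball
  independently of d because the flow moves the normalized traces with bounded speed. So E [X^2] is
  of order 1/d^2 (\<open>loop_second_moment\<close>). This is summable in d, hence the sum over d of X^2 is almost
  surely finite and X tends to 0 almost surely, for all k simultaneously and for any coupling of the
  matrices of different sizes.

  \<^bold>\<open>The hard wall.\<close> To integrate by parts entry by entry against the Gaussian law of the whole space
  (\<open>GOE_loop_identity\<close>), the indicator of the ball is replaced by the smooth weight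
  exp (- tr ((W/\<open>\<kappa>\<close>)^(2q)) / d). It makes every polynomial in the entries bounded, it lies between
  exp (-1) and 1 on the ball, and it tends to 0 outside as q tends to infinity. It contributes an
  additional term, which in terms of the eigenvalues s of W/\<open>\<kappa>\<close> is a sum of
  2q s^(k+2q-1) (1 - s^2). Each summand tends to 0 for |s| at most 1, precisely because of the factor
  1 - s^2 that comes from H, and the sum times the weight is bounded uniformly in q. By dominated
  convergence the additional term disappears in the limit.

  \<^bold>\<open>Uniqueness.\<close> On the ball the m-th normalized trace is at most \<open>\<kappa>\<close>^m in absolute value. By
  compactness it suffices to identify the limit points t of the sequences of normalized traces. They
  satisfy |t m| \<open>\<le>\<close> \<open>\<kappa>\<close>^m, t 0 = 1 and the limiting loop equations, in which the terms of order 1/d are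
  absent. For G(z), the sum of t m / z^(m+1), these equations say
  (2 G(z) - z)^2 (z^2 - \<open>\<kappa>\<close>^2) = Q(z) for |z| > \<open>\<kappa>\<close>, where
  Q(z) = z^4 - (4 + \<open>\<kappa>\<close>^2) z^2 - 4 (t 1) z + 4 (1 + \<open>\<kappa>\<close>^2 - t 2).
  The left-hand side is an analytic square times a function without zeros, so every zero of Q outside
  the closed disc of radius \<open>\<kappa>\<close> is multiple. The zeros of Q have sum 0 and their squares have sum
  2 (4 + \<open>\<kappa>\<close>^2), and with \<open>\<kappa> \<le> 2\<close> this leaves only Q(z) = (z^2 - (4 + \<open>\<kappa>\<close>^2) / 2)^2
  (\<open>quartic_coeffs_determined\<close>). Now G is explicit: it is a combination of
  z and (z^2 - (4 + \<open>\<kappa>\<close>^2) / 2) / sqrt (z^2 - \<open>\<kappa>\<close>^2), the generating function of the moments of the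
  limit measure (\<open>loop_equation_unique_solution\<close>, \<open>mu_limit_moment\<close>).

  All measures involved live on the compact interval from -\<open>\<kappa>\<close> to \<open>\<kappa>\<close>, so convergence of moments implies
  weak convergence by the Weierstrass approximation theorem (\<open>moments_imp_weak_conv\<close>).
\<close>

section \<open>Real spectra and traces of powers of symmetric matrices\<close>

definition power_trace :: "real mat \<Rightarrow> nat \<Rightarrow> real" where
  "power_trace A m = (\<Sum>i<dim_row A. (A ^\<^sub>m m) $$ (i, i))"

lemma sym_matsD:
  assumes "A \<in> sym_mats d"
  shows "A \<in> carrier_mat d d" "transpose_mat A = A"
    and "\<And>i j. i < d \<Longrightarrow> j < d \<Longrightarrow> A $$ (i, j) = A $$ (j, i)"
proof -
  show c: "A \<in> carrier_mat d d" and t: "transpose_mat A = A"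
    using assms by (auto simp: sym_mats_def)
  show "A $$ (i, j) = A $$ (j, i)" if "i < d" "j < d" for i j
  proof -
    have "A $$ (i, j) = transpose_mat A $$ (i, j)" using t by simp
    also have "\<dots> = A $$ (j, i)" using c that by (auto simp: transpose_mat_def)
    finally show ?thesis .
  qed
qed

text \<open>
  For an eigenvector v the number \<open>v\<^sup>* A v\<close> equals z |v|^2, and it is its own conjugate because A is
  real and symmetric.
\<close>

lemma symmetric_eigenvalue_real:
  assumes A: "A \<in> sym_mats d" and ev: "eigenvalue (map_mat complex_of_real A) z"
  shows "Im z = 0"
proof -
  let ?C = "map_mat complex_of_real A"
  note A' = sym_matsD[OF A]
  obtain v where v: "v \<in> carrier_vec d" "v \<noteq> 0\<^sub>v d" "?C *\<^sub>v v = z \<cdot>\<^sub>v v"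
    using ev A' unfolding eigenvalue_def eigenvector_def by auto
  have comp: "(\<Sum>j<d. of_real (A $$ (i, j)) * v $ j) = z * v $ i" if "i < d" for i
  proof -
    have "(?C *\<^sub>v v) $ i = (\<Sum>j<d. of_real (A $$ (i, j)) * v $ j)"
      using A'(1) v(1) that by (auto simp: scalar_prod_def atLeast0LessThan intro!: sum.cong)
    moreover have "(?C *\<^sub>v v) $ i = z * v $ i" using v that by simp
    ultimately show ?thesis by simp
  qed
  define q where "q = (\<Sum>i<d. \<Sum>j<d. cnj (v $ i) * of_real (A $$ (i, j)) * v $ j)"
  have q1: "q = z * (\<Sum>i<d. cnj (v $ i) * v $ i)"
  proof -
    have "q = (\<Sum>i<d. cnj (v $ i) * (\<Sum>j<d. of_real (A $$ (i, j)) * v $ j))"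
      by (simp add: q_def sum_distrib_left mult.assoc)
    also have "\<dots> = (\<Sum>i<d. cnj (v $ i) * (z * v $ i))"
      using comp by (intro sum.cong) auto
    finally show ?thesis by (simp add: sum_distrib_left mult_ac)
  qed
  have "cnj q = (\<Sum>i<d. \<Sum>j<d. v $ i * of_real (A $$ (i, j)) * cnj (v $ j))"
    by (simp add: q_def)
  also have "\<dots> = (\<Sum>j<d. \<Sum>i<d. v $ i * of_real (A $$ (i, j)) * cnj (v $ j))"
    by (rule sum.swap)
  also have "\<dots> = q"
    unfolding q_def using A'(3) by (intro sum.cong refl) (auto simp: mult_ac)
  finally have q2: "cnj q = q" .
  define s where "s = (\<Sum>i<d. (cmod (v $ i))\<^sup>2)"
  have s: "(\<Sum>i<d. cnj (v $ i) * v $ i) = of_real s"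
    by (simp add: s_def complex_norm_square mult.commute del: of_real_power)
  obtain i where i: "i < d" "v $ i \<noteq> 0"
  proof -
    have "\<exists>i<d. v $ i \<noteq> 0"
    proof (rule ccontr)
      assume "\<not> ?thesis"
      then have "v = 0\<^sub>v d" using v(1) by (intro eq_vecI) auto
      with v(2) show False by simp
    qed
    then show ?thesis using that by blast
  qed
  have "s > 0"
    unfolding s_def by (rule sum_pos2[of _ i]) (use i in auto)
  have "Im q = 0" using arg_cong[OF q2, of Im] by simp
  moreover have "Im q = Im z * s" using q1 s by simp
  ultimately show ?thesis using \<open>s > 0\<close> by simp
qed

lemma symmetric_char_poly_splits:
  assumes A: "A \<in> sym_mats d"
  obtains es where "length es = d" "char_poly A = (\<Prod>e\<leftarrow>es. [:- e, 1:])"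
proof -
  interpret hom: map_poly_inj_idom_hom "of_real :: real \<Rightarrow> complex" ..
  note A' = sym_matsD[OF A]
  let ?C = "map_mat complex_of_real A"
  have C: "?C \<in> carrier_mat d d" using A' by auto
  from char_poly_factorized[OF C] obtain as where
    as: "char_poly ?C = (\<Prod>a\<leftarrow>as. [:- a, 1:])" "length as = d" by blast
  have re: "Im a = 0" if "a \<in> set as" for a
  proof (rule symmetric_eigenvalue_real[OF A])
    have "poly (char_poly ?C) a = 0"
      using that by (auto simp: as poly_prod_list prod_list_zero_iff)
    then show "eigenvalue ?C a" using eigenvalue_root_char_poly[OF C] by simp
  qed
  let ?es = "map Re as"
  have "map_poly complex_of_real (char_poly A) = char_poly ?C"
    by (rule of_real_hom.char_poly_hom[symmetric, OF A'(1)])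
  also have "\<dots> = (\<Prod>a\<leftarrow>as. [:- of_real (Re a), 1:])"
    unfolding as using re by (intro arg_cong[of _ _ prod_list] map_cong refl)
      (auto simp: complex_eq_iff)
  also have "\<dots> = map_poly complex_of_real (\<Prod>e\<leftarrow>?es. [:- e, 1:])"
    by (simp add: hom.hom_prod_list o_def hom_distribs)
  finally have "char_poly A = (\<Prod>e\<leftarrow>?es. [:- e, 1:])"
    by (simp add: hom.eq_iff)
  then show ?thesis using that[of ?es] as(2) by simp
qed

text \<open>
  Together with the Schur decomposition this gives the traces of powers in terms of the eigenvalues.
\<close>

lemma upper_triangular_pow_diag:
  fixes B :: "real mat"
  assumes B: "B \<in> carrier_mat d d" and ut: "upper_triangular B"
  shows "upper_triangular (B ^\<^sub>m m) \<and> (\<forall>i<d. (B ^\<^sub>m m) $$ (i, i) = (B $$ (i, i)) ^ m)"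
proof (induction m)
  case 0
  then show ?case using B by (auto simp: upper_triangular_def)
next
  case (Suc m)
  have C: "B ^\<^sub>m m \<in> carrier_mat d d" using B by simp
  have e: "(B ^\<^sub>m Suc m) $$ (i, j) = (\<Sum>k<d. (B ^\<^sub>m m) $$ (i, k) * B $$ (k, j))"
    if "i < d" "j < d" for i j
    using that B C by (auto simp: scalar_prod_def atLeast0LessThan intro!: sum.cong)
  have z: "(B ^\<^sub>m m) $$ (i, k) * B $$ (k, j) = 0" if "j \<le> i" "i < d" "k < d" "k \<noteq> i \<or> j < i" for i j k
  proof (cases "k < i")
    case True
    then show ?thesis using Suc that C B by (auto simp: upper_triangular_def)
  next
    case False
    then have "j < k" using that by auto
    then show ?thesis using ut that B by (auto simp: upper_triangular_def)
  qed
  show ?case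
  proof (intro conjI allI impI)
    show "upper_triangular (B ^\<^sub>m Suc m)"
    proof (rule upper_triangularI)
      fix i j assume ij: "j < i" "i < dim_row (B ^\<^sub>m Suc m)"
      then have "i < d" "j < d" using B by auto
      then show "(B ^\<^sub>m Suc m) $$ (i, j) = 0"
        using e[of i j] z[of j i] ij by (auto intro!: sum.neutral)
    qed
  next
    fix i assume i: "i < d"
    have "(B ^\<^sub>m Suc m) $$ (i, i) = (\<Sum>k<d. (B ^\<^sub>m m) $$ (i, k) * B $$ (k, i))"
      using e i by simp
    also have "\<dots> = (\<Sum>k\<in>{i}. (B ^\<^sub>m m) $$ (i, k) * B $$ (k, i))"
      by (rule sum.mono_neutral_right) (use i z in auto)
    also have "\<dots> = (B $$ (i, i)) ^ Suc m" using Suc i by simp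
    finally show "(B ^\<^sub>m Suc m) $$ (i, i) = (B $$ (i, i)) ^ Suc m" .
  qed
qed

definition mtrace :: "real mat \<Rightarrow> real" where
  "mtrace A = (\<Sum>i<dim_row A. A $$ (i, i))"

lemma mtrace_mult:
  assumes "A \<in> carrier_mat d d" "B \<in> carrier_mat d d"
  shows "mtrace (A * B) = (\<Sum>i<d. \<Sum>j<d. A $$ (i, j) * B $$ (j, i))"
  using assms by (auto simp: mtrace_def scalar_prod_def atLeast0LessThan intro!: sum.cong)

lemma mtrace_mult_commute:
  assumes "A \<in> carrier_mat d d" "B \<in> carrier_mat d d"
  shows "mtrace (A * B) = mtrace (B * A)"
  unfolding mtrace_mult[OF assms] mtrace_mult[OF assms(2,1)]
  by (subst sum.swap) (simp add: mult.commute)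

lemma power_trace_eq_sum_eigenvalues:
  assumes A: "A \<in> sym_mats d" and es: "char_poly A = (\<Prod>e\<leftarrow>es. [:- e, 1:])"
  shows "power_trace A m = (\<Sum>e\<leftarrow>es. e ^ m)"
proof -
  note A' = sym_matsD[OF A]
  obtain B P Q where "schur_decomposition A es = (B, P, Q)" by (cases "schur_decomposition A es")
  from schur_decomposition[OF A'(1) es this]
  have w: "similar_mat_wit A B P Q" and ut: "upper_triangular B" and dg: "diag_mat B = es" by auto
  note w' = similar_mat_witD2[OF A'(1) w]
  have Am: "A ^\<^sub>m m \<in> carrier_mat d d" using A' by simp
  note w2 = similar_mat_witD2[OF Am similar_mat_wit_pow[OF w]]
  have Bm: "B ^\<^sub>m m \<in> carrier_mat d d" using w' by simp
  have "power_trace A m = mtrace (A ^\<^sub>m m)" using A' by (simp add: power_trace_def mtrace_def)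
  also have "\<dots> = mtrace (P * ((B ^\<^sub>m m) * Q))" using w' w2 Bm by (simp add: assoc_mult_mat[of _ d d])
  also have "\<dots> = mtrace ((B ^\<^sub>m m) * Q * P)"
    by (rule mtrace_mult_commute[of _ d]) (use w' Bm in auto)
  also have "\<dots> = mtrace (B ^\<^sub>m m)" using w' w2 Bm by (simp add: assoc_mult_mat[of _ d d _ d _ d])
  also have "\<dots> = (\<Sum>i<d. (B $$ (i, i)) ^ m)"
    using upper_triangular_pow_diag[OF w'(5) ut, of m] w' by (simp add: mtrace_def)
  also have "\<dots> = (\<Sum>e\<leftarrow>es. e ^ m)"
    using w' dg[symmetric] by (simp add: diag_mat_def o_def interv_sum_list_conv_sum_set_nat atLeast0LessThan)
  finally show ?thesis .
qed

lemma eigenvalue_mset_eq: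
  assumes "char_poly A = (\<Prod>e\<leftarrow>es. [:- e, 1:])"
  shows "eigenvalue_mset A = mset es"
proof -
  have "0 \<notin> set (map (\<lambda>e. [:- e, 1::real:]) es)" by auto
  from proots_prod_list[OF this] have "proots (\<Prod>e\<leftarrow>es. [:- e, 1:]) = mset es"
    by (simp add: o_def)
  then show ?thesis unfolding eigenvalue_mset_def assms .
qed

lemma power_trace_eq_sum_mset:
  assumes A: "A \<in> sym_mats d"
  shows "power_trace A m = (\<Sum>e\<in>#eigenvalue_mset A. e ^ m)" "size (eigenvalue_mset A) = d"
proof -
  obtain es where es: "length es = d" "char_poly A = (\<Prod>e\<leftarrow>es. [:- e, 1:])"
    using symmetric_char_poly_splits[OF A] .
  show "power_trace A m = (\<Sum>e\<in>#eigenvalue_mset A. e ^ m)" 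
    using power_trace_eq_sum_eigenvalues[OF A es(2)] eigenvalue_mset_eq[OF es(2)]
    by (metis mset_map sum_mset_sum_list)
  show "size (eigenvalue_mset A) = d" using es eigenvalue_mset_eq[OF es(2)] by simp
qed

lemma pow_mat_Suc_index:
  fixes A :: "real mat"
  assumes A: "A \<in> carrier_mat d d" and r: "r < d" "s < d"
  shows "(A ^\<^sub>m Suc m) $$ (r, s) = (\<Sum>l<d. (A ^\<^sub>m m) $$ (r, l) * A $$ (l, s))"
proof -
  have C: "A ^\<^sub>m m \<in> carrier_mat d d" using A by simp
  have "(A ^\<^sub>m Suc m) $$ (r, s) = row (A ^\<^sub>m m) r \<bullet> col A s" using A C r by simp
  also have "\<dots> = (\<Sum>l<d. (A ^\<^sub>m m) $$ (r, l) * A $$ (l, s))"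
    using A C r by (simp add: scalar_prod_def atLeast0LessThan)
  finally show ?thesis .
qed

lemma pow_mat_0_index:
  fixes A :: "real mat"
  assumes A: "A \<in> carrier_mat d d" and r: "r < d" "s < d"
  shows "(A ^\<^sub>m 0) $$ (r, s) = of_bool (r = s)"
  using assms by simp

lemma pow_mat_add_index:
  fixes A :: "real mat"
  assumes A: "A \<in> carrier_mat d d" and r: "r < d" "s < d"
  shows "(A ^\<^sub>m (a + b)) $$ (r, s) = (\<Sum>l<d. (A ^\<^sub>m a) $$ (r, l) * (A ^\<^sub>m b) $$ (l, s))"
  using r(2)
proof (induction b arbitrary: s)
  case 0
  have "(\<Sum>l<d. (A ^\<^sub>m a) $$ (r, l) * (A ^\<^sub>m 0) $$ (l, s)) = (\<Sum>l<d. if l = s then (A ^\<^sub>m a) $$ (r, l) else 0)"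
    by (rule sum.cong[OF refl]) (use A 0 in \<open>simp add: pow_mat_0_index[OF A] del: pow_mat.simps\<close>)
  then show ?case using 0 by simp
next
  case (Suc b)
  have "(A ^\<^sub>m (a + Suc b)) $$ (r, s) = (\<Sum>l<d. (\<Sum>k<d. (A ^\<^sub>m a) $$ (r, k) * (A ^\<^sub>m b) $$ (k, l)) * A $$ (l, s))"
    using pow_mat_Suc_index[OF A r(1) Suc.prems, of "a + b"] Suc.IH by simp
  also have "\<dots> = (\<Sum>k<d. (A ^\<^sub>m a) $$ (r, k) * (\<Sum>l<d. (A ^\<^sub>m b) $$ (k, l) * A $$ (l, s)))"
    unfolding sum_distrib_left sum_distrib_right by (subst sum.swap) (simp only: mult.assoc)
  also have "\<dots> = (\<Sum>k<d. (A ^\<^sub>m a) $$ (r, k) * (A ^\<^sub>m Suc b) $$ (k, s))"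
    by (rule sum.cong[OF refl]) (simp only: pow_mat_Suc_index[OF A _ Suc.prems] lessThan_iff)
  finally show ?case .
qed

lemma pow_mat_symmetric:
  assumes A: "A \<in> sym_mats d" and r: "r < d" "s < d"
  shows "(A ^\<^sub>m m) $$ (r, s) = (A ^\<^sub>m m) $$ (s, r)"
  using r
proof (induction m arbitrary: r s)
  case 0
  then show ?case using pow_mat_0_index[OF sym_matsD(1)[OF A], of r s] pow_mat_0_index[OF sym_matsD(1)[OF A], of s r]
    by (simp add: eq_commute)
next
  case (Suc m)
  note A' = sym_matsD[OF A]
  have 1: "(A ^\<^sub>m 1) $$ (s, l) = A $$ (s, l)" if "l < d" for l using A' by simp
  have "(A ^\<^sub>m Suc m) $$ (r, s) = (\<Sum>l<d. (A ^\<^sub>m m) $$ (r, l) * A $$ (l, s))"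
    by (rule pow_mat_Suc_index[OF A'(1) Suc.prems])
  also have "\<dots> = (\<Sum>l<d. (A ^\<^sub>m 1) $$ (s, l) * (A ^\<^sub>m m) $$ (l, r))"
  proof (rule sum.cong[OF refl])
    fix l assume "l \<in> {..<d}"
    then have l: "l < d" by simp
    show "(A ^\<^sub>m m) $$ (r, l) * A $$ (l, s) = (A ^\<^sub>m 1) $$ (s, l) * (A ^\<^sub>m m) $$ (l, r)"
      unfolding 1[OF l] Suc.IH[OF Suc.prems(1) l] A'(3)[OF l Suc.prems(2)] by (rule mult.commute)
  qed
  also have "\<dots> = (A ^\<^sub>m (1 + m)) $$ (s, r)"
    by (rule pow_mat_add_index[OF A'(1) Suc.prems(2,1), symmetric])
  finally show ?case by simp
qed

lemma power_trace_eq_sum_diag: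
  assumes "A \<in> carrier_mat d d"
  shows "power_trace A m = (\<Sum>i<d. (A ^\<^sub>m m) $$ (i, i))"
  using assms by (simp add: power_trace_def)

lemma power_trace_add:
  assumes A: "A \<in> sym_mats d"
  shows "power_trace A (a + b) = (\<Sum>i<d. \<Sum>j<d. (A ^\<^sub>m a) $$ (i, j) * (A ^\<^sub>m b) $$ (i, j))"
proof -
  note A' = sym_matsD[OF A]
  have "power_trace A (a + b) = (\<Sum>i<d. \<Sum>j<d. (A ^\<^sub>m a) $$ (i, j) * (A ^\<^sub>m b) $$ (j, i))"
    unfolding power_trace_eq_sum_diag[OF A'(1)]
    by (rule sum.cong[OF refl]) (simp only: pow_mat_add_index[OF A'(1)] lessThan_iff)
  also have "\<dots> = (\<Sum>i<d. \<Sum>j<d. (A ^\<^sub>m a) $$ (i, j) * (A ^\<^sub>m b) $$ (i, j))"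
    by (intro sum.cong refl arg_cong2[of _ _ _ _ "(*)"] pow_mat_symmetric[OF A]) auto
  finally show ?thesis .
qed

lemma power_trace_even_nonneg:
  assumes A: "A \<in> sym_mats d"
  shows "power_trace A (2 * m) \<ge> 0"
proof -
  have "power_trace A (m + m) = (\<Sum>i<d. \<Sum>j<d. ((A ^\<^sub>m m) $$ (i, j))\<^sup>2)"
    unfolding power_trace_add[OF A] power2_eq_square ..
  also have "\<dots> \<ge> 0" by (intro sum_nonneg) simp
  finally show ?thesis by (simp add: mult_2)
qed

lemma pow_entry_squared_le:
  assumes A: "A \<in> sym_mats d" and r: "r < d" "s < d"
  shows "((A ^\<^sub>m m) $$ (r, s))\<^sup>2 \<le> power_trace A (2 * m)"
proof -
  have "((A ^\<^sub>m m) $$ (r, s))\<^sup>2 \<le> (\<Sum>j<d. ((A ^\<^sub>m m) $$ (r, j))\<^sup>2)"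
    using r by (intro member_le_sum) auto
  also have "\<dots> \<le> (\<Sum>i<d. \<Sum>j<d. ((A ^\<^sub>m m) $$ (i, j))\<^sup>2)"
    using r by (intro member_le_sum[of r "{..<d}" "\<lambda>i. \<Sum>j<d. ((A ^\<^sub>m m) $$ (i, j))\<^sup>2"] sum_nonneg) auto
  also have "\<dots> = power_trace A (m + m)"
    unfolding power_trace_add[OF A] power2_eq_square ..
  finally show ?thesis by (simp add: mult_2)
qed

lemma space_sym_mat_algebra: "space (sym_mat_algebra d) = sym_mats d"
  by (simp add: sym_mat_algebra_def)

lemma measurable_entry:
  assumes "r < d" "s < d"
  shows "(\<lambda>A. A $$ (r, s)) \<in> borel_measurable (sym_mat_algebra d)"
proof -
  let ?f = "\<lambda>A. \<lambda>(i, j) \<in> {..<d} \<times> {..<d}. A $$ (i, j) :: real"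
  have "?f \<in> sym_mats d \<rightarrow> space (\<Pi>\<^sub>M p \<in> {..<d} \<times> {..<d}. borel)" by (auto simp: space_PiM)
  from measurable_vimage_algebra1[OF this]
  have "?f \<in> measurable (sym_mat_algebra d) (\<Pi>\<^sub>M p \<in> {..<d} \<times> {..<d}. borel)"
    unfolding sym_mat_algebra_def .
  moreover have "(\<lambda>x. x (r, s)) \<in> measurable (\<Pi>\<^sub>M p \<in> {..<d} \<times> {..<d}. (borel :: real measure)) borel"
    using assms by (intro measurable_component_singleton) auto
  ultimately have "(\<lambda>A. ?f A (r, s)) \<in> borel_measurable (sym_mat_algebra d)"
    by (rule measurable_compose)
  then show ?thesis using assms by simp
qed

section \<open>Gaussian integration by parts\<close>

lemma normal_density_0_eq:
  "normal_density 0 \<sigma> = (\<lambda>x. 1 / sqrt (2 * pi * \<sigma>\<^sup>2) * exp (- x\<^sup>2 / (2 * \<sigma>\<^sup>2)))"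
  by (simp add: normal_density_def fun_eq_iff)

lemma normal_density_deriv:
  assumes "\<sigma> > 0"
  shows "(normal_density 0 \<sigma> has_real_derivative (- (x / \<sigma>\<^sup>2) * normal_density 0 \<sigma> x)) (at x)"
proof -
  have "((\<lambda>x. c * exp (a * x\<^sup>2)) has_real_derivative (2 * a * x * (c * exp (a * x\<^sup>2)))) (at x)" for c a
    by (auto intro!: derivative_eq_intros)
  from this[of "1 / sqrt (2 * pi * \<sigma>\<^sup>2)" "- 1 / (2 * \<sigma>\<^sup>2)"] show ?thesis
    unfolding normal_density_0_eq by simp
qed

lemma normal_density_tendsto_0:
  assumes "\<sigma> > 0"
  shows "(normal_density 0 \<sigma> \<longlongrightarrow> 0) at_top" "(normal_density 0 \<sigma> \<longlongrightarrow> 0) at_bot"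
proof -
  define a where "a = 1 / (2 * \<sigma>\<^sup>2)"
  have a: "a > 0" using assms by (simp add: a_def)
  have e: "normal_density 0 \<sigma> = (\<lambda>x. 1 / sqrt (2 * pi * \<sigma>\<^sup>2) * exp (- a * x\<^sup>2))"
    by (simp add: normal_density_0_eq a_def)
  have "((\<lambda>x::real. exp (- a * x\<^sup>2)) \<longlongrightarrow> 0) F" if "filterlim (\<lambda>x::real. x\<^sup>2) at_top F" for F
    by (rule filterlim_compose[OF exp_at_bot filterlim_tendsto_neg_mult_at_bot[OF tendsto_const]])
       (use a that in simp_all)
  moreover have "filterlim (\<lambda>x::real. x\<^sup>2) at_top at_top" "filterlim (\<lambda>x::real. x\<^sup>2) at_top at_bot"
    by (simp_all add: filterlim_pow_at_top filterlim_pow_at_bot_even filterlim_ident)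
  ultimately have "((\<lambda>x::real. exp (- a * x\<^sup>2)) \<longlongrightarrow> 0) at_top" "((\<lambda>x::real. exp (- a * x\<^sup>2)) \<longlongrightarrow> 0) at_bot"
    by blast+
  from this[THEN tendsto_mult_right_zero, of "1 / sqrt (2 * pi * \<sigma>\<^sup>2)"]
  show "(normal_density 0 \<sigma> \<longlongrightarrow> 0) at_top" "(normal_density 0 \<sigma> \<longlongrightarrow> 0) at_bot"
    unfolding e by this
qed

lemma bounded_times_null:
  fixes f g :: "real \<Rightarrow> real"
  assumes "\<And>x. \<bar>f x\<bar> \<le> B" "(g \<longlongrightarrow> 0) F"
  shows "((\<lambda>x. f x * g x) \<longlongrightarrow> 0) F"
proof (rule tendsto_rabs_zero_cancel, rule Lim_null_comparison)
  show "\<forall>\<^sub>F x in F. norm \<bar>f x * g x\<bar> \<le> B * \<bar>g x\<bar>"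
    using assms(1) by (intro always_eventually) (auto simp: abs_mult intro!: mult_right_mono)
  show "((\<lambda>x. B * \<bar>g x\<bar>) \<longlongrightarrow> 0) F"
    using tendsto_mult_right_zero[OF tendsto_rabs_zero[OF assms(2)]] .
qed

text \<open>
  The derivative of f times the Gaussian density integrates to 0 over the line, because a bounded f
  times the density vanishes at both ends.
\<close>

lemma gaussian_integration_by_parts_1d:
  fixes f f' :: "real \<Rightarrow> real"
  assumes s: "\<sigma> > 0"
    and d: "\<And>x. (f has_real_derivative f' x) (at x)"
    and c: "\<And>x. isCont f' x"
    and bf: "\<And>x. \<bar>f x\<bar> \<le> B" and bf': "\<And>x. \<bar>f' x\<bar> \<le> B"
  defines "N \<equiv> density lborel (\<lambda>x. ennreal (normal_density 0 \<sigma> x))"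
  shows "(\<integral>x. f' x \<partial>N) = (\<integral>x. x / \<sigma>\<^sup>2 * f x \<partial>N)"
proof -
  let ?p = "normal_density 0 \<sigma>"
  have cf: "isCont f x" for x using d DERIV_isCont by blast
  have [measurable]: "f \<in> borel_measurable borel" "f' \<in> borel_measurable borel"
    using cf c by (auto intro!: borel_measurable_continuous_onI continuous_at_imp_continuous_on)
  have cp: "isCont ?p x" for x using normal_density_deriv[OF s] DERIV_isCont by blast
  define F where "F x = f x * ?p x" for x
  define F' where "F' x = ?p x * f' x - ?p x * (x / \<sigma>\<^sup>2 * f x)" for x
  have i1: "integrable lborel (\<lambda>x. ?p x * f' x)"
  proof (rule Bochner_Integration.integrable_bound)
    show "integrable lborel (\<lambda>x. B * ?p x)" using s by simp
    show "AE x in lborel. norm (?p x * f' x) \<le> norm (B * ?p x)"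
    proof (rule AE_I2)
      fix x
      have "norm (?p x * f' x) = \<bar>f' x\<bar> * ?p x" by (simp add: abs_mult)
      also have "\<dots> \<le> \<bar>B\<bar> * ?p x"
        by (rule mult_right_mono) (use order.trans[OF bf'[of x] abs_ge_self[of B]] in simp_all)
      also have "\<dots> = norm (B * ?p x)" by (simp add: abs_mult)
      finally show "norm (?p x * f' x) \<le> norm (B * ?p x)" .
    qed
  qed measurable
  have i2: "integrable lborel (\<lambda>x. ?p x * (x / \<sigma>\<^sup>2 * f x))"
  proof (rule Bochner_Integration.integrable_bound)
    show "integrable lborel (\<lambda>x. B / \<sigma>\<^sup>2 * (?p x * x))"
      using integrable_normal_moment_nz_1[OF s, of 0] by simp
    show "AE x in lborel. norm (?p x * (x / \<sigma>\<^sup>2 * f x)) \<le> norm (B / \<sigma>\<^sup>2 * (?p x * x))"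
    proof (rule AE_I2)
      fix x
      have "norm (?p x * (x / \<sigma>\<^sup>2 * f x)) = \<bar>f x\<bar> * norm (?p x * x / \<sigma>\<^sup>2)"
        by (simp add: abs_mult)
      also have "\<dots> \<le> \<bar>B\<bar> * norm (?p x * x / \<sigma>\<^sup>2)"
        by (rule mult_right_mono) (use order.trans[OF bf[of x] abs_ge_self[of B]] in simp_all)
      also have "\<dots> = norm (B / \<sigma>\<^sup>2 * (?p x * x))" by (simp add: abs_mult)
      finally show "norm (?p x * (x / \<sigma>\<^sup>2 * f x)) \<le> norm (B / \<sigma>\<^sup>2 * (?p x * x))" .
    qed
  qed measurable
  have dF: "(F has_vector_derivative F' x) (at x)" for x
    unfolding F_def[abs_def] F'_def has_real_derivative_iff_has_vector_derivative[symmetric]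
    by (rule DERIV_cong[OF DERIV_mult[OF d normal_density_deriv[OF s]]]) (simp add: algebra_simps)
  have cF': "isCont F' x" for x
    unfolding F'_def using cf c cp by (intro continuous_intros) (use s in auto)
  have iF': "integrable lborel F'" unfolding F'_def using i1 i2 by simp
  have lims: "(F \<longlongrightarrow> 0) at_top" "(F \<longlongrightarrow> 0) at_bot"
    unfolding F_def using bounded_times_null[OF bf] normal_density_tendsto_0[OF s] by auto
  have "(LBINT x=-\<infinity>..\<infinity>. F' x) = 0 - 0"
  proof (rule interval_integral_FTC_integrable[where F = F])
    show "set_integrable lborel (einterval (-\<infinity>) \<infinity>) F'"
      using iF' by (simp add: set_integrable_def)
    show "((F \<circ> real_of_ereal) \<longlongrightarrow> 0) (at_right (-\<infinity>))" "((F \<circ> real_of_ereal) \<longlongrightarrow> 0) (at_left \<infinity>)"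
      using lims by (simp_all add: ereal_tendsto_simps)
  qed (simp_all add: dF cF')
  then have "(\<integral>x. F' x \<partial>lborel) = 0"
    by (simp add: interval_lebesgue_integral_def set_lebesgue_integral_def)
  then have "(\<integral>x. ?p x * f' x \<partial>lborel) = (\<integral>x. ?p x * (x / \<sigma>\<^sup>2 * f x) \<partial>lborel)"
    unfolding F'_def using i1 i2 by simp
  then show ?thesis unfolding N_def by (simp add: integral_density)
qed

text \<open>
  Fubini reduces this to the one-dimensional statement in the coordinate p. The three bounds hold
  for polynomials times the cutoff weight, and they take care of all integrability questions.
\<close>

lemma gaussian_integration_by_parts:
  fixes F D :: "('i \<Rightarrow> real) \<Rightarrow> real"
  assumes fin: "finite I" and p: "p \<in> I" and s: "\<And>i. i \<in> I \<Longrightarrow> \<sigma> i > 0"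
  defines "M \<equiv> (\<lambda>i. if i \<in> I then density lborel (\<lambda>x. ennreal (normal_density 0 (\<sigma> i) x)) else return borel 0)"
  assumes mF[measurable]: "F \<in> borel_measurable (Pi\<^sub>M I M)" and mD[measurable]: "D \<in> borel_measurable (Pi\<^sub>M I M)"
    and bF: "\<And>y. y \<in> extensional I \<Longrightarrow> \<bar>F y\<bar> \<le> B" and bD: "\<And>y. y \<in> extensional I \<Longrightarrow> \<bar>D y\<bar> \<le> B"
    and byF: "\<And>y. y \<in> extensional I \<Longrightarrow> \<bar>y p * F y\<bar> \<le> B"
    and der: "\<And>y x. y \<in> extensional I \<Longrightarrow> ((\<lambda>x. F (y(p := x))) has_real_derivative D (y(p := x))) (at x)"
    and con: "\<And>y x. y \<in> extensional I \<Longrightarrow> isCont (\<lambda>x. D (y(p := x))) x"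
  shows "integrable (Pi\<^sub>M I M) D" "integrable (Pi\<^sub>M I M) (\<lambda>y. y p / (\<sigma> p)\<^sup>2 * F y)"
    "(\<integral>y. D y \<partial>Pi\<^sub>M I M) = (\<integral>y. y p / (\<sigma> p)\<^sup>2 * F y \<partial>Pi\<^sub>M I M)"
proof -
  have pM: "prob_space (M i)" for i
    unfolding M_def using s by (auto intro!: prob_space_normal_density prob_space_return)
  interpret product_prob_space M I by (rule product_prob_spaceI) (rule pM)
  interpret P: prob_space "Pi\<^sub>M I M" by (rule prob_space_PiM) (rule pM)
  have spM: "space (M i) = UNIV" "sets (M i) = sets borel" for i by (auto simp: M_def)
  have sp: "space (Pi\<^sub>M J M) = extensional J" for J by (auto simp: space_PiM spM PiE_def)
  have comp[measurable]: "(\<lambda>y. y p) \<in> borel_measurable (Pi\<^sub>M I M)"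
    using measurable_component_singleton[OF p, of M] unfolding measurable_cong_sets[OF refl spM(2)] .
  show iD: "integrable (Pi\<^sub>M I M) D"
    by (rule P.integrable_const_bound[of _ B]) (rule AE_I2, simp add: sp bD, rule mD)
  show iF: "integrable (Pi\<^sub>M I M) (\<lambda>y. y p / (\<sigma> p)\<^sup>2 * F y)"
  proof (rule P.integrable_const_bound[of _ "B / (\<sigma> p)\<^sup>2"])
    show "AE y in Pi\<^sub>M I M. norm (y p / (\<sigma> p)\<^sup>2 * F y) \<le> B / (\<sigma> p)\<^sup>2"
    proof (rule AE_I2)
      fix y assume "y \<in> space (Pi\<^sub>M I M)"
      then have "\<bar>y p * F y\<bar> \<le> B" using byF by (simp add: sp)
      then have "\<bar>y p * F y\<bar> / (\<sigma> p)\<^sup>2 \<le> B / (\<sigma> p)\<^sup>2" by (rule divide_right_mono) simp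
      then show "norm (y p / (\<sigma> p)\<^sup>2 * F y) \<le> B / (\<sigma> p)\<^sup>2" by (simp add: abs_mult)
    qed
  qed measurable
  have Mp: "M p = density lborel (\<lambda>x. ennreal (normal_density 0 (\<sigma> p) x))" using p by (simp add: M_def)
  define J where "J = I - {p}"
  have IJ: "I = insert p J" "p \<notin> J" "finite J" using p fin by (auto simp: J_def)
  have "(\<integral>y. D y \<partial>Pi\<^sub>M I M) = (\<integral>z. (\<integral>x. D (z(p := x)) \<partial>M p) \<partial>Pi\<^sub>M J M)"
    using product_integral_insert[OF IJ(3,2), of D] iD IJ(1) by simp
  also have "\<dots> = (\<integral>z. (\<integral>x. x / (\<sigma> p)\<^sup>2 * F (z(p := x)) \<partial>M p) \<partial>Pi\<^sub>M J M)"
  proof (rule Bochner_Integration.integral_cong[OF refl])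
    fix z assume "z \<in> space (Pi\<^sub>M J M)"
    then have z: "z \<in> extensional J" by (simp add: sp)
    define y where "y = z(p := 0)"
    have ext: "z(p := x) \<in> extensional I" for x
      using z IJ by (auto simp: extensional_def)
    have yz: "y(p := x) = z(p := x)" for x by (simp add: y_def)
    have y: "y \<in> extensional I" using ext by (simp add: y_def)
    show "(\<integral>x. D (z(p := x)) \<partial>M p) = (\<integral>x. x / (\<sigma> p)\<^sup>2 * F (z(p := x)) \<partial>M p)"
      unfolding Mp
      by (rule gaussian_integration_by_parts_1d[OF s[OF p] der[OF y, unfolded yz] con[OF y, unfolded yz] bF[OF ext] bD[OF ext]])
  qed
  also have "\<dots> = (\<integral>y. y p / (\<sigma> p)\<^sup>2 * F y \<partial>Pi\<^sub>M I M)"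
  proof -
    have "(\<integral>y. y p / (\<sigma> p)\<^sup>2 * F y \<partial>Pi\<^sub>M I M) = (\<integral>z. (\<integral>x. (z(p := x)) p / (\<sigma> p)\<^sup>2 * F (z(p := x)) \<partial>M p) \<partial>Pi\<^sub>M J M)"
      by (rule product_integral_insert[OF IJ(3,2), folded IJ(1), OF iF])
    then show ?thesis unfolding fun_upd_same by (rule sym)
  qed
  finally show "(\<integral>y. D y \<partial>Pi\<^sub>M I M) = (\<integral>y. y p / (\<sigma> p)\<^sup>2 * F y \<partial>Pi\<^sub>M I M)" .
qed

text \<open>
  The free entries of a symmetric matrix are those on and above the diagonal, and an entry off the
  diagonal occurs twice in the matrix. This lemma turns sums over the free entries into traces.
\<close>

lemma sum_upper_indices:
  fixes h :: "nat \<Rightarrow> nat \<Rightarrow> real"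
  assumes sym: "\<And>i j. i < d \<Longrightarrow> j < d \<Longrightarrow> h i j = h j i"
  shows "(\<Sum>p\<in>upper_indices d. (if fst p = snd p then 1 else 2) * h (fst p) (snd p)) = (\<Sum>i<d. \<Sum>j<d. h i j)"
proof -
  let ?D = "(\<lambda>i. (i, i)) ` {..<d}" and ?U = "{(i, j). i < j \<and> j < d}" and ?L = "{(i, j). j < i \<and> i < d}"
  have fin: "finite ?D" "finite ?U" "finite ?L"
    by (auto intro: finite_subset[of _ "{..<d} \<times> {..<d}"])
  let ?h = "\<lambda>p. h (fst p) (snd p)"
  have L: "sum ?h ?L = sum ?h ?U"
    by (rule sum.reindex_bij_witness[of _ prod.swap prod.swap]) (use sym in auto)
  have "upper_indices d = ?D \<union> ?U" by (auto simp: upper_indices_def)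
  then have "(\<Sum>p\<in>upper_indices d. (if fst p = snd p then 1 else 2) * ?h p)
    = (\<Sum>p\<in>?D. (if fst p = snd p then 1 else 2) * ?h p) + (\<Sum>p\<in>?U. (if fst p = snd p then 1 else 2) * ?h p)"
    using fin by (subst sum.union_disjoint[symmetric]) auto
  also have "(\<Sum>p\<in>?D. (if fst p = snd p then 1 else 2) * ?h p) = sum ?h ?D"
    by (intro sum.cong) auto
  also have "(\<Sum>p\<in>?U. (if fst p = snd p then 1 else 2) * ?h p) = (\<Sum>p\<in>?U. 2 * ?h p)"
    by (intro sum.cong) auto
  also have "\<dots> = sum ?h ?U + sum ?h ?L" using L by (simp add: sum_distrib_left[symmetric])
  also have "sum ?h ?U + sum ?h ?L = sum ?h (?U \<union> ?L)"
    by (rule sum.union_disjoint[symmetric]) (use fin in auto)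
  also have "sum ?h ?D + sum ?h (?U \<union> ?L) = sum ?h (?D \<union> (?U \<union> ?L))"
    by (rule sum.union_disjoint[symmetric]) (use fin in auto)
  also have "?D \<union> (?U \<union> ?L) = {..<d} \<times> {..<d}"
  proof (rule Set.set_eqI)
    show "p \<in> ?D \<union> (?U \<union> ?L) \<longleftrightarrow> p \<in> {..<d} \<times> {..<d}" for p
      by (cases p) (auto simp: image_iff)
  qed
  also have "sum ?h \<dots> = (\<Sum>i<d. \<Sum>j<d. h i j)" by (simp add: sum.cartesian_product case_prod_unfold)
  finally show ?thesis .
qed

section \<open>Derivatives of matrix powers in the entries\<close>

lemma sym_mat_of_upper_sym: "sym_mat_of_upper d y \<in> sym_mats d"
  unfolding sym_mats_def sym_mat_of_upper_def by (auto simp: min.commute max.commute)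

lemma sym_mat_of_upper_index:
  "r < d \<Longrightarrow> s < d \<Longrightarrow> sym_mat_of_upper d y $$ (r, s) = y (min r s, max r s)"
  by (simp add: sym_mat_of_upper_def)

text \<open>
  The derivative of the entry (r, s) of \<open>A ^ m\<close> when the free entry p = (i, j) of the symmetric matrix
  A moves. By the product rule it is the sum over a of the entries of
  \<open>A ^ a * E * A ^ (m - 1 - a)\<close>, where E is the symmetric matrix with a 1 at (i, j) and at (j, i) and
  0 elsewhere. The second summand is the entry (j, i), which coincides with (i, j) on the diagonal.
\<close>

definition dpow :: "real mat \<Rightarrow> nat \<Rightarrow> nat \<times> nat \<Rightarrow> nat \<Rightarrow> nat \<Rightarrow> real" where
  "dpow A m p r s = (\<Sum>a<m. (A ^\<^sub>m a) $$ (r, fst p) * (A ^\<^sub>m (m - 1 - a)) $$ (snd p, s)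
     + of_bool (fst p \<noteq> snd p) * ((A ^\<^sub>m a) $$ (r, snd p) * (A ^\<^sub>m (m - 1 - a)) $$ (fst p, s)))"

text \<open>
  The product rule for \<open>A ^ Suc m = A ^ m * A\<close>.
\<close>

lemma dpow_Suc:
  assumes A: "A \<in> carrier_mat d d" and p: "p \<in> upper_indices d" and r: "r < d" "s < d"
  shows "dpow A (Suc m) p r s = (\<Sum>l<d. dpow A m p r l * A $$ (l, s) + (A ^\<^sub>m m) $$ (r, l) * of_bool (p = (min l s, max l s)))"
proof -
  obtain i j where ij: "p = (i, j)" "i \<le> j" "j < d" "i < d" using p by (auto simp: upper_indices_def)
  \<comment> \<open>The entry (l, s) of the direction E is split according to whether l = i or l = j.\<close>
  have E: "of_bool (p = (min l s, max l s)) = (if l = i then of_bool (j = s) else 0) + (if l = j then of_bool (i \<noteq> j) * of_bool (i = s) else (0::real))" for l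
    using ij by (auto simp: min_def max_def)
  have 2: "(\<Sum>l<d. (A ^\<^sub>m m) $$ (r, l) * of_bool (p = (min l s, max l s)))
    = (A ^\<^sub>m m) $$ (r, i) * of_bool (j = s) + of_bool (i \<noteq> j) * ((A ^\<^sub>m m) $$ (r, j) * of_bool (i = s))"
  proof -
    have "(\<Sum>l<d. (A ^\<^sub>m m) $$ (r, l) * of_bool (p = (min l s, max l s)))
      = (\<Sum>l<d. (if l = i then (A ^\<^sub>m m) $$ (r, l) * of_bool (j = s) else 0)) + (\<Sum>l<d. if l = j then (A ^\<^sub>m m) $$ (r, l) * (of_bool (i \<noteq> j) * of_bool (i = s)) else 0)"
      unfolding E sum.distrib[symmetric] by (intro sum.cong refl) (simp add: distrib_left)
    then show ?thesis using ij by simp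
  qed
  have 1: "(\<Sum>l<d. dpow A m p r l * A $$ (l, s)) = (\<Sum>a<m. (A ^\<^sub>m a) $$ (r, i) * (A ^\<^sub>m (m - a)) $$ (j, s)
     + of_bool (i \<noteq> j) * ((A ^\<^sub>m a) $$ (r, j) * (A ^\<^sub>m (m - a)) $$ (i, s)))"
  proof -
    have "(\<Sum>l<d. dpow A m p r l * A $$ (l, s)) = (\<Sum>a<m. \<Sum>l<d. ((A ^\<^sub>m a) $$ (r, i) * (A ^\<^sub>m (m - 1 - a)) $$ (j, l)
     + of_bool (i \<noteq> j) * ((A ^\<^sub>m a) $$ (r, j) * (A ^\<^sub>m (m - 1 - a)) $$ (i, l))) * A $$ (l, s))"
      unfolding dpow_def ij(1) fst_conv snd_conv sum_distrib_right by (rule sum.swap)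
    also have "\<dots> = (\<Sum>a<m. (A ^\<^sub>m a) $$ (r, i) * (A ^\<^sub>m (m - a)) $$ (j, s)
     + of_bool (i \<noteq> j) * ((A ^\<^sub>m a) $$ (r, j) * (A ^\<^sub>m (m - a)) $$ (i, s)))"
    proof (rule sum.cong[OF refl])
      fix a assume "a \<in> {..<m}"
      then have a: "m - a = Suc (m - 1 - a)" by auto
      show "(\<Sum>l<d. ((A ^\<^sub>m a) $$ (r, i) * (A ^\<^sub>m (m - 1 - a)) $$ (j, l)
     + of_bool (i \<noteq> j) * ((A ^\<^sub>m a) $$ (r, j) * (A ^\<^sub>m (m - 1 - a)) $$ (i, l))) * A $$ (l, s))
      = (A ^\<^sub>m a) $$ (r, i) * (A ^\<^sub>m (m - a)) $$ (j, s)
     + of_bool (i \<noteq> j) * ((A ^\<^sub>m a) $$ (r, j) * (A ^\<^sub>m (m - a)) $$ (i, s))"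
        unfolding a pow_mat_Suc_index[OF A ij(3) r(2)] pow_mat_Suc_index[OF A ij(4) r(2)] sum_distrib_left sum.distrib[symmetric]
        by (intro sum.cong refl) (simp only: distrib_right mult.assoc)
    qed
    finally show ?thesis .
  qed
  show ?thesis
    unfolding sum.distrib 1 2
    using pow_mat_0_index[OF A ij(3) r(2)] pow_mat_0_index[OF A ij(4) r(2)] A
    by (simp add: dpow_def ij(1) del: pow_mat.simps)
qed

context
  fixes d :: nat and p :: "nat \<times> nat" and y :: "nat \<times> nat \<Rightarrow> real"
  assumes p: "p \<in> upper_indices d"
begin

private abbreviation (input) "curve x \<equiv> sym_mat_of_upper d (y(p := x))"

lemma has_derivative_pow_entry:
  assumes r: "r < d" "s < d"
  shows "((\<lambda>x. (curve x ^\<^sub>m m) $$ (r, s)) has_real_derivative dpow (curve x) m p r s) (at x)"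
  using r
proof (induction m arbitrary: s)
  case 0
  have e: "(\<lambda>x. (curve x ^\<^sub>m 0) $$ (r, s)) = (\<lambda>x. of_bool (r = s))"
    using pow_mat_0_index[OF sym_matsD(1)[OF sym_mat_of_upper_sym] 0] by blast
  show ?case unfolding e by (simp add: dpow_def)
next
  case (Suc m)
  note C = sym_matsD(1)[OF sym_mat_of_upper_sym]
  have E: "((\<lambda>x. curve x $$ (l, s)) has_real_derivative of_bool (p = (min l s, max l s))) (at x)" if "l < d" for l
    unfolding sym_mat_of_upper_index[OF that Suc.prems(2)] fun_upd_apply
    by (cases "p = (min l s, max l s)") auto
  have e: "(\<lambda>x. (curve x ^\<^sub>m Suc m) $$ (r, s)) = (\<lambda>x. \<Sum>l<d. (curve x ^\<^sub>m m) $$ (r, l) * curve x $$ (l, s))"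
    by (rule ext) (rule pow_mat_Suc_index[OF C Suc.prems])
  show ?case unfolding e dpow_Suc[OF C p Suc.prems]
  proof (rule DERIV_sum)
    fix l assume "l \<in> {..<d}"
    then have l: "l < d" by simp
    show "((\<lambda>x. (curve x ^\<^sub>m m) $$ (r, l) * curve x $$ (l, s)) has_real_derivative
      dpow (curve x) m p r l * curve x $$ (l, s) + (curve x ^\<^sub>m m) $$ (r, l) * of_bool (p = (min l s, max l s))) (at x)"
      by (rule DERIV_cong[OF DERIV_mult[OF Suc.IH[OF Suc.prems(1) l] E[OF l]]]) (simp only: mult.commute)
  qed
qed

lemma isCont_pow_entry:
  "r < d \<Longrightarrow> s < d \<Longrightarrow> isCont (\<lambda>x. (curve x ^\<^sub>m m) $$ (r, s)) x"
  using has_derivative_pow_entry DERIV_isCont by blast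

lemma isCont_dpow:
  assumes r: "r < d" "s < d"
  shows "isCont (\<lambda>x. dpow (curve x) m p r s) x"
proof -
  have "fst p < d" "snd p < d" using p by (auto simp: upper_indices_def)
  with r show ?thesis unfolding dpow_def by (intro continuous_intros isCont_pow_entry)
qed

text \<open>
  The gradient of tr (A^m): by cyclicity of the trace all m terms of the product rule agree.
\<close>

lemma sum_dpow_diag:
  assumes A: "A \<in> sym_mats d"
  shows "(\<Sum>r<d. dpow A m p r r) = real m * ((if fst p = snd p then 1 else 2) * (A ^\<^sub>m (m - 1)) $$ p)"
proof -
  obtain i j where ij: "p = (i, j)" "i \<le> j" "j < d" "i < d" using p by (auto simp: upper_indices_def)
  note A' = sym_matsD[OF A]
  have "(\<Sum>r<d. dpow A m p r r) = (\<Sum>a<m. \<Sum>r<d. (A ^\<^sub>m a) $$ (r, i) * (A ^\<^sub>m (m - 1 - a)) $$ (j, r)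
     + of_bool (i \<noteq> j) * ((A ^\<^sub>m a) $$ (r, j) * (A ^\<^sub>m (m - 1 - a)) $$ (i, r)))"
    unfolding dpow_def ij(1) fst_conv snd_conv by (rule sum.swap)
  also have "\<dots> = (\<Sum>a<m. (if i = j then 1 else 2) * (A ^\<^sub>m (m - 1)) $$ (i, j))"
  proof (rule sum.cong[OF refl])
    fix a assume "a \<in> {..<m}"
    then have a: "(m - 1 - a) + a = m - 1" by auto
    have "(\<Sum>r<d. (A ^\<^sub>m a) $$ (r, i) * (A ^\<^sub>m (m - 1 - a)) $$ (j, r)) = (A ^\<^sub>m (m - 1)) $$ (j, i)" if "i < d" "j < d" for i j
      using pow_mat_add_index[OF A'(1) that(2,1), of "m - 1 - a" a] unfolding a by (simp only: mult.commute)
    note this[OF ij(4,3)] this[OF ij(3,4)]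
    then show "(\<Sum>r<d. (A ^\<^sub>m a) $$ (r, i) * (A ^\<^sub>m (m - 1 - a)) $$ (j, r)
     + of_bool (i \<noteq> j) * ((A ^\<^sub>m a) $$ (r, j) * (A ^\<^sub>m (m - 1 - a)) $$ (i, r))) = (if i = j then 1 else 2) * (A ^\<^sub>m (m - 1)) $$ (i, j)"
      unfolding sum.distrib sum_distrib_left[symmetric] pow_mat_symmetric[OF A ij(3,4), of "m - 1"] by simp
  qed
  finally show ?thesis by (simp add: ij(1))
qed

lemma has_derivative_power_trace:
  "((\<lambda>x. power_trace (curve x) m) has_real_derivative
    real m * ((if fst p = snd p then 1 else 2) * (curve x ^\<^sub>m (m - 1)) $$ p)) (at x)"
proof -
  have e: "(\<lambda>x. power_trace (curve x) m) = (\<lambda>x. \<Sum>r<d. (curve x ^\<^sub>m m) $$ (r, r))"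
    by (rule ext) (rule power_trace_eq_sum_diag[OF sym_matsD(1)[OF sym_mat_of_upper_sym]])
  show ?thesis
    unfolding e sum_dpow_diag[OF sym_mat_of_upper_sym, symmetric]
    by (rule DERIV_sum) (rule has_derivative_pow_entry, simp_all)
qed

end

text \<open>
  The divergence of the vector field \<open>A ^ k\<close> on the space of symmetric matrices. The product of
  traces comes from the diagonal entries of the two powers, the term with the factor k from the
  symmetry constraint, which couples the entries (i, j) and (j, i).
\<close>

lemma sum_dpow_self:
  assumes A: "A \<in> sym_mats d"
  shows "(\<Sum>p\<in>upper_indices d. dpow A k p (fst p) (snd p))
    = ((\<Sum>a<k. power_trace A a * power_trace A (k - 1 - a)) + real k * power_trace A (k - 1)) / 2"
proof -
  \<comment> \<open>Reversing the sum over a shows that h is symmetric, as \<open>sum_upper_indices\<close> requires.\<close>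
  define h where "h i j = (\<Sum>a<k. (A ^\<^sub>m a) $$ (i, i) * (A ^\<^sub>m (k - 1 - a)) $$ (j, j)
     + (A ^\<^sub>m a) $$ (i, j) * (A ^\<^sub>m (k - 1 - a)) $$ (i, j))" for i j
  have sym: "h i j = h j i" if "i < d" "j < d" for i j
  proof -
    have "(\<Sum>a<k. (A ^\<^sub>m a) $$ (i, i) * (A ^\<^sub>m (k - 1 - a)) $$ (j, j)) = (\<Sum>a<k. (A ^\<^sub>m a) $$ (j, j) * (A ^\<^sub>m (k - 1 - a)) $$ (i, i))"
      by (rule sum.reindex_bij_witness[of _ "\<lambda>a. k - 1 - a" "\<lambda>a. k - 1 - a"]) auto
    then show ?thesis unfolding h_def sum.distrib
      by (simp only: pow_mat_symmetric[OF A that])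
  qed
  have "dpow A k p (fst p) (snd p) = (if fst p = snd p then 1 else 2) * (h (fst p) (snd p) / 2)" if p: "p \<in> upper_indices d" for p
  proof -
    obtain i j where ij: "p = (i, j)" "i \<le> j" "j < d" "i < d" using p by (auto simp: upper_indices_def)
    have "(A ^\<^sub>m m) $$ (j, i) = (A ^\<^sub>m m) $$ (i, j)" for m by (rule pow_mat_symmetric[OF A ij(3,4)])
    then show ?thesis
      by (cases "i = j") (simp_all add: dpow_def h_def ij(1) sum.distrib flip: sum_distrib_left)
  qed
  then have "(\<Sum>p\<in>upper_indices d. dpow A k p (fst p) (snd p))
    = (\<Sum>p\<in>upper_indices d. (if fst p = snd p then 1 else 2) * (h (fst p) (snd p) / 2))"
    by (rule sum.cong[OF refl])
  also have "\<dots> = (\<Sum>i<d. \<Sum>j<d. h i j / 2)"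
    by (rule sum_upper_indices) (simp add: sym)
  also have "\<dots> = (\<Sum>i<d. \<Sum>j<d. h i j) / 2" by (simp add: sum_divide_distrib)
  also have "(\<Sum>i<d. \<Sum>j<d. h i j) = (\<Sum>a<k. \<Sum>i<d. \<Sum>j<d. (A ^\<^sub>m a) $$ (i, i) * (A ^\<^sub>m (k - 1 - a)) $$ (j, j)
     + (A ^\<^sub>m a) $$ (i, j) * (A ^\<^sub>m (k - 1 - a)) $$ (i, j))"
    unfolding h_def by (subst sum.swap[of _ "{..<k}"]) (subst sum.swap[of _ "{..<k}"], rule refl)
  also have "\<dots> = (\<Sum>a<k. power_trace A a * power_trace A (k - 1 - a) + power_trace A (k - 1))"
  proof (rule sum.cong[OF refl])
    fix a assume "a \<in> {..<k}"
    then have a: "a + (k - 1 - a) = k - 1" by auto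
    show "(\<Sum>i<d. \<Sum>j<d. (A ^\<^sub>m a) $$ (i, i) * (A ^\<^sub>m (k - 1 - a)) $$ (j, j)
     + (A ^\<^sub>m a) $$ (i, j) * (A ^\<^sub>m (k - 1 - a)) $$ (i, j)) = power_trace A a * power_trace A (k - 1 - a) + power_trace A (k - 1)"
      using power_trace_add[OF A, of a "k - 1 - a"] unfolding a sum.distrib
      by (simp add: power_trace_eq_sum_diag[OF sym_matsD(1)[OF A]] sum_product)
  qed
  finally show ?thesis by (simp add: sum.distrib)
qed

section \<open>The loop observable and its derivative along the flow\<close>

definition conv_moments :: "(nat \<Rightarrow> 'a::comm_ring_1) \<Rightarrow> nat \<Rightarrow> 'a" where
  "conv_moments t k = (\<Sum>a<k. t a * t (k - 1 - a))"

text \<open>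
  If t is the moment sequence of a probability measure \<open>\<mu>\<close> and h(x) = (c - x^2) x^k, this is the double
  integral of (h(x) - h(y)) / (x - y) against \<open>\<mu> \<otimes> \<mu>\<close> minus the integral of x h(x) against \<open>\<mu>\<close>. The
  divided difference of x^k contributes \<open>conv_moments t k\<close>.
\<close>

definition loop_defect :: "'a::comm_ring_1 \<Rightarrow> (nat \<Rightarrow> 'a) \<Rightarrow> nat \<Rightarrow> 'a" where
  "loop_defect c t k = c * conv_moments t k - conv_moments t (k + 2) - c * t (k + 1) + t (k + 3)"

definition norm_trace :: "real mat \<Rightarrow> nat \<Rightarrow> real" where
  "norm_trace A m = power_trace A m / real (dim_row A)"

text \<open>
  The part of the loop equation that is linear in the moments. The terms divided by d are the
  finite-size correction that comes from the second summand in \<open>sum_dpow_self\<close>.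
\<close>

definition loop_linear :: "real \<Rightarrow> nat \<Rightarrow> nat \<Rightarrow> (nat \<Rightarrow> real) \<Rightarrow> real" where
  "loop_linear \<kappa> k d t = t (k + 3) - \<kappa>\<^sup>2 * t (k + 1) + (\<kappa>\<^sup>2 * real k * t (k - 1) - real (k + 2) * t (k + 1)) / real d"

definition loop_stat :: "real \<Rightarrow> nat \<Rightarrow> nat \<Rightarrow> (nat \<Rightarrow> real) \<Rightarrow> real" where
  "loop_stat \<kappa> k d t = \<kappa>\<^sup>2 * conv_moments t k - conv_moments t (k + 2) + loop_linear \<kappa> k d t"

text \<open>
  The derivative of \<open>conv_moments\<close> at t in the direction s.
\<close>

definition dconv :: "(nat \<Rightarrow> real) \<Rightarrow> (nat \<Rightarrow> real) \<Rightarrow> nat \<Rightarrow> real" where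
  "dconv t s k = (\<Sum>a<k. s a * t (k - 1 - a) + t a * s (k - 1 - a))"

definition dloop_stat :: "real \<Rightarrow> nat \<Rightarrow> nat \<Rightarrow> (nat \<Rightarrow> real) \<Rightarrow> (nat \<Rightarrow> real) \<Rightarrow> real" where
  "dloop_stat \<kappa> k d t s = \<kappa>\<^sup>2 * dconv t s k - dconv t s (k + 2) + loop_linear \<kappa> k d s"

text \<open>
  The speed of the normalized trace of W^m along the flow of (\<open>\<kappa>\<close>^2 - W^2) W^k.
\<close>

definition mom_flow :: "real \<Rightarrow> nat \<Rightarrow> (nat \<Rightarrow> real) \<Rightarrow> nat \<Rightarrow> real" where
  "mom_flow \<kappa> k t m = real m * (\<kappa>\<^sup>2 * t (k + (m - 1)) - t (k + 2 + (m - 1)))"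

lemma has_derivative_loop_stat:
  assumes "\<And>m. ((\<lambda>x. t x m) has_real_derivative s m) (at x)"
  shows "((\<lambda>x. loop_stat \<kappa> k d (t x)) has_real_derivative dloop_stat \<kappa> k d (t x) s) (at x)"
proof -
  have c: "((\<lambda>x. conv_moments (t x) k) has_real_derivative dconv (t x) s k) (at x)" for k
    unfolding conv_moments_def dconv_def
    by (rule DERIV_sum) (rule DERIV_cong[OF DERIV_mult[OF assms assms]], simp add: mult.commute)
  show ?thesis
    unfolding loop_stat_def dloop_stat_def loop_linear_def
    by (intro DERIV_add DERIV_diff DERIV_cmult DERIV_cdivide c assms)
qed

lemma dconv_linear:
  "(\<Sum>p\<in>P. c p * dconv t (s p) k) = dconv t (\<lambda>m. \<Sum>p\<in>P. c p * s p m) k"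
  unfolding dconv_def sum_distrib_left sum_distrib_right
  by (subst sum.swap) (simp add: sum.distrib distrib_left ac_simps)

text \<open>
  Linearity in the direction allows one to insert the vector field into the gradient of the loop
  observable: it is enough to know how the field moves the normalized traces.
\<close>

lemma dloop_stat_linear:
  "(\<Sum>p\<in>P. c p * dloop_stat \<kappa> k d t (s p)) = dloop_stat \<kappa> k d t (\<lambda>m. \<Sum>p\<in>P. c p * s p m)"
  unfolding dloop_stat_def loop_linear_def dconv_linear[symmetric]
  by (simp add: sum.distrib sum_subtractf distrib_left right_diff_distrib diff_divide_distrib add_divide_distrib sum_divide_distrib sum_distrib_left ac_simps)

section \<open>Polynomial growth, the smooth cutoff and measurability\<close>

text \<open>
  Observables that are measurable and of polynomial growth in the Frobenius norm, whose square is
  \<open>power_trace A 2\<close>. The class is closed under ring operations and contains the entries, hence it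
  contains everything that occurs in the loop identity except the cutoff weight.
\<close>

definition tame :: "nat \<Rightarrow> (real mat \<Rightarrow> real) \<Rightarrow> bool" where
  "tame d G \<longleftrightarrow> G \<in> borel_measurable (sym_mat_algebra d) \<and>
     (\<exists>C K. C \<ge> 0 \<and> (\<forall>A\<in>sym_mats d. \<bar>G A\<bar> \<le> C * (1 + power_trace A 2) ^ K))"

lemma tameI:
  assumes "G \<in> borel_measurable (sym_mat_algebra d)"
    and "C \<ge> 0" "\<And>A. A \<in> sym_mats d \<Longrightarrow> \<bar>G A\<bar> \<le> C * (1 + power_trace A 2) ^ K"
  shows "tame d G"
  unfolding tame_def using assms by blast

lemma tame_measurable: "tame d G \<Longrightarrow> G \<in> borel_measurable (sym_mat_algebra d)"
  by (simp add: tame_def)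

lemma one_le_frobenius: "A \<in> sym_mats d \<Longrightarrow> 1 \<le> 1 + power_trace A 2"
  using power_trace_even_nonneg[of A d 1] by simp

lemma tame_const: "tame d (\<lambda>_. c)"
  by (rule tameI[of _ _ "\<bar>c\<bar>" 0]) auto

lemma tame_mult:
  assumes "tame d F" "tame d G"
  shows "tame d (\<lambda>A. F A * G A)"
proof -
  from assms obtain C K C' K' where
    *: "C \<ge> 0" "\<And>A. A \<in> sym_mats d \<Longrightarrow> \<bar>F A\<bar> \<le> C * (1 + power_trace A 2) ^ K"
       "C' \<ge> 0" "\<And>A. A \<in> sym_mats d \<Longrightarrow> \<bar>G A\<bar> \<le> C' * (1 + power_trace A 2) ^ K'"
    unfolding tame_def by blast
  show ?thesis
  proof (rule tameI[of _ _ "C * C'" "K + K'"])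
    show "(\<lambda>A. F A * G A) \<in> borel_measurable (sym_mat_algebra d)"
      using assms by (intro borel_measurable_times tame_measurable)
    fix A assume A: "A \<in> sym_mats d"
    have n: "0 \<le> 1 + power_trace A 2" using one_le_frobenius[OF A] by linarith
    have "\<bar>F A\<bar> * \<bar>G A\<bar> \<le> (C * (1 + power_trace A 2) ^ K) * (C' * (1 + power_trace A 2) ^ K')"
      by (rule mult_mono) (use *(2,4)[OF A] *(1) n in auto)
    then show "\<bar>F A * G A\<bar> \<le> C * C' * (1 + power_trace A 2) ^ (K + K')"
      by (simp add: abs_mult power_add mult_ac)
  qed (use * in simp)
qed

lemma tame_add:
  assumes "tame d F" "tame d G"
  shows "tame d (\<lambda>A. F A + G A)"
proof -
  from assms obtain C K C' K' where
    *: "C \<ge> 0" "\<And>A. A \<in> sym_mats d \<Longrightarrow> \<bar>F A\<bar> \<le> C * (1 + power_trace A 2) ^ K"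
       "C' \<ge> 0" "\<And>A. A \<in> sym_mats d \<Longrightarrow> \<bar>G A\<bar> \<le> C' * (1 + power_trace A 2) ^ K'"
    unfolding tame_def by blast
  show ?thesis
  proof (rule tameI[of _ _ "C + C'" "K + K'"])
    show "(\<lambda>A. F A + G A) \<in> borel_measurable (sym_mat_algebra d)"
      using assms by (intro borel_measurable_add tame_measurable)
    fix A assume A: "A \<in> sym_mats d"
    have "C * (1 + power_trace A 2) ^ K \<le> C * (1 + power_trace A 2) ^ (K + K')"
      "C' * (1 + power_trace A 2) ^ K' \<le> C' * (1 + power_trace A 2) ^ (K + K')"
      using *(1,3) one_le_frobenius[OF A] by (intro mult_left_mono power_increasing; simp)+
    then have "\<bar>F A\<bar> + \<bar>G A\<bar> \<le> C * (1 + power_trace A 2) ^ (K + K') + C' * (1 + power_trace A 2) ^ (K + K')"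
      using *(2,4)[OF A] by linarith
    then show "\<bar>F A + G A\<bar> \<le> (C + C') * (1 + power_trace A 2) ^ (K + K')"
      unfolding distrib_right using abs_triangle_ineq[of "F A" "G A"] by linarith
  qed (use * in simp)
qed

lemma tame_diff: "tame d F \<Longrightarrow> tame d G \<Longrightarrow> tame d (\<lambda>A. F A - G A)"
  using tame_add[OF _ tame_mult[OF tame_const[of d "-1"]], of F G] by simp

lemma tame_sum: "(\<And>i. i \<in> I \<Longrightarrow> tame d (F i)) \<Longrightarrow> tame d (\<lambda>A. \<Sum>i\<in>I. F i A)"
  by (induction I rule: infinite_finite_induct) (auto intro: tame_add tame_const)

lemma tame_divide: "tame d F \<Longrightarrow> tame d (\<lambda>A. F A / c)"
  using tame_mult[OF _ tame_const[of d "inverse c"], of F] by (simp add: divide_inverse)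

lemma tame_cong: "(\<And>A. A \<in> sym_mats d \<Longrightarrow> F A = G A) \<Longrightarrow> tame d G \<Longrightarrow> tame d F"
  unfolding tame_def space_sym_mat_algebra[symmetric] using measurable_cong[of "sym_mat_algebra d" F G borel] by simp

lemma tame_entry:
  assumes "r < d" "s < d"
  shows "tame d (\<lambda>A. A $$ (r, s))"
proof (rule tameI[of _ _ 1 1])
  show "(\<lambda>A. A $$ (r, s)) \<in> borel_measurable (sym_mat_algebra d)" by (rule measurable_entry[OF assms])
  fix A assume A: "A \<in> sym_mats d"
  have A1: "A ^\<^sub>m 1 = A" using sym_matsD(1)[OF A] by simp
  have "(A $$ (r, s))\<^sup>2 \<le> power_trace A 2" using pow_entry_squared_le[OF A assms, of 1] A1 by simp
  moreover have "\<bar>x\<bar> \<le> 1 + x\<^sup>2" for x :: real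
  proof -
    have "0 \<le> (\<bar>x\<bar> - 1)\<^sup>2" by simp
    then have "2 * \<bar>x\<bar> \<le> 1 + x\<^sup>2" unfolding power2_diff by simp
    then show ?thesis using abs_ge_zero[of x] by linarith
  qed
  ultimately show "\<bar>A $$ (r, s)\<bar> \<le> 1 * (1 + power_trace A 2) ^ 1" 
    using order.trans by (metis add_left_mono mult_1 power_one_right)
qed simp

lemma tame_pow_entry:
  assumes "r < d" "s < d"
  shows "tame d (\<lambda>A. (A ^\<^sub>m m) $$ (r, s))"
  using assms
proof (induction m arbitrary: s)
  case 0
  then show ?case
    by (intro tame_cong[OF pow_mat_0_index[OF sym_matsD(1)] tame_const])
next
  case (Suc m)
  have "tame d (\<lambda>A. \<Sum>l<d. (A ^\<^sub>m m) $$ (r, l) * A $$ (l, s))"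
    by (intro tame_sum tame_mult tame_entry Suc.IH) (use Suc.prems in auto)
  then show ?case
    by (rule tame_cong[rotated]) (rule pow_mat_Suc_index[OF sym_matsD(1) Suc.prems])
qed

lemma tame_dpow:
  assumes "r < d" "s < d" "p \<in> upper_indices d"
  shows "tame d (\<lambda>A. dpow A m p r s)"
  unfolding dpow_def using assms
  by (intro tame_sum tame_add tame_mult tame_const tame_pow_entry) (auto simp: upper_indices_def)

lemma tame_power_trace: "tame d (\<lambda>A. power_trace A m)"
proof (rule tame_cong[rotated])
  show "tame d (\<lambda>A. \<Sum>i<d. (A ^\<^sub>m m) $$ (i, i))"
    by (intro tame_sum tame_pow_entry) auto
qed (rule power_trace_eq_sum_diag[OF sym_matsD(1)])

lemma tame_norm_trace: "tame d (\<lambda>A. norm_trace A m)"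
proof (rule tame_cong)
  show "norm_trace A m = power_trace A m / real d" if "A \<in> sym_mats d" for A
    using sym_matsD(1)[OF that] by (simp add: norm_trace_def)
qed (intro tame_divide tame_power_trace)

lemma tame_loop_stat:
  "(\<And>m. tame d (\<lambda>A. t A m)) \<Longrightarrow> tame d (\<lambda>A. loop_stat \<kappa> k d (t A))"
  unfolding loop_stat_def loop_linear_def conv_moments_def
  by (intro tame_sum tame_add tame_diff tame_mult tame_divide tame_const)

lemma tame_dloop_stat:
  "(\<And>m. tame d (\<lambda>A. t A m)) \<Longrightarrow> (\<And>m. tame d (\<lambda>A. s A m)) \<Longrightarrow> tame d (\<lambda>A. dloop_stat \<kappa> k d (t A) (s A))"
  unfolding dloop_stat_def loop_linear_def dconv_def
  by (intro tame_sum tame_add tame_diff tame_mult tame_divide tame_const)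

lemma tame_mom_flow: "(\<And>m. tame d (\<lambda>A. t A m)) \<Longrightarrow> tame d (\<lambda>A. mom_flow \<kappa> k (t A) m)"
  unfolding mom_flow_def by (intro tame_diff tame_mult tame_const)

text \<open>
  One term of the exponential series dominates the power.
\<close>

lemma power_times_exp_bounded:
  fixes \<epsilon> :: real
  assumes "\<epsilon> > 0"
  shows "\<exists>C\<ge>0. \<forall>u\<ge>0. (1 + u) ^ K * exp (- (\<epsilon> * u)) \<le> C"
proof (intro exI[of _ "exp \<epsilon> * fact K / \<epsilon> ^ K"] conjI allI impI)
  show "0 \<le> exp \<epsilon> * fact K / \<epsilon> ^ K" using assms by simp
  fix u :: real assume u: "u \<ge> 0"
  define x where "x = \<epsilon> * (1 + u)"
  have x: "x \<ge> 0" using assms u by (simp add: x_def)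
  have s: "(\<lambda>n. x ^ n / fact n) sums exp x"
    using exp_converges[of x] by (simp add: divide_inverse mult.commute)
  have "(\<Sum>n\<in>{K}. x ^ n / fact n) \<le> exp x"
    unfolding sums_unique[OF s] by (rule sum_le_suminf) (use x sums_summable[OF s] in auto)
  then have "x ^ K \<le> exp x * fact K" by (simp add: field_simps)
  moreover have "exp x = exp \<epsilon> * exp (\<epsilon> * u)" by (simp add: x_def distrib_left exp_add)
  ultimately have "\<epsilon> ^ K * (1 + u) ^ K \<le> exp \<epsilon> * fact K * exp (\<epsilon> * u)"
    by (simp add: x_def power_mult_distrib mult_ac)
  then have "\<epsilon> ^ K * (1 + u) ^ K * exp (- (\<epsilon> * u)) \<le> exp \<epsilon> * fact K * exp (\<epsilon> * u) * exp (- (\<epsilon> * u))"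
    by (rule mult_right_mono) simp
  then have "\<epsilon> ^ K * ((1 + u) ^ K * exp (- (\<epsilon> * u))) \<le> exp \<epsilon> * fact K"
    by (simp add: mult.assoc mult_exp_exp)
  then show "(1 + u) ^ K * exp (- (\<epsilon> * u)) \<le> exp \<epsilon> * fact K / \<epsilon> ^ K"
    using assms by (simp add: pos_le_divide_eq mult.commute)
qed

text \<open>
  A smooth substitute for the indicator of the operator norm ball of radius \<open>\<kappa>\<close>: in terms of the
  eigenvalues e the exponent is minus \<open>\<epsilon>\<close> times the sum of (e/\<open>\<kappa>\<close>)^(2q).
\<close>

definition weight :: "real \<Rightarrow> real \<Rightarrow> nat \<Rightarrow> real mat \<Rightarrow> real" where
  "weight \<kappa> \<epsilon> q A = exp (- (\<epsilon> * (power_trace A (2 * q) / \<kappa> ^ (2 * q))))"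

text \<open>
  For each eigenvalue, x = (e/\<open>\<kappa>\<close>)^2 satisfies x \<open>\<le>\<close> 1 + x^q.
\<close>

lemma frobenius_le_high_trace:
  assumes A: "A \<in> sym_mats d" and k: "\<kappa> > 0" and q: "q \<ge> 1"
  shows "power_trace A 2 \<le> \<kappa>\<^sup>2 * (real d + power_trace A (2 * q) / \<kappa> ^ (2 * q))"
proof -
  obtain es where es: "length es = d" "char_poly A = (\<Prod>e\<leftarrow>es. [:- e, 1:])"
    using symmetric_char_poly_splits[OF A] .
  have e: "e\<^sup>2 \<le> \<kappa>\<^sup>2 * (1 + e ^ (2 * q) / \<kappa> ^ (2 * q))" for e
  proof -
    define x where "x = (e / \<kappa>)\<^sup>2"
    have x0: "x \<ge> 0" by (simp add: x_def)
    have "x \<le> 1 + x ^ q"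
    proof (cases "x \<le> 1")
      case True
      then show ?thesis using zero_le_power[OF x0, of q] by linarith
    next
      case False
      then have "x ^ 1 \<le> x ^ q" using q by (intro power_increasing) auto
      then show ?thesis by simp
    qed
    then have "\<kappa>\<^sup>2 * x \<le> \<kappa>\<^sup>2 * (1 + x ^ q)" by (rule mult_left_mono) simp
    moreover have "\<kappa>\<^sup>2 * x = e\<^sup>2" using k by (simp add: x_def power_divide)
    moreover have "x ^ q = e ^ (2 * q) / \<kappa> ^ (2 * q)" by (simp add: x_def power_divide power_mult)
    ultimately show ?thesis by simp
  qed
  have "power_trace A 2 = (\<Sum>e\<leftarrow>es. e\<^sup>2)" by (rule power_trace_eq_sum_eigenvalues[OF A es(2)])
  also have "\<dots> \<le> (\<Sum>e\<leftarrow>es. \<kappa>\<^sup>2 * (1 + e ^ (2 * q) / \<kappa> ^ (2 * q)))" by (rule sum_list_mono) (rule e)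
  also have "\<dots> = \<kappa>\<^sup>2 * (real (length es) + (\<Sum>e\<leftarrow>es. e ^ (2 * q)) / \<kappa> ^ (2 * q))"
    by (induction es) (simp_all add: algebra_simps add_divide_distrib)
  finally show ?thesis unfolding power_trace_eq_sum_eigenvalues[OF A es(2)] es(1) .
qed

text \<open>
  The weight decays exponentially in a quantity that controls the Frobenius norm, so it beats
  polynomial growth.
\<close>

lemma tame_weight_bounded:
  assumes G: "tame d G" and k: "\<kappa> > 0" and e: "\<epsilon> > 0" and q: "q \<ge> 1"
  shows "\<exists>B\<ge>0. \<forall>A\<in>sym_mats d. \<bar>G A * weight \<kappa> \<epsilon> q A\<bar> \<le> B"
proof -
  from G obtain C K where C: "C \<ge> 0" "\<And>A. A \<in> sym_mats d \<Longrightarrow> \<bar>G A\<bar> \<le> C * (1 + power_trace A 2) ^ K"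
    unfolding tame_def by blast
  obtain C' where C': "C' \<ge> 0" "\<And>u. u \<ge> 0 \<Longrightarrow> (1 + u) ^ K * exp (- (\<epsilon> * u)) \<le> C'"
    using power_times_exp_bounded[OF e] by blast
  define b where "b = 1 + \<kappa>\<^sup>2 * (real d + 1)"
  have b: "b \<ge> 0" by (simp add: b_def)
  show ?thesis
  proof (intro exI[of _ "C * b ^ K * C'"] conjI ballI)
    show "0 \<le> C * b ^ K * C'" using C C' b by simp
    fix A assume A: "A \<in> sym_mats d"
    define u where "u = power_trace A (2 * q) / \<kappa> ^ (2 * q)"
    have u: "u \<ge> 0" using power_trace_even_nonneg[OF A] k by (simp add: u_def)
    have "1 + power_trace A 2 \<le> 1 + \<kappa>\<^sup>2 * (real d + u)"
      using frobenius_le_high_trace[OF A k q] by (simp add: u_def)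
    also have "\<dots> \<le> b * (1 + u)"
    proof -
      have "b * (1 + u) - (1 + \<kappa>\<^sup>2 * (real d + u)) = u + \<kappa>\<^sup>2 + \<kappa>\<^sup>2 * real d * u"
        by (simp add: b_def algebra_simps)
      moreover have "\<dots> \<ge> 0" using u by simp
      ultimately show ?thesis by linarith
    qed
    finally have "(1 + power_trace A 2) ^ K \<le> (b * (1 + u)) ^ K"
      using one_le_frobenius[OF A] by (intro power_mono) auto
    then have "\<bar>G A\<bar> \<le> C * (b * (1 + u)) ^ K"
      using C(2)[OF A] mult_left_mono[OF _ C(1)] order.trans by blast
    then have "\<bar>G A\<bar> * exp (- (\<epsilon> * u)) \<le> C * (b * (1 + u)) ^ K * exp (- (\<epsilon> * u))"
      by (rule mult_right_mono) simp
    also have "\<dots> = C * b ^ K * ((1 + u) ^ K * exp (- (\<epsilon> * u)))" by (simp add: power_mult_distrib)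
    also have "\<dots> \<le> C * b ^ K * C'" using C'(2)[OF u] C(1) b by (intro mult_left_mono) auto
    finally show "\<bar>G A * weight \<kappa> \<epsilon> q A\<bar> \<le> C * b ^ K * C'"
      by (simp add: weight_def u_def abs_mult)
  qed
qed

lemma measurable_weight: "weight \<kappa> \<epsilon> q \<in> borel_measurable (sym_mat_algebra d)"
  unfolding weight_def[abs_def] by (intro measurable_compose[OF _ borel_measurable_exp] borel_measurable_uminus borel_measurable_times
      borel_measurable_divide borel_measurable_const tame_measurable[OF tame_power_trace])

section \<open>The loop identity for the cut-off Gaussian ensemble\<close>

text \<open>
  The entries of the vector field (\<open>\<kappa>\<close>^2 - A^2) A^k.
\<close>

definition field_entry :: "real \<Rightarrow> nat \<Rightarrow> real mat \<Rightarrow> nat \<times> nat \<Rightarrow> real" where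
  "field_entry \<kappa> k A p = \<kappa>\<^sup>2 * (A ^\<^sub>m k) $$ p - (A ^\<^sub>m (k + 2)) $$ p"

text \<open>
  The number of places at which a free entry occurs in the matrix. The reciprocal of the variance of
  the entry is d/2 times this number.
\<close>

definition offdiag_mult :: "nat \<times> nat \<Rightarrow> real" where
  "offdiag_mult p = (if fst p = snd p then 1 else 2)"

definition loop_obs :: "real \<Rightarrow> nat \<Rightarrow> real mat \<Rightarrow> real" where
  "loop_obs \<kappa> k A = loop_stat \<kappa> k (dim_row A) (norm_trace A)"

text \<open>
  The derivative of \<open>loop_obs\<close> along the vector field.
\<close>

definition flow_obs :: "real \<Rightarrow> nat \<Rightarrow> real mat \<Rightarrow> real" where
  "flow_obs \<kappa> k A = dloop_stat \<kappa> k (dim_row A) (norm_trace A) (mom_flow \<kappa> k (norm_trace A))"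

text \<open>
  The logarithmic derivative of the cutoff weight along the vector field.
\<close>

definition wall_obs :: "real \<Rightarrow> nat \<Rightarrow> real \<Rightarrow> nat \<Rightarrow> real mat \<Rightarrow> real" where
  "wall_obs \<kappa> k \<epsilon> q A = - (\<epsilon> * (real (dim_row A) * mom_flow \<kappa> k (norm_trace A) (2 * q) / \<kappa> ^ (2 * q)))"

lemma sum_field_times_power:
  assumes A: "A \<in> sym_mats d"
  shows "(\<Sum>p\<in>upper_indices d. offdiag_mult p * (field_entry \<kappa> k A p * (A ^\<^sub>m m) $$ p))
    = \<kappa>\<^sup>2 * power_trace A (k + m) - power_trace A (k + 2 + m)"
proof -
  have "(\<Sum>p\<in>upper_indices d. offdiag_mult p * (field_entry \<kappa> k A p * (A ^\<^sub>m m) $$ p))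
    = (\<Sum>p\<in>upper_indices d. (if fst p = snd p then 1 else 2) * (field_entry \<kappa> k A (fst p, snd p) * (A ^\<^sub>m m) $$ (fst p, snd p)))"
    unfolding offdiag_mult_def prod.collapse ..
  also have "\<dots> = (\<Sum>i<d. \<Sum>j<d. field_entry \<kappa> k A (i, j) * (A ^\<^sub>m m) $$ (i, j))"
  proof (rule sum_upper_indices)
    show "field_entry \<kappa> k A (i, j) * (A ^\<^sub>m m) $$ (i, j) = field_entry \<kappa> k A (j, i) * (A ^\<^sub>m m) $$ (j, i)"
      if "i < d" "j < d" for i j
      unfolding field_entry_def pow_mat_symmetric[OF A that] ..
  qed
  also have "\<dots> = \<kappa>\<^sup>2 * power_trace A (k + m) - power_trace A (k + 2 + m)"
    unfolding power_trace_add[OF A] field_entry_def left_diff_distrib sum_subtractf sum_distrib_left mult.assoc ..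
  finally show ?thesis .
qed

lemma sum_field_times_trace_grad:
  assumes A: "A \<in> sym_mats d"
  shows "(\<Sum>p\<in>upper_indices d. field_entry \<kappa> k A p * (real m * (offdiag_mult p * (A ^\<^sub>m (m - 1)) $$ p)))
    = real d * mom_flow \<kappa> k (norm_trace A) m"
proof -
  have "(\<Sum>p\<in>upper_indices d. field_entry \<kappa> k A p * (real m * (offdiag_mult p * (A ^\<^sub>m (m - 1)) $$ p)))
    = real m * (\<Sum>p\<in>upper_indices d. offdiag_mult p * (field_entry \<kappa> k A p * (A ^\<^sub>m (m - 1)) $$ p))"
    unfolding sum_distrib_left by (rule sum.cong[OF refl]) (simp only: mult_ac)
  also have "\<dots> = real m * (\<kappa>\<^sup>2 * power_trace A (k + (m - 1)) - power_trace A (k + 2 + (m - 1)))"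
    unfolding sum_field_times_power[OF A] ..
  also have "\<dots> = real d * mom_flow \<kappa> k (norm_trace A) m"
  proof (cases "d = 0")
    case True
    then show ?thesis using sym_matsD(1)[OF A] by (simp add: power_trace_def)
  next
    case False
    have "dim_row A = d" using sym_matsD(1)[OF A] by simp
    then have "power_trace A j = real d * norm_trace A j" for j using False by (simp add: norm_trace_def)
    then show ?thesis unfolding mom_flow_def by (simp add: algebra_simps)
  qed
  finally show ?thesis .
qed

text \<open>
  The reason for the name loop observable: divergence and Gaussian drift of the vector field combine
  to a multiple of \<open>loop_obs\<close>. The weights \<open>offdiag_mult\<close> turn the drift, in which the variances on and
  off the diagonal differ by a factor of 2, into a trace.
\<close>

lemma field_divergence:
  assumes A: "A \<in> sym_mats d" and d: "d \<ge> 1"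
  shows "(\<Sum>p\<in>upper_indices d. \<kappa>\<^sup>2 * dpow A k p (fst p) (snd p) - dpow A (k + 2) p (fst p) (snd p))
      - (\<Sum>p\<in>upper_indices d. A $$ p / ((1 + of_bool (fst p = snd p)) / real d) * field_entry \<kappa> k A p)
    = (real d)\<^sup>2 / 2 * loop_obs \<kappa> k A"
proof -
  have dim: "dim_row A = d" using sym_matsD(1)[OF A] by simp
  have T: "power_trace A j = real d * norm_trace A j" for j using d dim by (simp add: norm_trace_def)
  have A1: "A ^\<^sub>m 1 = A" using sym_matsD(1)[OF A] by simp
  have "(\<Sum>p\<in>upper_indices d. A $$ p / ((1 + of_bool (fst p = snd p)) / real d) * field_entry \<kappa> k A p)
    = (\<Sum>p\<in>upper_indices d. real d / 2 * (offdiag_mult p * (field_entry \<kappa> k A p * (A ^\<^sub>m 1) $$ p)))"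
    unfolding A1 by (rule sum.cong[OF refl]) (simp add: offdiag_mult_def)
  also have "\<dots> = real d / 2 * (\<kappa>\<^sup>2 * power_trace A (k + 1) - power_trace A (k + 2 + 1))"
    unfolding sum_distrib_left[symmetric] sum_field_times_power[OF A] ..
  finally have 1: "(\<Sum>p\<in>upper_indices d. A $$ p / ((1 + of_bool (fst p = snd p)) / real d) * field_entry \<kappa> k A p)
    = (real d)\<^sup>2 / 2 * (\<kappa>\<^sup>2 * norm_trace A (k + 1) - norm_trace A (k + 3))"
    unfolding T by (simp add: power2_eq_square algebra_simps numeral_3_eq_3)
  have conv: "(\<Sum>a<k. power_trace A a * power_trace A (k - 1 - a)) = (real d)\<^sup>2 * conv_moments (norm_trace A) k" for k
    unfolding T conv_moments_def sum_distrib_left by (rule sum.cong[OF refl]) (simp only: power2_eq_square mult_ac)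
  have lin: "real k * power_trace A (k - 1) = (real d)\<^sup>2 * (real k * norm_trace A (k - 1) / real d)" for k
    unfolding T using d by (simp add: power2_eq_square)
  have D: "(\<Sum>p\<in>upper_indices d. dpow A k p (fst p) (snd p)) = (real d)\<^sup>2 / 2 * (conv_moments (norm_trace A) k + real k * norm_trace A (k - 1) / real d)" for k
    unfolding sum_dpow_self[OF A] conv lin by (simp only: distrib_left[symmetric]) simp
  have 2: "(\<Sum>p\<in>upper_indices d. \<kappa>\<^sup>2 * dpow A k p (fst p) (snd p) - dpow A (k + 2) p (fst p) (snd p))
    = (real d)\<^sup>2 / 2 * (\<kappa>\<^sup>2 * (conv_moments (norm_trace A) k + real k * norm_trace A (k - 1) / real d)
       - (conv_moments (norm_trace A) (k + 2) + real (k + 2) * norm_trace A (k + 1) / real d))"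
    unfolding sum_subtractf sum_distrib_left[symmetric] D by (simp add: algebra_simps)
  show ?thesis unfolding 1 2 loop_obs_def loop_stat_def loop_linear_def dim right_diff_distrib[symmetric]
    by (simp add: algebra_simps diff_divide_distrib add_divide_distrib)
qed

text \<open>
  The derivative, in the free entry p, of the p-th entry of the vector field times \<open>loop_obs\<close> times
  the weight, divided by the weight.
\<close>

definition dfield_obs :: "real \<Rightarrow> nat \<Rightarrow> real \<Rightarrow> nat \<Rightarrow> nat \<times> nat \<Rightarrow> real mat \<Rightarrow> real" where
  "dfield_obs \<kappa> k \<epsilon> q p A =
     (\<kappa>\<^sup>2 * dpow A k p (fst p) (snd p) - dpow A (k + 2) p (fst p) (snd p)) * loop_obs \<kappa> k A
      + field_entry \<kappa> k A p * dloop_stat \<kappa> k (dim_row A) (norm_trace A) (\<lambda>m. real m * (offdiag_mult p * (A ^\<^sub>m (m - 1)) $$ p) / real (dim_row A))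
      - field_entry \<kappa> k A p * loop_obs \<kappa> k A * (\<epsilon> * (real (2 * q) * (offdiag_mult p * (A ^\<^sub>m (2 * q - 1)) $$ p) / \<kappa> ^ (2 * q)))"

context
  fixes d :: nat and p :: "nat \<times> nat" and y :: "nat \<times> nat \<Rightarrow> real"
  assumes p: "p \<in> upper_indices d"
begin

private abbreviation (input) "C x \<equiv> sym_mat_of_upper d (y(p := x))"

lemma curve_derivs:
  shows "dim_row (C x) = d"
    and "((\<lambda>x. power_trace (C x) m) has_real_derivative real m * (offdiag_mult p * (C x ^\<^sub>m (m - 1)) $$ p)) (at x)"
    and "((\<lambda>x. norm_trace (C x) m) has_real_derivative real m * (offdiag_mult p * (C x ^\<^sub>m (m - 1)) $$ p) / real d) (at x)"
    and "((\<lambda>x. (C x ^\<^sub>m m) $$ p) has_real_derivative dpow (C x) m p (fst p) (snd p)) (at x)"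
    and "((\<lambda>x. loop_obs \<kappa> k (C x)) has_real_derivative
     dloop_stat \<kappa> k d (norm_trace (C x)) (\<lambda>m. real m * (offdiag_mult p * (C x ^\<^sub>m (m - 1)) $$ p) / real d)) (at x)"
    and "((\<lambda>x. field_entry \<kappa> k (C x) p) has_real_derivative
     \<kappa>\<^sup>2 * dpow (C x) k p (fst p) (snd p) - dpow (C x) (k + 2) p (fst p) (snd p)) (at x)"
    and "((\<lambda>x. weight \<kappa> \<epsilon> q (C x)) has_real_derivative
     weight \<kappa> \<epsilon> q (C x) * - (\<epsilon> * (real (2 * q) * (offdiag_mult p * (C x ^\<^sub>m (2 * q - 1)) $$ p) / \<kappa> ^ (2 * q)))) (at x)"
proof -
  have pd: "fst p < d" "snd p < d" using p by (auto simp: upper_indices_def)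
  show dim: "dim_row (C x) = d" for x using sym_matsD(1)[OF sym_mat_of_upper_sym] by blast
  show T: "((\<lambda>x. power_trace (C x) m) has_real_derivative real m * (offdiag_mult p * (C x ^\<^sub>m (m - 1)) $$ p)) (at x)" for m x
    unfolding offdiag_mult_def by (rule has_derivative_power_trace[OF p])
  show N: "((\<lambda>x. norm_trace (C x) m) has_real_derivative real m * (offdiag_mult p * (C x ^\<^sub>m (m - 1)) $$ p) / real d) (at x)" for m x
    unfolding norm_trace_def dim by (rule DERIV_cdivide[OF T])
  show P: "((\<lambda>x. (C x ^\<^sub>m m) $$ p) has_real_derivative dpow (C x) m p (fst p) (snd p)) (at x)" for m x
    using has_derivative_pow_entry[OF p pd, of y m x] unfolding prod.collapse .
  show "((\<lambda>x. loop_obs \<kappa> k (C x)) has_real_derivative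
     dloop_stat \<kappa> k d (norm_trace (C x)) (\<lambda>m. real m * (offdiag_mult p * (C x ^\<^sub>m (m - 1)) $$ p) / real d)) (at x)"
    unfolding loop_obs_def dim by (rule has_derivative_loop_stat[OF N])
  show "((\<lambda>x. field_entry \<kappa> k (C x) p) has_real_derivative
     \<kappa>\<^sup>2 * dpow (C x) k p (fst p) (snd p) - dpow (C x) (k + 2) p (fst p) (snd p)) (at x)"
    unfolding field_entry_def by (intro DERIV_diff DERIV_cmult P)
  show "((\<lambda>x. weight \<kappa> \<epsilon> q (C x)) has_real_derivative
     weight \<kappa> \<epsilon> q (C x) * - (\<epsilon> * (real (2 * q) * (offdiag_mult p * (C x ^\<^sub>m (2 * q - 1)) $$ p) / \<kappa> ^ (2 * q)))) (at x)"
    unfolding weight_def by (rule DERIV_fun_exp[OF DERIV_minus[OF DERIV_cmult[OF DERIV_cdivide[OF T]]]])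
qed

lemma has_derivative_field:
  "((\<lambda>x. field_entry \<kappa> k (C x) p * loop_obs \<kappa> k (C x) * weight \<kappa> \<epsilon> q (C x)) has_real_derivative
     dfield_obs \<kappa> k \<epsilon> q p (C x) * weight \<kappa> \<epsilon> q (C x)) (at x)"
proof -
  have gen: "(h' * l + l' * h) * w + w * (- e) * (h * l) = (h' * l + h * l' - h * l * e) * w" for h h' l l' w e :: real
    by (simp add: algebra_simps)
  show ?thesis unfolding dfield_obs_def curve_derivs(1)
    by (rule DERIV_cong[OF DERIV_mult[OF DERIV_mult[OF curve_derivs(6,5)] curve_derivs(7)] gen])
qed

lemma isCont_dfield: "isCont (\<lambda>x. dfield_obs \<kappa> k \<epsilon> q p (C x) * weight \<kappa> \<epsilon> q (C x)) x"
proof -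
  have pd: "fst p < d" "snd p < d" using p by (auto simp: upper_indices_def)
  note c = curve_derivs(3-7)[THEN DERIV_isCont] isCont_dpow[OF p pd]
  show ?thesis
    unfolding dfield_obs_def curve_derivs(1) dloop_stat_def loop_linear_def dconv_def divide_inverse
    by (intro continuous_intros c)
qed

end

text \<open>
  The pointwise form of the loop identity: the divergence of the field, weighted by \<open>loop_obs\<close> and by
  the cutoff, minus the Gaussian drift.
\<close>

lemma sum_dfield:
  assumes A: "A \<in> sym_mats d" and d: "d \<ge> 1"
  shows "(\<Sum>p\<in>upper_indices d. dfield_obs \<kappa> k \<epsilon> q p A * w
      - A $$ p / ((1 + of_bool (fst p = snd p)) / real d) * (field_entry \<kappa> k A p * loop_obs \<kappa> k A * w))
    = ((real d)\<^sup>2 / 2 * (loop_obs \<kappa> k A)\<^sup>2 + flow_obs \<kappa> k A + loop_obs \<kappa> k A * wall_obs \<kappa> k \<epsilon> q A) * w"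
proof -
  let ?P = "upper_indices d" and ?X = "loop_obs \<kappa> k A"
  have dim: "dim_row A = d" using sym_matsD(1)[OF A] by simp
  define e where "e p = real (2 * q) * (offdiag_mult p * (A ^\<^sub>m (2 * q - 1)) $$ p)" for p
  define s where "s p m = real m * (offdiag_mult p * (A ^\<^sub>m (m - 1)) $$ p) / real d" for p m
  define h' where "h' p = \<kappa>\<^sup>2 * dpow A k p (fst p) (snd p) - dpow A (k + 2) p (fst p) (snd p)" for p
  define h where "h p = field_entry \<kappa> k A p" for p
  define g where "g p = A $$ p / ((1 + of_bool (fst p = snd p)) / real d)" for p
  have e: "(\<Sum>p\<in>?P. h p * e p) = real d * mom_flow \<kappa> k (norm_trace A) (2 * q)"
    unfolding h_def e_def by (rule sum_field_times_trace_grad[OF A])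
  have s: "(\<Sum>p\<in>?P. h p * dloop_stat \<kappa> k d (norm_trace A) (s p)) = flow_obs \<kappa> k A"
  proof -
    have "(\<Sum>p\<in>?P. h p * s p m) = mom_flow \<kappa> k (norm_trace A) m" for m
    proof -
      have "(\<Sum>p\<in>?P. h p * s p m) = (\<Sum>p\<in>?P. h p * (real m * (offdiag_mult p * (A ^\<^sub>m (m - 1)) $$ p))) / real d"
        unfolding s_def sum_divide_distrib by simp
      also have "\<dots> = mom_flow \<kappa> k (norm_trace A) m"
        unfolding h_def sum_field_times_trace_grad[OF A] using d by simp
      finally show ?thesis .
    qed
    then show ?thesis unfolding dloop_stat_linear flow_obs_def dim by simp
  qed
  have D: "(\<Sum>p\<in>?P. h' p) - (\<Sum>p\<in>?P. g p * h p) = (real d)\<^sup>2 / 2 * ?X"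
    unfolding h'_def g_def h_def by (rule field_divergence[OF A d])
  have "(\<Sum>p\<in>?P. dfield_obs \<kappa> k \<epsilon> q p A * w - g p * (h p * ?X * w))
    = (\<Sum>p\<in>?P. (h' p - g p * h p) * (?X * w) + h p * dloop_stat \<kappa> k d (norm_trace A) (s p) * w
        - (h p * e p) * (?X * (\<epsilon> / \<kappa> ^ (2 * q)) * w))"
    unfolding dfield_obs_def h_def[symmetric] h'_def[symmetric] s_def[symmetric] e_def[symmetric] dim
    by (rule sum.cong[OF refl]) (simp add: algebra_simps)
  also have "\<dots> = ((\<Sum>p\<in>?P. h' p) - (\<Sum>p\<in>?P. g p * h p)) * (?X * w) + (\<Sum>p\<in>?P. h p * dloop_stat \<kappa> k d (norm_trace A) (s p)) * w
        - (\<Sum>p\<in>?P. h p * e p) * (?X * (\<epsilon> / \<kappa> ^ (2 * q)) * w)"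
    by (simp only: sum_subtractf sum.distrib sum_distrib_right[symmetric])
  also have "\<dots> = ((real d)\<^sup>2 / 2 * ?X\<^sup>2 + flow_obs \<kappa> k A + ?X * wall_obs \<kappa> k \<epsilon> q A) * w"
    unfolding D s e wall_obs_def dim by (simp add: power2_eq_square algebra_simps)
  finally show ?thesis unfolding g_def h_def .
qed

lemma measurable_sym_mat_of_upper:
  assumes "\<And>p. p \<in> upper_indices d \<Longrightarrow> sets (M p) = sets borel"
  shows "sym_mat_of_upper d \<in> measurable (Pi\<^sub>M (upper_indices d) M) (sym_mat_algebra d)"
  unfolding sym_mat_algebra_def
proof (rule measurable_vimage_algebra2)
  show "sym_mat_of_upper d \<in> space (Pi\<^sub>M (upper_indices d) M) \<rightarrow> sym_mats d"
    using sym_mat_of_upper_sym by blast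
  show "(\<lambda>y. \<lambda>(i, j) \<in> {..<d} \<times> {..<d}. sym_mat_of_upper d y $$ (i, j))
    \<in> measurable (Pi\<^sub>M (upper_indices d) M) (\<Pi>\<^sub>M p \<in> {..<d} \<times> {..<d}. borel)"
  proof (rule measurable_restrict)
    fix p assume "p \<in> {..<d} \<times> {..<d}"
    then obtain i j where ij: "p = (i, j)" "i < d" "j < d" by auto
    have u: "(min i j, max i j) \<in> upper_indices d" using ij by (auto simp: upper_indices_def)
    have "(\<lambda>y. y (min i j, max i j)) \<in> measurable (Pi\<^sub>M (upper_indices d) M) (M (min i j, max i j))"
      by (rule measurable_component_singleton[OF u])
    then show "(\<lambda>y. case p of (i, j) \<Rightarrow> sym_mat_of_upper d y $$ (i, j)) \<in> borel_measurable (Pi\<^sub>M (upper_indices d) M)"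
      unfolding ij(1) prod.case sym_mat_of_upper_index[OF ij(2,3)] measurable_cong_sets[OF refl assms[OF u]] .
  qed
qed

lemma tame_loop_obs: "tame d (loop_obs \<kappa> k)"
proof (rule tame_cong)
  show "loop_obs \<kappa> k A = loop_stat \<kappa> k d (norm_trace A)" if "A \<in> sym_mats d" for A
    using sym_matsD(1)[OF that] by (simp add: loop_obs_def)
qed (intro tame_loop_stat tame_norm_trace)

lemma tame_flow_obs: "tame d (flow_obs \<kappa> k)"
proof (rule tame_cong)
  show "flow_obs \<kappa> k A = dloop_stat \<kappa> k d (norm_trace A) (mom_flow \<kappa> k (norm_trace A))" if "A \<in> sym_mats d" for A
    using sym_matsD(1)[OF that] by (simp add: flow_obs_def)
qed (intro tame_dloop_stat tame_norm_trace tame_mom_flow)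

lemma tame_wall_obs: "tame d (wall_obs \<kappa> k \<epsilon> q)"
proof (rule tame_cong)
  show "wall_obs \<kappa> k \<epsilon> q A = - \<epsilon> * (real d * mom_flow \<kappa> k (norm_trace A) (2 * q) / \<kappa> ^ (2 * q))" if "A \<in> sym_mats d" for A
    using sym_matsD(1)[OF that] by (simp add: wall_obs_def)
qed (intro tame_mult tame_const tame_divide tame_mom_flow tame_norm_trace)

lemma tame_field_entry:
  assumes "p \<in> upper_indices d"
  shows "tame d (\<lambda>A. field_entry \<kappa> k A p)"
proof -
  obtain i j where ij: "p = (i, j)" "i < d" "j < d" using assms by (auto simp: upper_indices_def)
  show ?thesis unfolding field_entry_def ij(1)
    by (intro tame_diff tame_mult tame_const tame_pow_entry ij(2,3))
qed

lemma tame_dfield_obs: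
  assumes p: "p \<in> upper_indices d"
  shows "tame d (dfield_obs \<kappa> k \<epsilon> q p)"
proof (rule tame_cong)
  have pd: "fst p < d" "snd p < d" using p by (auto simp: upper_indices_def)
  have P: "tame d (\<lambda>A. (A ^\<^sub>m m) $$ p)" for m
    using tame_pow_entry[OF pd, of m] unfolding prod.collapse .
  let ?f = "\<lambda>A. (\<kappa>\<^sup>2 * dpow A k p (fst p) (snd p) - dpow A (k + 2) p (fst p) (snd p)) * loop_obs \<kappa> k A
      + field_entry \<kappa> k A p * dloop_stat \<kappa> k d (norm_trace A) (\<lambda>m. real m * (offdiag_mult p * (A ^\<^sub>m (m - 1)) $$ p) / real d)
      - field_entry \<kappa> k A p * loop_obs \<kappa> k A * (\<epsilon> * (real (2 * q) * (offdiag_mult p * (A ^\<^sub>m (2 * q - 1)) $$ p) / \<kappa> ^ (2 * q)))"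
  show "dfield_obs \<kappa> k \<epsilon> q p A = ?f A" if "A \<in> sym_mats d" for A
  proof -
    have "dim_row A = d" using sym_matsD(1)[OF that] by simp
    then show ?thesis unfolding dfield_obs_def by simp
  qed
  show "tame d ?f"
    by (intro tame_add tame_diff tame_mult tame_divide tame_const
        tame_dpow[OF pd p] tame_loop_obs tame_field_entry[OF p] tame_dloop_stat tame_norm_trace P)
qed

definition goe_sd :: "nat \<Rightarrow> nat \<times> nat \<Rightarrow> real" where
  "goe_sd d p = sqrt ((1 + of_bool (fst p = snd p)) / real d)"

text \<open>
  Outside the index set the value is an arbitrary probability measure, so that the family consists of
  probability measures at all indices.
\<close>

definition goe_marginal :: "nat \<Rightarrow> nat \<times> nat \<Rightarrow> real measure" where
  "goe_marginal d p = (if p \<in> upper_indices d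
     then density lborel (\<lambda>x. ennreal (normal_density 0 (goe_sd d p) x)) else return borel 0)"

lemma GOE_eq:
  "GOE d = distr (Pi\<^sub>M (upper_indices d) (goe_marginal d)) (sym_mat_algebra d) (sym_mat_of_upper d)"
proof -
  have "(\<Pi>\<^sub>M (i, j) \<in> upper_indices d. density lborel (normal_density 0 (sqrt ((1 + of_bool (i = j)) / real d))))
    = Pi\<^sub>M (upper_indices d) (goe_marginal d)"
    by (rule PiM_cong[OF refl]) (auto simp: goe_marginal_def goe_sd_def)
  then show ?thesis unfolding GOE_def by simp
qed

lemma finite_upper_indices: "finite (upper_indices d)"
  by (rule finite_subset[of _ "{..<d} \<times> {..<d}"]) (auto simp: upper_indices_def)

lemma goe_marginal_sets: "sets (goe_marginal d p) = sets borel"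
  by (simp add: goe_marginal_def)

lemma measurable_goe_embedding:
  "sym_mat_of_upper d \<in> measurable (Pi\<^sub>M (upper_indices d) (goe_marginal d)) (sym_mat_algebra d)"
  by (rule measurable_sym_mat_of_upper) (rule goe_marginal_sets)

lemma goe_sd_pos: "d \<ge> 1 \<Longrightarrow> goe_sd d p > 0"
  by (simp add: goe_sd_def)

lemma prob_space_GOE:
  assumes "d \<ge> 1"
  shows "prob_space (GOE d)"
proof -
  have "prob_space (goe_marginal d p)" for p
    unfolding goe_marginal_def using goe_sd_pos[OF assms, of p]
    by (auto intro!: prob_space_normal_density prob_space_return)
  then have "prob_space (Pi\<^sub>M (upper_indices d) (goe_marginal d))" by (rule prob_space_PiM)
  then show ?thesis unfolding GOE_eq by (rule prob_space.prob_space_distr) (rule measurable_goe_embedding)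
qed

text \<open>
  Integration by parts in every free entry, summed over the entries. The square appears because the
  test function is the loop observable itself.
\<close>

lemma GOE_loop_identity:
  fixes k :: nat
  assumes d: "d \<ge> 1" and k: "\<kappa> > 0" and e: "\<epsilon> > 0" and q: "q \<ge> 1"
  defines "R \<equiv> \<lambda>A. ((real d)\<^sup>2 / 2 * (loop_obs \<kappa> k A)\<^sup>2 + flow_obs \<kappa> k A + loop_obs \<kappa> k A * wall_obs \<kappa> k \<epsilon> q A) * weight \<kappa> \<epsilon> q A"
  shows "integrable (GOE d) R" "(\<integral>A. R A \<partial>GOE d) = 0"
proof -
  let ?U = "upper_indices d"
  let ?\<gamma> = "Pi\<^sub>M ?U (goe_marginal d)"
  let ?w = "weight \<kappa> \<epsilon> q"
  let ?E = "sym_mat_of_upper d"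
  define F where "F p A = field_entry \<kappa> k A p * loop_obs \<kappa> k A * ?w A" for p A
  define D where "D p A = dfield_obs \<kappa> k \<epsilon> q p A * ?w A" for p A
  have mF: "F p \<in> borel_measurable (sym_mat_algebra d)" if "p \<in> ?U" for p
    unfolding F_def by (intro borel_measurable_times tame_measurable tame_field_entry tame_loop_obs measurable_weight that)
  have mD: "D p \<in> borel_measurable (sym_mat_algebra d)" if "p \<in> ?U" for p
    unfolding D_def by (intro borel_measurable_times tame_measurable[OF tame_dfield_obs] measurable_weight that)
  have ibp: "integrable ?\<gamma> (\<lambda>y. D p (?E y)) \<and> integrable ?\<gamma> (\<lambda>y. y p / (goe_sd d p)\<^sup>2 * F p (?E y)) \<and>
      (\<integral>y. D p (?E y) \<partial>?\<gamma>) = (\<integral>y. y p / (goe_sd d p)\<^sup>2 * F p (?E y) \<partial>?\<gamma>)" if p: "p \<in> ?U" for p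
  proof -
    obtain i j where ij: "p = (i, j)" "i \<le> j" "i < d" "j < d" using p by (auto simp: upper_indices_def)
    have yp: "?E y $$ p = y p" for y
      unfolding ij(1) sym_mat_of_upper_index[OF ij(3,4)] using ij(2) by (simp add: min_def max_def)
    have tH: "tame d (\<lambda>A. field_entry \<kappa> k A p * loop_obs \<kappa> k A)"
      by (intro tame_mult tame_field_entry p tame_loop_obs)
    have tA: "tame d (\<lambda>A. A $$ p)" unfolding ij(1) by (rule tame_entry[OF ij(3,4)])
    obtain B1 where B1: "\<And>A. A \<in> sym_mats d \<Longrightarrow> \<bar>F p A\<bar> \<le> B1"
      using tame_weight_bounded[OF tH k e q] unfolding F_def by blast
    obtain B2 where B2: "\<And>A. A \<in> sym_mats d \<Longrightarrow> \<bar>D p A\<bar> \<le> B2"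
      using tame_weight_bounded[OF tame_dfield_obs[OF p] k e q] unfolding D_def by blast
    obtain B3 where B3: "\<And>A. A \<in> sym_mats d \<Longrightarrow> \<bar>A $$ p * F p A\<bar> \<le> B3"
      using tame_weight_bounded[OF tame_mult[OF tA tH] k e q] unfolding F_def mult.assoc by blast
    define B where "B = max B1 (max B2 B3)"
    have bF: "\<bar>F p (?E y)\<bar> \<le> B" and bD: "\<bar>D p (?E y)\<bar> \<le> B" and bY: "\<bar>y p * F p (?E y)\<bar> \<le> B" for y
      using B1[OF sym_mat_of_upper_sym, of y] B2[OF sym_mat_of_upper_sym, of y] B3[OF sym_mat_of_upper_sym, of y]
      unfolding yp B_def by linarith+
    have m1: "(\<lambda>y. F p (?E y)) \<in> borel_measurable ?\<gamma>" "(\<lambda>y. D p (?E y)) \<in> borel_measurable ?\<gamma>"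
      using measurable_compose[OF measurable_goe_embedding mF[OF p]] measurable_compose[OF measurable_goe_embedding mD[OF p]] by blast+
    have dr: "((\<lambda>x. F p (?E (y(p := x)))) has_real_derivative D p (?E (y(p := x)))) (at x)" for y x
      unfolding F_def D_def by (rule has_derivative_field[OF p])
    have ct: "isCont (\<lambda>x. D p (?E (y(p := x)))) x" for y x
      unfolding D_def by (rule isCont_dfield[OF p])
    have mg: "goe_marginal d = (\<lambda>p. if p \<in> ?U then density lborel (\<lambda>x. ennreal (normal_density 0 (goe_sd d p) x)) else return borel 0)"
      by (rule ext) (rule goe_marginal_def)
    show ?thesis
      using gaussian_integration_by_parts[where \<sigma> = "goe_sd d", OF finite_upper_indices p goe_sd_pos[OF d], folded mg, OF m1 bF bD bY dr ct]
      by blast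
  qed
  have sq: "(goe_sd d p)\<^sup>2 = (1 + of_bool (fst p = snd p)) / real d" for p
    unfolding goe_sd_def by (rule real_sqrt_pow2) simp
  have R: "R (?E y) = (\<Sum>p\<in>?U. D p (?E y) - y p / (goe_sd d p)\<^sup>2 * F p (?E y))" for y
  proof -
    have "?E y $$ p = y p" if p: "p \<in> ?U" for p
    proof -
      obtain i j where ij: "p = (i, j)" "i \<le> j" "i < d" "j < d" using p by (auto simp: upper_indices_def)
      show ?thesis
        unfolding ij(1) sym_mat_of_upper_index[OF ij(3,4)] using ij(2) by (simp add: min_def max_def)
    qed
    then have "(\<Sum>p\<in>?U. D p (?E y) - y p / (goe_sd d p)\<^sup>2 * F p (?E y))
      = (\<Sum>p\<in>?U. D p (?E y) - ?E y $$ p / ((1 + of_bool (fst p = snd p)) / real d) * F p (?E y))"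
      unfolding sq by (intro sum.cong refl) simp
    then show ?thesis
      unfolding R_def D_def F_def sum_dfield[OF sym_mat_of_upper_sym d] by (rule sym)
  qed
  have iR: "integrable ?\<gamma> (\<lambda>y. R (?E y))"
    unfolding R by (intro Bochner_Integration.integrable_sum Bochner_Integration.integrable_diff) (use ibp in blast)+
  have "(\<integral>y. R (?E y) \<partial>?\<gamma>) = (\<Sum>p\<in>?U. (\<integral>y. D p (?E y) - y p / (goe_sd d p)\<^sup>2 * F p (?E y) \<partial>?\<gamma>))"
    unfolding R by (rule Bochner_Integration.integral_sum) (intro Bochner_Integration.integrable_diff; use ibp in blast)
  also have "\<dots> = 0"
  proof (rule sum.neutral, rule ballI)
    fix p assume p: "p \<in> ?U"
    show "(\<integral>y. D p (?E y) - y p / (goe_sd d p)\<^sup>2 * F p (?E y) \<partial>?\<gamma>) = 0"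
      using ibp[OF p] Bochner_Integration.integral_diff[of ?\<gamma> "\<lambda>y. D p (?E y)" "\<lambda>y. y p / (goe_sd d p)\<^sup>2 * F p (?E y)"]
      by simp
  qed
  finally have z: "(\<integral>y. R (?E y) \<partial>?\<gamma>) = 0" .
  have mR: "R \<in> borel_measurable (sym_mat_algebra d)"
    unfolding R_def by (intro borel_measurable_times borel_measurable_add borel_measurable_power borel_measurable_const
      tame_measurable tame_loop_obs tame_flow_obs tame_wall_obs measurable_weight)
  show "integrable (GOE d) R"
    unfolding GOE_eq integrable_distr_eq[OF measurable_goe_embedding mR] by (rule iR)
  show "(\<integral>A. R A \<partial>GOE d) = 0"
    unfolding GOE_eq integral_distr[OF measurable_goe_embedding mR] by (rule z)
qed

section \<open>Growth of the observables in terms of the eigenvalues\<close>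

lemma nonneg_term_le_sum_list:
  fixes f :: "'a \<Rightarrow> real"
  assumes "x \<in> set xs" "\<And>y. f y \<ge> 0"
  shows "f x \<le> (\<Sum>y\<leftarrow>xs. f y)"
  using assms(1)
proof (induction xs)
  case (Cons a xs)
  have "0 \<le> (\<Sum>y\<leftarrow>xs. f y)" by (rule sum_list_nonneg) (use assms(2) in auto)
  then show ?case using Cons assms(2)[of a] by auto
qed simp

text \<open>
  The constants in this and in the following bounds do not depend on d; the second moment bound and
  its summability rest on that.
\<close>

lemma loop_linear_bound:
  assumes d: "d \<ge> 1" and t: "\<And>m. m \<le> k + 3 \<Longrightarrow> \<bar>t m\<bar> \<le> V"
  shows "\<bar>loop_linear \<kappa> k d t\<bar> \<le> (\<kappa>\<^sup>2 * real (k + 1) + real (k + 3)) * V"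
proof -
  have m: "\<bar>c * t m\<bar> \<le> c * V" if "c \<ge> 0" "m \<le> k + 3" for c m
    using mult_left_mono[OF t[OF that(2)] that(1)] that(1) by (simp add: abs_mult)
  have "\<bar>(\<kappa>\<^sup>2 * real k * t (k - 1) - real (k + 2) * t (k + 1)) / real d\<bar>
      \<le> \<bar>\<kappa>\<^sup>2 * real k * t (k - 1) - real (k + 2) * t (k + 1)\<bar> / 1"
    unfolding abs_divide by (rule divide_left_mono) (use d in auto)
  also have "\<dots> \<le> \<kappa>\<^sup>2 * real k * V + real (k + 2) * V"
    unfolding div_by_1 by (intro order.trans[OF abs_triangle_ineq4] add_mono m) auto
  finally have "\<bar>loop_linear \<kappa> k d t\<bar> \<le> (V + \<kappa>\<^sup>2 * V) + (\<kappa>\<^sup>2 * real k * V + real (k + 2) * V)"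
    unfolding loop_linear_def
    by (intro order.trans[OF abs_triangle_ineq] order.trans[OF abs_triangle_ineq4] add_mono m t) auto
  also have "\<dots> = (\<kappa>\<^sup>2 * real (k + 1) + real (k + 3)) * V" by (simp add: algebra_simps)
  finally show ?thesis .
qed

lemma dconv_bound:
  assumes t: "\<And>m. m \<le> k + 3 \<Longrightarrow> \<bar>t m\<bar> \<le> U" and s: "\<And>m. m \<le> k + 3 \<Longrightarrow> \<bar>s m\<bar> \<le> V" and j: "j \<le> k + 2"
  shows "\<bar>dconv t s j\<bar> \<le> 2 * real j * (U * V)"
proof -
  have UV: "0 \<le> U" "0 \<le> V" using t[of 0] s[of 0] by auto
  have "\<bar>dconv t s j\<bar> \<le> (\<Sum>a<j. \<bar>s a * t (j - 1 - a) + t a * s (j - 1 - a)\<bar>)" unfolding dconv_def by (rule sum_abs)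
  also have "\<dots> \<le> (\<Sum>a<j. 2 * (U * V))"
  proof (rule sum_mono)
    fix a assume "a \<in> {..<j}"
    then have a: "a \<le> k + 3" "j - 1 - a \<le> k + 3" using j by auto
    have "\<bar>s a * t (j - 1 - a)\<bar> \<le> V * U" "\<bar>t a * s (j - 1 - a)\<bar> \<le> U * V"
      unfolding abs_mult using UV by (intro mult_mono t s a; simp)+
    then show "\<bar>s a * t (j - 1 - a) + t a * s (j - 1 - a)\<bar> \<le> 2 * (U * V)"
      using abs_triangle_ineq[of "s a * t (j - 1 - a)" "t a * s (j - 1 - a)"] by (simp add: mult.commute[of V U])
  qed
  finally show ?thesis by simp
qed

definition stat_const :: "real \<Rightarrow> nat \<Rightarrow> real" where
  "stat_const \<kappa> k = (\<kappa>\<^sup>2 * (2 * real k) + 2 * real (k + 2)) + (\<kappa>\<^sup>2 * real (k + 1) + real (k + 3))"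

lemma dloop_stat_bound:
  assumes d: "d \<ge> 1" and U: "U \<ge> 1" and t: "\<And>m. m \<le> k + 3 \<Longrightarrow> \<bar>t m\<bar> \<le> U" and s: "\<And>m. m \<le> k + 3 \<Longrightarrow> \<bar>s m\<bar> \<le> V"
  shows "\<bar>dloop_stat \<kappa> k d t s\<bar> \<le> stat_const \<kappa> k * (U * V)"
proof -
  have V: "0 \<le> V" using s[of 0] by auto
  have "V \<le> U * V" using mult_right_mono[OF U V] by simp
  then have L: "\<bar>loop_linear \<kappa> k d s\<bar> \<le> (\<kappa>\<^sup>2 * real (k + 1) + real (k + 3)) * (U * V)"
    by (intro order.trans[OF loop_linear_bound[OF d s]] mult_left_mono) auto
  have "\<bar>\<kappa>\<^sup>2 * dconv t s k\<bar> \<le> \<kappa>\<^sup>2 * (2 * real k * (U * V))"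
    using dconv_bound[OF t s, of k] by (simp add: abs_mult mult_left_mono)
  then have "\<bar>dloop_stat \<kappa> k d t s\<bar> \<le> (\<kappa>\<^sup>2 * (2 * real k * (U * V)) + 2 * real (k + 2) * (U * V))
      + (\<kappa>\<^sup>2 * real (k + 1) + real (k + 3)) * (U * V)"
    unfolding dloop_stat_def
    by (intro order.trans[OF abs_triangle_ineq] order.trans[OF abs_triangle_ineq4] add_mono dconv_bound[OF t s] L) auto
  then show ?thesis unfolding stat_const_def by (simp only: distrib_right mult.assoc)
qed

lemma loop_stat_bound:
  assumes d: "d \<ge> 1" and U: "U \<ge> 1" and t: "\<And>m. m \<le> k + 3 \<Longrightarrow> \<bar>t m\<bar> \<le> U"
  shows "\<bar>loop_stat \<kappa> k d t\<bar> \<le> stat_const \<kappa> k * (U * U)"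
proof -
  have half: "2 * conv_moments t j = dconv t t j" for j
  proof -
    have "(\<Sum>a<j. t a * t (j - 1 - a)) + (\<Sum>a<j. t a * t (j - 1 - a)) = dconv t t j"
      unfolding dconv_def sum.distrib ..
    then show ?thesis by (simp add: conv_moments_def)
  qed
  have c: "\<bar>conv_moments t j\<bar> \<le> 2 * real j * (U * U)" if "j \<le> k + 2" for j
  proof -
    have "\<bar>dconv t t j\<bar> \<le> 2 * real j * (U * U)" by (rule dconv_bound[where k = k]) (use t that in auto)
    then have "2 * \<bar>conv_moments t j\<bar> \<le> 2 * real j * (U * U)" unfolding half[symmetric] abs_mult by simp
    then show ?thesis using abs_ge_zero[of "conv_moments t j"] by linarith
  qed
  have "U \<le> U * U" using U by simp
  then have L: "\<bar>loop_linear \<kappa> k d t\<bar> \<le> (\<kappa>\<^sup>2 * real (k + 1) + real (k + 3)) * (U * U)"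
    by (intro order.trans[OF loop_linear_bound[OF d t]] mult_left_mono) auto
  have "\<bar>\<kappa>\<^sup>2 * conv_moments t k\<bar> \<le> \<kappa>\<^sup>2 * (2 * real k * (U * U))"
    using c[of k] by (simp add: abs_mult mult_left_mono)
  then have "\<bar>loop_stat \<kappa> k d t\<bar> \<le> (\<kappa>\<^sup>2 * (2 * real k * (U * U)) + 2 * real (k + 2) * (U * U))
      + (\<kappa>\<^sup>2 * real (k + 1) + real (k + 3)) * (U * U)"
    unfolding loop_stat_def
    by (intro order.trans[OF abs_triangle_ineq] order.trans[OF abs_triangle_ineq4] add_mono c L) auto
  then show ?thesis unfolding stat_const_def by (simp only: distrib_right mult.assoc)
qed

text \<open>
  This is where the flow has bounded speed, uniformly in the dimension.
\<close>

lemma mom_flow_bound: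
  assumes "\<And>m. m \<le> 2 * k + 4 \<Longrightarrow> \<bar>t m\<bar> \<le> U" and m: "m \<le> k + 3" and U: "U \<ge> 0"
  shows "\<bar>mom_flow \<kappa> k t m\<bar> \<le> real (k + 3) * (\<kappa>\<^sup>2 + 1) * U"
proof -
  have "\<bar>\<kappa>\<^sup>2 * t (k + (m - 1)) - t (k + 2 + (m - 1))\<bar> \<le> \<bar>\<kappa>\<^sup>2 * t (k + (m - 1))\<bar> + \<bar>t (k + 2 + (m - 1))\<bar>"
    by (rule abs_triangle_ineq4)
  also have "\<dots> \<le> \<kappa>\<^sup>2 * U + U"
  proof (rule add_mono)
    show "\<bar>\<kappa>\<^sup>2 * t (k + (m - 1))\<bar> \<le> \<kappa>\<^sup>2 * U"
      unfolding abs_mult abs_power2 by (rule mult_left_mono[OF assms(1)]) (use m in auto)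
    show "\<bar>t (k + 2 + (m - 1))\<bar> \<le> U" by (rule assms(1)) (use m in auto)
  qed
  finally have b: "\<bar>\<kappa>\<^sup>2 * t (k + (m - 1)) - t (k + 2 + (m - 1))\<bar> \<le> (\<kappa>\<^sup>2 + 1) * U" by (simp add: distrib_right)
  have "\<bar>mom_flow \<kappa> k t m\<bar> = real m * \<bar>\<kappa>\<^sup>2 * t (k + (m - 1)) - t (k + 2 + (m - 1))\<bar>"
    unfolding mom_flow_def abs_mult by simp
  also have "\<dots> \<le> real (k + 3) * ((\<kappa>\<^sup>2 + 1) * U)"
    by (rule mult_mono) (use b m in auto)
  finally show ?thesis by (simp only: mult.assoc)
qed

definition obs_const :: "real \<Rightarrow> nat \<Rightarrow> real" where
  "obs_const \<kappa> k = stat_const \<kappa> k * (1 + real (k + 3) * (\<kappa>\<^sup>2 + 1))"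

lemma stat_const_nonneg: "stat_const \<kappa> k \<ge> 0"
  by (simp add: stat_const_def)

lemma obs_const_nonneg: "obs_const \<kappa> k \<ge> 0"
  unfolding obs_const_def using stat_const_nonneg[of \<kappa> k] by simp

lemma obs_bounds:
  assumes A: "A \<in> sym_mats d" and d: "d \<ge> 1" and U: "U \<ge> 1" and t: "\<And>m. m \<le> 2 * k + 4 \<Longrightarrow> \<bar>norm_trace A m\<bar> \<le> U"
  shows "\<bar>loop_obs \<kappa> k A\<bar> \<le> obs_const \<kappa> k * U\<^sup>2" "\<bar>flow_obs \<kappa> k A\<bar> \<le> obs_const \<kappa> k * U\<^sup>2"
proof -
  define c where "c = real (k + 3) * (\<kappa>\<^sup>2 + 1)"
  have c: "c \<ge> 0" by (simp add: c_def)
  have dim: "dim_row A = d" using sym_matsD(1)[OF A] by simp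
  have t': "\<bar>norm_trace A m\<bar> \<le> U" if "m \<le> k + 3" for m using t that by simp
  have s: "\<bar>mom_flow \<kappa> k (norm_trace A) m\<bar> \<le> c * U" if "m \<le> k + 3" for m
    unfolding c_def by (rule mom_flow_bound) (use t that U in auto)
  have 1: "\<bar>loop_obs \<kappa> k A\<bar> \<le> stat_const \<kappa> k * 1 * U\<^sup>2"
    using loop_stat_bound[OF d U t'] unfolding loop_obs_def dim by (simp add: power2_eq_square)
  have "\<bar>flow_obs \<kappa> k A\<bar> \<le> stat_const \<kappa> k * (U * (c * U))"
    unfolding flow_obs_def dim by (rule dloop_stat_bound[OF d U t' s])
  then have 2: "\<bar>flow_obs \<kappa> k A\<bar> \<le> stat_const \<kappa> k * c * U\<^sup>2" by (simp only: power2_eq_square mult_ac)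
  have "stat_const \<kappa> k * 1 * U\<^sup>2 \<le> obs_const \<kappa> k * U\<^sup>2" "stat_const \<kappa> k * c * U\<^sup>2 \<le> obs_const \<kappa> k * U\<^sup>2"
    unfolding obs_const_def c_def[symmetric]
    by (intro mult_right_mono mult_left_mono stat_const_nonneg; use c in simp)+
  with 1 2 show "\<bar>loop_obs \<kappa> k A\<bar> \<le> obs_const \<kappa> k * U\<^sup>2" "\<bar>flow_obs \<kappa> k A\<bar> \<le> obs_const \<kappa> k * U\<^sup>2"
    by linarith+
qed

definition confined :: "real \<Rightarrow> real mat \<Rightarrow> bool" where
  "confined \<kappa> A \<longleftrightarrow> (\<forall>e\<in>#eigenvalue_mset A. \<bar>e\<bar> \<le> \<kappa>)"

definition excess :: "real \<Rightarrow> nat \<Rightarrow> real mat \<Rightarrow> real" where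
  "excess \<kappa> q A = power_trace A (2 * q) / \<kappa> ^ (2 * q)"

text \<open>
  In the scaled eigenvalues s = e/\<open>\<kappa>\<close> the wall is at |s| = 1.
\<close>

definition scaled_eigs :: "real \<Rightarrow> real mat \<Rightarrow> real list" where
  "scaled_eigs \<kappa> A = map (\<lambda>e. e / \<kappa>) (sorted_list_of_multiset (eigenvalue_mset A))"

lemma scaled_eigs:
  assumes A: "A \<in> sym_mats d" and k: "\<kappa> > 0"
  shows "length (scaled_eigs \<kappa> A) = d"
    and "power_trace A m = \<kappa> ^ m * (\<Sum>s\<leftarrow>scaled_eigs \<kappa> A. s ^ m)"
    and "excess \<kappa> q A = (\<Sum>s\<leftarrow>scaled_eigs \<kappa> A. s ^ (2 * q))"
    and "confined \<kappa> A \<longleftrightarrow> (\<forall>s\<in>set (scaled_eigs \<kappa> A). \<bar>s\<bar> \<le> 1)"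
proof -
  define es where "es = sorted_list_of_multiset (eigenvalue_mset A)"
  have es: "mset es = eigenvalue_mset A" by (simp add: es_def)
  show "length (scaled_eigs \<kappa> A) = d"
    using power_trace_eq_sum_mset(2)[OF A] unfolding scaled_eigs_def es_def[symmetric] es[symmetric] by simp
  show T: "power_trace A m = \<kappa> ^ m * (\<Sum>s\<leftarrow>scaled_eigs \<kappa> A. s ^ m)" for m
  proof -
    have "power_trace A m = (\<Sum>e\<leftarrow>es. e ^ m)"
      unfolding power_trace_eq_sum_mset(1)[OF A] es[symmetric] by (metis mset_map sum_mset_sum_list)
    also have "\<dots> = (\<Sum>e\<leftarrow>es. \<kappa> ^ m * (e / \<kappa>) ^ m)" using k by (simp add: power_divide)
    also have "\<dots> = \<kappa> ^ m * (\<Sum>s\<leftarrow>scaled_eigs \<kappa> A. s ^ m)"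
      by (simp add: scaled_eigs_def es_def o_def sum_list_const_mult)
    finally show ?thesis .
  qed
  show "excess \<kappa> q A = (\<Sum>s\<leftarrow>scaled_eigs \<kappa> A. s ^ (2 * q))" unfolding excess_def T using k by simp
  have "set es = set_mset (eigenvalue_mset A)" unfolding es[symmetric] by simp
  then show "confined \<kappa> A \<longleftrightarrow> (\<forall>s\<in>set (scaled_eigs \<kappa> A). \<bar>s\<bar> \<le> 1)"
    unfolding confined_def scaled_eigs_def es_def[symmetric] using k by simp
qed

lemma excess_nonneg: "A \<in> sym_mats d \<Longrightarrow> \<kappa> > 0 \<Longrightarrow> excess \<kappa> q A \<ge> 0"
  unfolding excess_def using power_trace_even_nonneg[of A d q] by simp

lemma excess_le_dim:
  assumes A: "A \<in> sym_mats d" and k: "\<kappa> > 0" and c: "confined \<kappa> A"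
  shows "excess \<kappa> q A \<le> real d"
proof -
  define ss where "ss = scaled_eigs \<kappa> A"
  note ss = scaled_eigs[OF A k, folded ss_def]
  have "(\<Sum>s\<leftarrow>ss. s ^ (2 * q)) \<le> (\<Sum>s\<leftarrow>ss. 1)"
  proof (rule sum_list_mono)
    fix s assume "s \<in> set ss"
    then have "\<bar>s\<bar> \<le> 1" using c ss(4) by blast
    then have "\<bar>s\<bar> ^ (2 * q) \<le> 1" by (intro power_le_one) auto
    then show "s ^ (2 * q) \<le> 1" by (simp add: power_even_abs)
  qed
  then show ?thesis unfolding ss(3) using ss(1) by (simp add: sum_list_triv)
qed

text \<open>
  A single eigenvalue outside the interval makes the exponent of the weight diverge.
\<close>

lemma excess_at_top:
  assumes A: "A \<in> sym_mats d" and k: "\<kappa> > 0" and c: "\<not> confined \<kappa> A"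
  shows "filterlim (\<lambda>q. excess \<kappa> q A) at_top sequentially"
proof -
  define ss where "ss = scaled_eigs \<kappa> A"
  note ss = scaled_eigs[OF A k, folded ss_def]
  obtain s where s: "s \<in> set ss" "\<bar>s\<bar> > 1" using c ss(4) by force
  have s2: "1 < s\<^sup>2" using one_less_power[OF s(2), of 2] by simp
  have "filterlim (\<lambda>q. (s\<^sup>2) ^ q) at_infinity sequentially"
    by (rule filterlim_realpow_sequentially_gt1) (use s2 in simp)
  moreover have "0 < (s\<^sup>2) ^ q" for q
    by (rule zero_less_power) (use s2 in linarith)
  ultimately have "filterlim (\<lambda>q. (s\<^sup>2) ^ q) at_top sequentially"
    by (intro filterlim_at_infinity_imp_filterlim_at_top always_eventually allI)
  then show ?thesis
  proof (rule filterlim_at_top_mono)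
    have "(s\<^sup>2) ^ q \<le> excess \<kappa> q A" for q
    proof -
      have "s ^ (2 * q) \<le> (\<Sum>s\<leftarrow>ss. s ^ (2 * q))"
        using nonneg_term_le_sum_list[OF s(1), of "\<lambda>s. s ^ (2 * q)"] by (simp add: power_mult)
      then show ?thesis unfolding ss(3) by (simp add: power_mult)
    qed
    then show "\<forall>\<^sub>F q in sequentially. (s\<^sup>2) ^ q \<le> excess \<kappa> q A" by simp
  qed
qed

text \<open>
  A bound uniform in q: |s|^m is at most 1 inside the interval and at most s^(2q) outside.
\<close>

lemma norm_trace_bound:
  assumes A: "A \<in> sym_mats d" and k: "\<kappa> > 0" and d: "d \<ge> 1" and m: "m \<le> 2 * q"
  shows "\<bar>norm_trace A m\<bar> \<le> \<kappa> ^ m * (1 + excess \<kappa> q A)"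
proof -
  define ss where "ss = scaled_eigs \<kappa> A"
  note ss = scaled_eigs[OF A k, folded ss_def]
  have dim: "dim_row A = d" using sym_matsD(1)[OF A] by simp
  have S: "0 \<le> excess \<kappa> q A" by (rule excess_nonneg[OF A k])
  have "\<bar>\<Sum>s\<leftarrow>ss. s ^ m\<bar> \<le> (\<Sum>s\<leftarrow>ss. \<bar>s ^ m\<bar>)" using sum_list_abs[of "map (\<lambda>s. s ^ m) ss"] by (simp add: o_def)
  also have "\<dots> \<le> (\<Sum>s\<leftarrow>ss. 1 + s ^ (2 * q))"
  proof (rule sum_list_mono)
    fix s :: real
    show "\<bar>s ^ m\<bar> \<le> 1 + s ^ (2 * q)"
    proof (cases "\<bar>s\<bar> \<le> 1")
      case True
      then have "\<bar>s\<bar> ^ m \<le> 1" by (intro power_le_one) auto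
      moreover have "0 \<le> s ^ (2 * q)" by (simp add: power_mult)
      ultimately show ?thesis unfolding power_abs by linarith
    next
      case False
      then have "\<bar>s\<bar> ^ m \<le> \<bar>s\<bar> ^ (2 * q)" using m by (intro power_increasing) auto
      then show ?thesis by (simp add: power_abs power_even_abs)
    qed
  qed
  also have "\<dots> = real d + excess \<kappa> q A" unfolding ss(3) using ss(1) by (simp add: sum_list_addf sum_list_triv)
  also have "\<dots> \<le> real d * (1 + excess \<kappa> q A)"
  proof -
    have "1 * excess \<kappa> q A \<le> real d * excess \<kappa> q A" by (rule mult_right_mono) (use S d in auto)
    then show ?thesis unfolding distrib_left by simp
  qed
  finally have "\<bar>\<Sum>s\<leftarrow>ss. s ^ m\<bar> / real d \<le> 1 + excess \<kappa> q A"
    using d by (simp add: pos_divide_le_eq mult.commute)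
  then have "\<kappa> ^ m * (\<bar>\<Sum>s\<leftarrow>ss. s ^ m\<bar> / real d) \<le> \<kappa> ^ m * (1 + excess \<kappa> q A)"
    using k by (intro mult_left_mono) auto
  then show ?thesis unfolding norm_trace_def dim ss(2) using k by (simp add: abs_mult)
qed

lemma norm_trace_bound_confined:
  assumes A: "A \<in> sym_mats d" and k: "\<kappa> > 0" and d: "d \<ge> 1" and c: "confined \<kappa> A"
  shows "\<bar>norm_trace A m\<bar> \<le> \<kappa> ^ m"
proof -
  define ss where "ss = scaled_eigs \<kappa> A"
  note ss = scaled_eigs[OF A k, folded ss_def]
  have dim: "dim_row A = d" using sym_matsD(1)[OF A] by simp
  have "\<bar>\<Sum>s\<leftarrow>ss. s ^ m\<bar> \<le> (\<Sum>s\<leftarrow>ss. \<bar>s ^ m\<bar>)" using sum_list_abs[of "map (\<lambda>s. s ^ m) ss"] by (simp add: o_def)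
  also have "\<dots> \<le> (\<Sum>s\<leftarrow>ss. 1)"
  proof (rule sum_list_mono)
    fix s assume "s \<in> set ss"
    then have "\<bar>s\<bar> \<le> 1" using c ss(4) by blast
    then show "\<bar>s ^ m\<bar> \<le> 1" unfolding power_abs by (intro power_le_one) auto
  qed
  also have "\<dots> = real d" using ss(1) by (simp add: sum_list_triv)
  finally have "\<bar>\<Sum>s\<leftarrow>ss. s ^ m\<bar> / real d \<le> 1" using d by (simp add: pos_divide_le_eq)
  then have "\<kappa> ^ m * (\<bar>\<Sum>s\<leftarrow>ss. s ^ m\<bar> / real d) \<le> \<kappa> ^ m * 1" using k by (intro mult_left_mono) auto
  then show ?thesis unfolding norm_trace_def dim ss(2) using k by (simp add: abs_mult)
qed

text \<open>
  The contribution of one scaled eigenvalue to the wall term, bounded uniformly in q. Inside the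
  interval, n x^(n-1) (1 - x) \<open>\<le>\<close> 1 - x^n by comparison with the geometric sum; outside, Bernoulli's
  inequality gives q (x^2 - 1) \<open>\<le>\<close> x^(2q).
\<close>

lemma wall_profile_le:
  fixes s :: real
  assumes q: "q \<ge> 1" and k: "k \<le> 2 * q"
  shows "real (2 * q) * (\<bar>s\<bar> ^ (k + (2 * q - 1)) * \<bar>1 - s\<^sup>2\<bar>) \<le> 2 * (1 + s ^ (2 * q)) ^ 3"
proof -
  define x where "x = \<bar>s\<bar>"
  define u where "u = x ^ (2 * q)"
  have x0: "x \<ge> 0" and u0: "u \<ge> 0" by (simp_all add: x_def u_def)
  have us: "s ^ (2 * q) = u" by (simp add: u_def x_def power_even_abs)
  have s2: "s\<^sup>2 = x\<^sup>2" by (simp add: x_def)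
  have c1: "1 \<le> (1 + u) ^ 3" using u0 by (simp add: one_le_power)
  have "real (2 * q) * (x ^ (k + (2 * q - 1)) * \<bar>1 - x\<^sup>2\<bar>) \<le> 2 * (1 + u) ^ 3"
  proof (cases "x \<le> 1")
    case True
    define n where "n = 2 * q"
    have n: "n \<ge> 1" using q by (simp add: n_def)
    have "real n * x ^ (n - 1) * (1 - x) \<le> 1 - x ^ n"
    proof -
      have "real n * x ^ (n - 1) = (\<Sum>i<n. x ^ (n - 1))" by simp
      also have "\<dots> \<le> (\<Sum>i<n. x ^ i)"
        by (intro sum_mono power_decreasing) (use True x0 in auto)
      finally have "real n * x ^ (n - 1) * (1 - x) \<le> (\<Sum>i<n. x ^ i) * (1 - x)"
        using True by (intro mult_right_mono) auto
      also have "\<dots> = 1 - x ^ n" by (simp add: one_diff_power_eq mult.commute)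
      finally show ?thesis .
    qed
    also have "\<dots> \<le> 1" using x0 by simp
    finally have a: "real n * x ^ (n - 1) * (1 - x) \<le> 1" .
    have xk: "x ^ k \<le> 1" using True x0 by (simp add: power_le_one)
    have x2: "\<bar>1 - x\<^sup>2\<bar> = (1 - x) * (1 + x)"
      using power_le_one[OF x0 True, of 2] by (simp add: power2_eq_square algebra_simps)
    have "real n * (x ^ (k + (n - 1)) * \<bar>1 - x\<^sup>2\<bar>) = (real n * x ^ (n - 1) * (1 - x)) * (x ^ k * (1 + x))"
      unfolding x2 power_add by (simp only: mult_ac)
    also have "\<dots> \<le> 1 * (1 * 2)"
      using a xk True x0 by (intro mult_mono) auto
    finally show ?thesis using c1 unfolding n_def by linarith
  next
    case False
    then have x1: "x > 1" by simp
    have "1 + real q * (x\<^sup>2 - 1) \<le> (1 + (x\<^sup>2 - 1)) ^ q"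
      by (rule Bernoulli_inequality) (use x1 in simp)
    then have b: "real q * (x\<^sup>2 - 1) \<le> u" by (simp add: u_def power_mult)
    have x2: "\<bar>1 - x\<^sup>2\<bar> = x\<^sup>2 - 1" using one_less_power[OF x1, of 2] by simp
    have "x ^ (k + (2 * q - 1)) \<le> x ^ (2 * q + 2 * q)"
      by (rule power_increasing) (use x1 k in auto)
    also have "\<dots> = u * u" unfolding u_def by (rule power_add)
    finally have c: "x ^ (k + (2 * q - 1)) \<le> u * u" .
    have "real (2 * q) * (x ^ (k + (2 * q - 1)) * \<bar>1 - x\<^sup>2\<bar>) = 2 * ((real q * (x\<^sup>2 - 1)) * x ^ (k + (2 * q - 1)))"
      unfolding x2 by simp
    also have "\<dots> \<le> 2 * (u * (u * u))"
      by (intro mult_left_mono mult_mono b c) (use u0 x0 in auto)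
    also have "\<dots> = 2 * u ^ 3" by (simp add: power3_eq_cube)
    also have "\<dots> \<le> 2 * (1 + u) ^ 3" using u0 by (intro mult_left_mono power_mono) auto
    finally show ?thesis .
  qed
  then show ?thesis unfolding us s2 x_def by simp
qed

text \<open>
  Inside the interval the power decays geometrically, and at the wall the factor 1 - s^2 vanishes:
  the vector field is tangent to the boundary of the ball.
\<close>

lemma wall_profile_tendsto_0:
  fixes s :: real
  assumes s: "\<bar>s\<bar> \<le> 1"
  shows "(\<lambda>q. real (2 * q) * (\<bar>s\<bar> ^ (k + (2 * q - 1)) * \<bar>1 - s\<^sup>2\<bar>)) \<longlonglongrightarrow> 0"
proof (cases "\<bar>s\<bar> = 1")
  case True
  then have "s\<^sup>2 = 1" by (metis power2_abs power_one)
  then show ?thesis by simp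
next
  case False
  define y where "y = s\<^sup>2"
  have y: "0 \<le> y" "norm y < 1" using s False abs_square_less_1[of s] by (auto simp: y_def)
  have "(\<lambda>n. 2 * (real n * y ^ n) + 2 * y ^ n) \<longlonglongrightarrow> 2 * 0 + 2 * 0"
    by (intro tendsto_add tendsto_mult_left powser_times_n_limit_0 LIMSEQ_power_zero y(2))
  then have lim: "(\<lambda>n. 2 * (real n * y ^ n) + 2 * y ^ n) \<longlonglongrightarrow> 0" by simp
  have "(\<lambda>q. real (2 * Suc q) * (\<bar>s\<bar> ^ (k + (2 * Suc q - 1)) * \<bar>1 - s\<^sup>2\<bar>)) \<longlonglongrightarrow> 0"
  proof (rule Lim_null_comparison[OF _ lim], rule always_eventually, rule allI)
    fix q
    have "\<bar>s\<bar> ^ (k + (2 * Suc q - 1)) \<le> \<bar>s\<bar> ^ (2 * q)"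
      by (rule power_decreasing) (use s in auto)
    also have "\<dots> = y ^ q" by (simp add: y_def power_mult)
    finally have a: "\<bar>s\<bar> ^ (k + (2 * Suc q - 1)) \<le> y ^ q" .
    have "\<bar>1 - s\<^sup>2\<bar> \<le> 1" using y by (simp add: y_def)
    then have "\<bar>s\<bar> ^ (k + (2 * Suc q - 1)) * \<bar>1 - s\<^sup>2\<bar> \<le> y ^ q * 1"
      using a y by (intro mult_mono) auto
    then have "real (2 * Suc q) * (\<bar>s\<bar> ^ (k + (2 * Suc q - 1)) * \<bar>1 - s\<^sup>2\<bar>) \<le> real (2 * Suc q) * (y ^ q * 1)"
      by (rule mult_left_mono) simp
    also have "\<dots> = 2 * (real q * y ^ q) + 2 * y ^ q" by (simp add: algebra_simps)
    finally show "norm (real (2 * Suc q) * (\<bar>s\<bar> ^ (k + (2 * Suc q - 1)) * \<bar>1 - s\<^sup>2\<bar>)) \<le> 2 * (real q * y ^ q) + 2 * y ^ q"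
      by simp
  qed
  then show ?thesis by (rule LIMSEQ_imp_Suc)
qed

lemma wall_obs_abs_le:
  assumes A: "A \<in> sym_mats d" and k: "\<kappa> > 0" and d: "d \<ge> 1" and e: "\<epsilon> > 0" and q: "q \<ge> 1"
    and T: "\<And>m. power_trace A m = \<kappa> ^ m * (\<Sum>s\<leftarrow>ss. s ^ m)"
  shows "\<bar>wall_obs \<kappa> k \<epsilon> q A\<bar> \<le> \<epsilon> * \<kappa> ^ (k + 1) * (\<Sum>s\<leftarrow>ss. real (2 * q) * (\<bar>s\<bar> ^ (k + (2 * q - 1)) * \<bar>1 - s\<^sup>2\<bar>))"
proof -
  have dim: "dim_row A = d" using sym_matsD(1)[OF A] by simp
  define j where "j = k + (2 * q - 1)"
  have j: "j + 1 = k + 2 * q" "k + 2 + (2 * q - 1) = j + 2" using q by (auto simp: j_def)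
  have N: "real d * norm_trace A m = power_trace A m" for m using d dim by (simp add: norm_trace_def)
  have "real d * mom_flow \<kappa> k (norm_trace A) (2 * q) = real (2 * q) * (\<kappa>\<^sup>2 * (real d * norm_trace A j) - real d * norm_trace A (j + 2))"
    unfolding mom_flow_def j(2) j_def[symmetric] by (simp add: algebra_simps)
  also have "\<dots> = \<kappa> ^ (j + 2) * (real (2 * q) * ((\<Sum>s\<leftarrow>ss. s ^ j) - (\<Sum>s\<leftarrow>ss. s ^ (j + 2))))"
  proof -
    have "\<kappa> ^ (j + 2) = \<kappa>\<^sup>2 * \<kappa> ^ j" by (simp only: power_add mult.commute)
    moreover have "n * (K * (P * a) - K * P * b) = K * P * (n * (a - b))" for n K P a b :: real
      by (simp add: algebra_simps)
    ultimately show ?thesis unfolding N T by (simp only:)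
  qed
  also have "(\<Sum>s\<leftarrow>ss. s ^ j) - (\<Sum>s\<leftarrow>ss. s ^ (j + 2)) = (\<Sum>s\<leftarrow>ss. s ^ j * (1 - s\<^sup>2))"
    by (induction ss) (simp_all add: algebra_simps power_add power2_eq_square)
  finally have "real d * mom_flow \<kappa> k (norm_trace A) (2 * q) / \<kappa> ^ (2 * q)
      = \<kappa> ^ (j + 2) / \<kappa> ^ (2 * q) * (real (2 * q) * (\<Sum>s\<leftarrow>ss. s ^ j * (1 - s\<^sup>2)))" by simp
  also have "\<kappa> ^ (j + 2) / \<kappa> ^ (2 * q) = \<kappa> ^ (k + 1)"
  proof -
    have "j + 2 = (k + 1) + 2 * q" using j by simp
    then have "\<kappa> ^ (j + 2) = \<kappa> ^ (k + 1) * \<kappa> ^ (2 * q)" by (simp only: power_add)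
    then show ?thesis using k by simp
  qed
  finally have W: "wall_obs \<kappa> k \<epsilon> q A = - (\<epsilon> * (\<kappa> ^ (k + 1) * (real (2 * q) * (\<Sum>s\<leftarrow>ss. s ^ j * (1 - s\<^sup>2)))))"
    unfolding wall_obs_def dim by simp
  have "\<bar>\<Sum>s\<leftarrow>ss. s ^ j * (1 - s\<^sup>2)\<bar> \<le> (\<Sum>s\<leftarrow>ss. \<bar>s\<bar> ^ j * \<bar>1 - s\<^sup>2\<bar>)"
    using sum_list_abs[of "map (\<lambda>s. s ^ j * (1 - s\<^sup>2)) ss"] by (simp add: o_def abs_mult power_abs)
  then have "\<epsilon> * (\<kappa> ^ (k + 1) * (real (2 * q) * \<bar>\<Sum>s\<leftarrow>ss. s ^ j * (1 - s\<^sup>2)\<bar>))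
    \<le> \<epsilon> * (\<kappa> ^ (k + 1) * (real (2 * q) * (\<Sum>s\<leftarrow>ss. \<bar>s\<bar> ^ j * \<bar>1 - s\<^sup>2\<bar>)))"
    using e k by (intro mult_left_mono) auto
  moreover have "\<bar>wall_obs \<kappa> k \<epsilon> q A\<bar> = \<epsilon> * (\<kappa> ^ (k + 1) * (real (2 * q) * \<bar>\<Sum>s\<leftarrow>ss. s ^ j * (1 - s\<^sup>2)\<bar>))"
    unfolding W abs_minus_cancel abs_mult using e k by simp
  ultimately show ?thesis unfolding j_def[symmetric] by (simp add: sum_list_const_mult mult.assoc)
qed

lemma weight_eq: "weight \<kappa> \<epsilon> q A = exp (- (\<epsilon> * excess \<kappa> q A))"
  by (simp add: weight_def excess_def)

definition growth_const :: "real \<Rightarrow> nat \<Rightarrow> real" where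
  "growth_const \<kappa> k = obs_const \<kappa> k * ((1 + \<kappa>) ^ (2 * k + 4))\<^sup>2"

lemma growth_const_nonneg: "growth_const \<kappa> k \<ge> 0"
  unfolding growth_const_def using obs_const_nonneg by simp

lemma power_le_growth:
  fixes \<kappa> :: real
  assumes "\<kappa> > 0" "m \<le> n"
  shows "\<kappa> ^ m \<le> (1 + \<kappa>) ^ n"
proof -
  have "\<kappa> ^ m \<le> (1 + \<kappa>) ^ m" using assms by (intro power_mono) auto
  also have "\<dots> \<le> (1 + \<kappa>) ^ n" using assms by (intro power_increasing) auto
  finally show ?thesis .
qed

lemma obs_growth:
  assumes A: "A \<in> sym_mats d" and k: "\<kappa> > 0" and d: "d \<ge> 1" and q: "q \<ge> k + 2"
  shows "\<bar>loop_obs \<kappa> k A\<bar> \<le> growth_const \<kappa> k * (1 + excess \<kappa> q A)\<^sup>2"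
    "\<bar>flow_obs \<kappa> k A\<bar> \<le> growth_const \<kappa> k * (1 + excess \<kappa> q A)\<^sup>2"
proof -
  define c where "c = (1 + \<kappa>) ^ (2 * k + 4)"
  have c1: "c \<ge> 1" unfolding c_def using k by (intro one_le_power) auto
  define S where "S = 1 + excess \<kappa> q A"
  have S: "S \<ge> 1" using excess_nonneg[OF A k] by (simp add: S_def)
  have t: "\<bar>norm_trace A m\<bar> \<le> c * S" if m: "m \<le> 2 * k + 4" for m
  proof -
    have "m \<le> 2 * q" using m q by simp
    from norm_trace_bound[OF A k d this] have "\<bar>norm_trace A m\<bar> \<le> \<kappa> ^ m * S" by (simp add: S_def)
    also have "\<dots> \<le> c * S" using power_le_growth[OF k m] S unfolding c_def by (intro mult_right_mono) auto
    finally show ?thesis .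
  qed
  have cS: "1 \<le> c * S" using mult_mono[of 1 c 1 S] c1 S by simp
  show "\<bar>loop_obs \<kappa> k A\<bar> \<le> growth_const \<kappa> k * (1 + excess \<kappa> q A)\<^sup>2"
    "\<bar>flow_obs \<kappa> k A\<bar> \<le> growth_const \<kappa> k * (1 + excess \<kappa> q A)\<^sup>2"
    unfolding growth_const_def c_def[symmetric] S_def[symmetric] mult.assoc power_mult_distrib[symmetric]
    by (rule obs_bounds[OF A d cS]; rule t; assumption)+
qed

lemma obs_growth_confined:
  assumes A: "A \<in> sym_mats d" and k: "\<kappa> > 0" and d: "d \<ge> 1" and c: "confined \<kappa> A"
  shows "\<bar>loop_obs \<kappa> k A\<bar> \<le> growth_const \<kappa> k" "\<bar>flow_obs \<kappa> k A\<bar> \<le> growth_const \<kappa> k"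
proof -
  have t: "\<bar>norm_trace A m\<bar> \<le> (1 + \<kappa>) ^ (2 * k + 4)" if "m \<le> 2 * k + 4" for m
    using norm_trace_bound_confined[OF A k d c, of m] power_le_growth[OF k that] by linarith
  have one: "1 \<le> (1 + \<kappa>) ^ (2 * k + 4)" using k by (intro one_le_power) auto
  show "\<bar>loop_obs \<kappa> k A\<bar> \<le> growth_const \<kappa> k" "\<bar>flow_obs \<kappa> k A\<bar> \<le> growth_const \<kappa> k"
    unfolding growth_const_def
    by (rule obs_bounds[OF A d one]; rule t; assumption)+
qed

lemma wall_growth:
  assumes A: "A \<in> sym_mats d" and k: "\<kappa> > 0" and d: "d \<ge> 1" and e: "\<epsilon> > 0" and q: "q \<ge> k + 2"
  shows "\<bar>wall_obs \<kappa> k \<epsilon> q A\<bar> \<le> \<epsilon> * \<kappa> ^ (k + 1) * (2 * real d) * (1 + excess \<kappa> q A) ^ 3"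
proof -
  define ss where "ss = scaled_eigs \<kappa> A"
  note ss = scaled_eigs[OF A k, folded ss_def]
  have q1: "q \<ge> 1" "k \<le> 2 * q" using q by auto
  have "(\<Sum>s\<leftarrow>ss. real (2 * q) * (\<bar>s\<bar> ^ (k + (2 * q - 1)) * \<bar>1 - s\<^sup>2\<bar>)) \<le> (\<Sum>s\<leftarrow>ss. 2 * (1 + excess \<kappa> q A) ^ 3)"
  proof (rule sum_list_mono)
    fix s assume s: "s \<in> set ss"
    have "s ^ (2 * q) \<le> excess \<kappa> q A" unfolding ss(3)
      by (rule nonneg_term_le_sum_list[OF s]) (simp add: power_mult)
    then have "(1 + s ^ (2 * q)) ^ 3 \<le> (1 + excess \<kappa> q A) ^ 3"
      by (intro power_mono) (auto simp: power_mult)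
    then show "real (2 * q) * (\<bar>s\<bar> ^ (k + (2 * q - 1)) * \<bar>1 - s\<^sup>2\<bar>) \<le> 2 * (1 + excess \<kappa> q A) ^ 3"
      using wall_profile_le[OF q1, of s] by linarith
  qed
  also have "\<dots> = 2 * real d * (1 + excess \<kappa> q A) ^ 3" using ss(1) by (simp add: sum_list_triv)
  finally have "\<epsilon> * \<kappa> ^ (k + 1) * (\<Sum>s\<leftarrow>ss. real (2 * q) * (\<bar>s\<bar> ^ (k + (2 * q - 1)) * \<bar>1 - s\<^sup>2\<bar>))
     \<le> \<epsilon> * \<kappa> ^ (k + 1) * (2 * real d * (1 + excess \<kappa> q A) ^ 3)"
    using e k by (intro mult_left_mono) auto
  then show ?thesis using wall_obs_abs_le[OF A k d e q1(1) ss(2), of k] by (simp only: mult.assoc)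
qed

lemma wall_obs_tendsto_0:
  assumes A: "A \<in> sym_mats d" and k: "\<kappa> > 0" and d: "d \<ge> 1" and e: "\<epsilon> > 0" and c: "confined \<kappa> A"
  shows "(\<lambda>q. wall_obs \<kappa> k \<epsilon> q A) \<longlonglongrightarrow> 0"
proof -
  define ss where "ss = scaled_eigs \<kappa> A"
  note ss = scaled_eigs[OF A k, folded ss_def]
  define g where "g s q = real (2 * q) * (\<bar>s\<bar> ^ (k + (2 * q - 1)) * \<bar>1 - s\<^sup>2\<bar>)" for s :: real and q
  have "\<forall>s\<in>set ss. \<bar>s\<bar> \<le> 1" using c ss(4) by blast
  then have "(\<lambda>q. \<Sum>s\<leftarrow>ss. g s q) \<longlonglongrightarrow> 0"
  proof (induction ss)
    case Nil
    then show ?case by simp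
  next
    case (Cons a ss)
    then have "(\<lambda>q. g a q + (\<Sum>s\<leftarrow>ss. g s q)) \<longlonglongrightarrow> 0 + 0"
      unfolding g_def by (intro tendsto_add wall_profile_tendsto_0) auto
    then show ?case by simp
  qed
  then have lim: "(\<lambda>q. \<epsilon> * \<kappa> ^ (k + 1) * (\<Sum>s\<leftarrow>ss. g s q)) \<longlonglongrightarrow> 0" by (rule tendsto_mult_right_zero)
  show ?thesis
  proof (rule Lim_null_comparison[OF _ lim], rule eventually_sequentiallyI)
    fix q :: nat assume "1 \<le> q"
    then show "norm (wall_obs \<kappa> k \<epsilon> q A) \<le> \<epsilon> * \<kappa> ^ (k + 1) * (\<Sum>s\<leftarrow>ss. g s q)"
      unfolding g_def real_norm_def by (rule wall_obs_abs_le[OF A k d e _ ss(2)])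
  qed
qed

section \<open>The second moment of the loop observable on the ball\<close>

text \<open>
  A description of the ball by countably many polynomial inequalities, which shows that it is
  measurable.
\<close>

lemma confined_iff_excess:
  assumes A: "A \<in> sym_mats d" and k: "\<kappa> > 0"
  shows "confined \<kappa> A \<longleftrightarrow> (\<forall>q. excess \<kappa> q A \<le> real d)"
proof
  assume "confined \<kappa> A"
  then show "\<forall>q. excess \<kappa> q A \<le> real d" using excess_le_dim[OF A k] by blast
next
  assume le: "\<forall>q. excess \<kappa> q A \<le> real d"
  show "confined \<kappa> A"
  proof (rule ccontr)
    assume "\<not> confined \<kappa> A"
    from excess_at_top[OF A k this] have "\<forall>\<^sub>F q in sequentially. real d + 1 \<le> excess \<kappa> q A"
      unfolding filterlim_at_top by blast
    then obtain q where "real d + 1 \<le> excess \<kappa> q A" using eventually_happens'[OF sequentially_bot] by blast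
    then show False using le[rule_format, of q] by linarith
  qed
qed

lemma measurable_excess: "excess \<kappa> q \<in> borel_measurable (sym_mat_algebra d)"
  unfolding excess_def[abs_def] by (intro tame_measurable tame_divide tame_power_trace)

definition confined_set :: "real \<Rightarrow> nat \<Rightarrow> real mat set" where
  "confined_set \<kappa> d = {A \<in> sym_mats d. confined \<kappa> A}"

lemma sets_confined:
  assumes "\<kappa> > 0"
  shows "confined_set \<kappa> d \<in> sets (sym_mat_algebra d)"
proof -
  have "{A \<in> space (sym_mat_algebra d). \<forall>q. excess \<kappa> q A \<le> real d} \<in> sets (sym_mat_algebra d)"
    using measurable_excess[measurable] by measurable
  also have "{A \<in> space (sym_mat_algebra d). \<forall>q. excess \<kappa> q A \<le> real d} = confined_set \<kappa> d"
    unfolding space_sym_mat_algebra confined_set_def using confined_iff_excess[OF _ assms] by blast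
  finally show ?thesis .
qed

lemma space_GOE: "space (GOE d) = sym_mats d" "sets (GOE d) = sets (sym_mat_algebra d)"
  by (simp_all add: GOE_def space_sym_mat_algebra)

lemma power_times_exp_tendsto_0:
  fixes \<epsilon> :: real
  assumes e: "\<epsilon> > 0"
  shows "((\<lambda>u. (1 + u) ^ K * exp (- (\<epsilon> * u))) \<longlongrightarrow> 0) at_top"
proof -
  obtain C where C: "C \<ge> 0" "\<forall>u\<ge>0. (1 + u) ^ Suc K * exp (- (\<epsilon> * u)) \<le> C"
    using power_times_exp_bounded[OF e, of "Suc K"] by blast
  have lim: "((\<lambda>u::real. C * inverse (1 + u)) \<longlongrightarrow> 0) at_top"
    by (intro tendsto_mult_right_zero tendsto_inverse_0_at_top filterlim_tendsto_add_at_top[OF tendsto_const] filterlim_ident)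
  show ?thesis
  proof (rule Lim_null_comparison[OF _ lim])
    show "\<forall>\<^sub>F u in at_top. norm ((1 + u) ^ K * exp (- (\<epsilon> * u))) \<le> C * inverse (1 + u)"
    proof (rule eventually_mono[OF eventually_ge_at_top[of 0]])
      fix u :: real assume u: "0 \<le> u"
      have "(1 + u) * ((1 + u) ^ K * exp (- (\<epsilon> * u))) \<le> C" using C(2) u by (simp add: mult.assoc)
      then have "(1 + u) ^ K * exp (- (\<epsilon> * u)) \<le> C / (1 + u)"
        using u by (simp add: pos_le_divide_eq mult.commute)
      then show "norm ((1 + u) ^ K * exp (- (\<epsilon> * u))) \<le> C * inverse (1 + u)"
        using u by (simp add: divide_inverse)
    qed
  qed
qed

text \<open>
  The loop identity bounds the integral of \<open>loop_obs\<close>^2 times the weight by that of the flow term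
  plus the wall term. On the ball the weight is at least exp (-1) and the flow term is at most
  \<open>growth_const\<close>; everything else is an error that vanishes as q tends to infinity.
\<close>

lemma loop_second_moment:
  fixes k :: nat
  assumes d: "d \<ge> 1" and kp: "\<kappa> > 0"
  shows "integrable (GOE d) (\<lambda>A. indicator (confined_set \<kappa> d) A * (loop_obs \<kappa> k A)\<^sup>2)"
    "(\<integral>A. indicator (confined_set \<kappa> d) A * (loop_obs \<kappa> k A)\<^sup>2 \<partial>GOE d)
       \<le> 2 * exp 1 * growth_const \<kappa> k / (real d)\<^sup>2 * measure (GOE d) (confined_set \<kappa> d)"
proof -
  interpret G: prob_space "GOE d" by (rule prob_space_GOE[OF d])
  let ?E = "confined_set \<kappa> d"
  let ?X = "loop_obs \<kappa> k" and ?Z = "flow_obs \<kappa> k"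
  let ?c = "growth_const \<kappa> k"
  \<comment> \<open>The exponent of the weight is at most \<open>\<epsilon> * d\<close> on the ball.\<close>
  define \<epsilon> where "\<epsilon> = 1 / real d"
  have e: "\<epsilon> > 0" using d by (simp add: \<epsilon>_def)
  let ?B = "wall_obs \<kappa> k \<epsilon>" and ?w = "weight \<kappa> \<epsilon>"
  have meas_eq: "borel_measurable (GOE d) = borel_measurable (sym_mat_algebra d)"
    by (rule measurable_cong_sets) (simp_all add: space_GOE)
  have mX: "?X \<in> borel_measurable (GOE d)" and mZ: "?Z \<in> borel_measurable (GOE d)"
    and mB: "?B q \<in> borel_measurable (GOE d)" and mw: "?w q \<in> borel_measurable (GOE d)" for q
    unfolding meas_eq by (rule tame_measurable tame_loop_obs tame_flow_obs tame_wall_obs measurable_weight)+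
  have E: "?E \<in> sets (GOE d)" unfolding space_GOE by (rule sets_confined[OF kp])
  have mE: "(indicator ?E :: _ \<Rightarrow> real) \<in> borel_measurable (GOE d)" using E by (rule borel_measurable_indicator)
  have spE: "A \<in> sym_mats d \<Longrightarrow> indicator ?E A = (if confined \<kappa> A then 1 else (0::real))" for A
    by (simp add: confined_set_def)
  note c0 = growth_const_nonneg[of \<kappa> k]
  note m = borel_measurable_times borel_measurable_power borel_measurable_add borel_measurable_diff borel_measurable_abs
     borel_measurable_const mX mZ mB mw mE
  have iX: "integrable (GOE d) (\<lambda>A. indicator ?E A * (?X A)\<^sup>2)"
  proof (rule G.integrable_const_bound[of _ "?c\<^sup>2"])
    show "(\<lambda>A. indicator ?E A * (?X A)\<^sup>2) \<in> borel_measurable (GOE d)" by (intro m)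
    show "AE A in GOE d. norm (indicator ?E A * (?X A)\<^sup>2) \<le> ?c\<^sup>2"
    proof (rule AE_I2)
      fix A assume "A \<in> space (GOE d)"
      then have A: "A \<in> sym_mats d" by (simp add: space_GOE)
      show "norm (indicator ?E A * (?X A)\<^sup>2) \<le> ?c\<^sup>2"
      proof (cases "confined \<kappa> A")
        case True
        have "\<bar>?X A\<bar>\<^sup>2 \<le> ?c\<^sup>2" by (rule power_mono[OF obs_growth_confined(1)[OF A kp d True]]) simp
        then show ?thesis using True by (simp add: spE[OF A])
      qed (simp add: spE[OF A])
    qed
  qed
  then show "integrable (GOE d) (\<lambda>A. indicator ?E A * (?X A)\<^sup>2)" .
  \<comment> \<open>The error: the flow term that the weight leaves outside the ball, and the wall term.\<close>
  define r where "r q A = (1 - indicator ?E A) * (\<bar>?Z A\<bar> * ?w q A) + \<bar>?X A * ?B q A\<bar> * ?w q A" for q A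
  have mr: "r q \<in> borel_measurable (GOE d)" for q
    unfolding r_def by (intro m)
  have w1: "0 \<le> ?w q A" "?w q A \<le> 1" if "A \<in> sym_mats d" for q A
    using excess_nonneg[OF that kp, of q] e unfolding weight_eq by auto
  define c' where "c' = ?c + ?c * (\<epsilon> * \<kappa> ^ (k + 1) * (2 * real d))"
  have c'0: "c' \<ge> 0" unfolding c'_def using c0 e kp by simp
  have r0: "0 \<le> r q A" if A: "A \<in> sym_mats d" for q A
    unfolding r_def using w1[OF A, of q] by (intro add_nonneg_nonneg mult_nonneg_nonneg) (auto simp: indicator_def)
  have rb: "r q A \<le> c' * ((1 + excess \<kappa> q A) ^ 5 * exp (- (\<epsilon> * excess \<kappa> q A)))"
    if A: "A \<in> sym_mats d" and q: "q \<ge> k + 2" for q A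
  proof -
    define S where "S = 1 + excess \<kappa> q A"
    have S: "S \<ge> 1" using excess_nonneg[OF A kp, of q] by (simp add: S_def)
    have S25: "S\<^sup>2 \<le> S ^ 5" using S by (intro power_increasing) auto
    have wq: "0 \<le> ?w q A" by (rule w1[OF A])
    have Z: "\<bar>?Z A\<bar> \<le> ?c * S ^ 5"
      using obs_growth(2)[OF A kp d q] mult_left_mono[OF S25 c0] unfolding S_def[symmetric] by linarith
    have "\<bar>?X A * ?B q A\<bar> \<le> (?c * S\<^sup>2) * (\<epsilon> * \<kappa> ^ (k + 1) * (2 * real d) * S ^ 3)"
      unfolding abs_mult S_def
      by (rule mult_mono[OF obs_growth(1)[OF A kp d q] wall_growth[OF A kp d e q]]) (use c0 in auto)
    also have "\<dots> = ?c * (\<epsilon> * \<kappa> ^ (k + 1) * (2 * real d)) * (S\<^sup>2 * S ^ 3)" by (simp only: mult_ac)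
    also have "S\<^sup>2 * S ^ 3 = S ^ 5" by (simp flip: power_add)
    finally have XB: "\<bar>?X A * ?B q A\<bar> \<le> ?c * (\<epsilon> * \<kappa> ^ (k + 1) * (2 * real d)) * S ^ 5" .
    have "(1 - indicator ?E A) * (\<bar>?Z A\<bar> * ?w q A) \<le> \<bar>?Z A\<bar> * ?w q A"
      using wq by (simp add: indicator_def)
    also have "\<dots> \<le> ?c * S ^ 5 * ?w q A" by (rule mult_right_mono[OF Z wq])
    finally have "r q A \<le> ?c * S ^ 5 * ?w q A + ?c * (\<epsilon> * \<kappa> ^ (k + 1) * (2 * real d)) * S ^ 5 * ?w q A"
      unfolding r_def using mult_right_mono[OF XB wq] by (rule add_mono)
    also have "\<dots> = c' * (S ^ 5 * ?w q A)" unfolding c'_def by (simp only: distrib_right mult.assoc)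
    finally show ?thesis unfolding S_def weight_eq .
  qed
  have rlim: "(\<lambda>q. r q A) \<longlonglongrightarrow> 0" if A: "A \<in> sym_mats d" for A
  proof (cases "confined \<kappa> A")
    case True
    have lim: "(\<lambda>q. \<bar>?X A\<bar> * \<bar>?B q A\<bar>) \<longlonglongrightarrow> 0"
      by (intro tendsto_mult_right_zero tendsto_rabs_zero wall_obs_tendsto_0[OF A kp d e True])
    show ?thesis
    proof (rule Lim_null_comparison[OF _ lim], rule always_eventually, rule allI)
      fix q
      have "\<bar>?X A * ?B q A\<bar> * ?w q A \<le> \<bar>?X A * ?B q A\<bar> * 1"
        by (rule mult_left_mono[OF w1(2)[OF A]]) simp
      then have "r q A \<le> \<bar>?X A\<bar> * \<bar>?B q A\<bar>" using True by (simp add: r_def spE[OF A] abs_mult)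
      then show "norm (r q A) \<le> \<bar>?X A\<bar> * \<bar>?B q A\<bar>" using r0[OF A, of q] by simp
    qed
  next
    case False
    have lim: "(\<lambda>q. c' * ((1 + excess \<kappa> q A) ^ 5 * exp (- (\<epsilon> * excess \<kappa> q A)))) \<longlonglongrightarrow> 0"
      by (intro tendsto_mult_right_zero filterlim_compose[OF power_times_exp_tendsto_0[OF e] excess_at_top[OF A kp False]])
    show ?thesis
    proof (rule Lim_null_comparison[OF _ lim], rule eventually_sequentiallyI[of "k + 2"])
      fix q assume "k + 2 \<le> q"
      then show "norm (r q A) \<le> c' * ((1 + excess \<kappa> q A) ^ 5 * exp (- (\<epsilon> * excess \<kappa> q A)))"
        using rb[OF A, of q] r0[OF A, of q] by simp
    qed
  qed
  obtain C5 where C5: "\<And>u. u \<ge> 0 \<Longrightarrow> (1 + u) ^ 5 * exp (- (\<epsilon> * u)) \<le> C5"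
    using power_times_exp_bounded[OF e, of 5] by blast
  have rbd: "norm (r q A) \<le> c' * C5" if A: "A \<in> sym_mats d" and q: "q \<ge> k + 2" for q A
    using rb[OF A q] r0[OF A, of q] mult_left_mono[OF C5[OF excess_nonneg[OF A kp, of q]] c'0] by simp
  have ir: "integrable (GOE d) (r q)" if q: "q \<ge> k + 2" for q
    by (rule G.integrable_const_bound[of _ "c' * C5"]) (rule AE_I2, rule rbd, simp add: space_GOE, rule q, rule mr)
  have rint: "(\<lambda>q. \<integral>A. r (q + (k + 2)) A \<partial>GOE d) \<longlonglongrightarrow> (\<integral>A. 0 \<partial>GOE d)"
  proof (rule integral_dominated_convergence[where w = "\<lambda>_. c' * C5"])
    show "AE A in GOE d. (\<lambda>q. r (q + (k + 2)) A) \<longlonglongrightarrow> 0"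
      by (rule AE_I2, rule LIMSEQ_ignore_initial_segment, rule rlim) (simp add: space_GOE)
    show "AE A in GOE d. norm (r (q + (k + 2)) A) \<le> c' * C5" for q
      by (rule AE_I2, rule rbd) (simp_all add: space_GOE)
  qed (use mr in auto)
  define a where "a = (real d)\<^sup>2 / 2 * exp (-1)"
  have main: "a * (\<integral>A. indicator ?E A * (?X A)\<^sup>2 \<partial>GOE d) \<le> ?c * measure (GOE d) ?E + (\<integral>A. r q A \<partial>GOE d)"
    if q: "q \<ge> k + 2" for q
  proof -
    define R where "R A = ((real d)\<^sup>2 / 2 * (?X A)\<^sup>2 + ?Z A + ?X A * ?B q A) * ?w q A" for A
    have q1: "q \<ge> 1" using q by simp
    note id = GOE_loop_identity[OF d kp e q1, of k, folded R_def[abs_def]]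
    have iE: "integrable (GOE d) (\<lambda>A. ?c * indicator ?E A)"
      by (rule integrable_mult_right, rule integrable_real_indicator[OF E]) (simp add: less_top[symmetric])
    have "(\<integral>A. a * (indicator ?E A * (?X A)\<^sup>2) \<partial>GOE d) \<le> (\<integral>A. R A + (?c * indicator ?E A + r q A) \<partial>GOE d)"
    proof (rule integral_mono)
      show "integrable (GOE d) (\<lambda>A. a * (indicator ?E A * (?X A)\<^sup>2))" using iX by (rule integrable_mult_right)
      show "integrable (GOE d) (\<lambda>A. R A + (?c * indicator ?E A + r q A))"
        using id(1) iE ir[OF q] by (intro Bochner_Integration.integrable_add)
      fix A assume "A \<in> space (GOE d)"
      then have A: "A \<in> sym_mats d" by (simp add: space_GOE)
      have split: "R A = (real d)\<^sup>2 / 2 * (?w q A * (?X A)\<^sup>2) + ?Z A * ?w q A + ?X A * ?B q A * ?w q A"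
        unfolding R_def by (simp add: algebra_simps)
      have XB: "- (\<bar>?X A * ?B q A\<bar> * ?w q A) \<le> ?X A * ?B q A * ?w q A"
        using mult_right_mono[OF abs_ge_minus_self[of "?X A * ?B q A"] w1(1)[OF A, of q]] by simp
      have Zw: "- (\<bar>?Z A\<bar> * ?w q A) \<le> ?Z A * ?w q A"
        using mult_right_mono[OF abs_ge_minus_self[of "?Z A"] w1(1)[OF A, of q]] by simp
      show "a * (indicator ?E A * (?X A)\<^sup>2) \<le> R A + (?c * indicator ?E A + r q A)"
      proof (cases "confined \<kappa> A")
        case True
        have "\<epsilon> * excess \<kappa> q A \<le> 1"
          using excess_le_dim[OF A kp True, of q] d by (simp add: \<epsilon>_def)
        then have "exp (-1) \<le> ?w q A" unfolding weight_eq by simp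
        then have "exp (-1) * (?X A)\<^sup>2 \<le> ?w q A * (?X A)\<^sup>2" by (rule mult_right_mono) simp
        then have "(real d)\<^sup>2 / 2 * (exp (-1) * (?X A)\<^sup>2) \<le> (real d)\<^sup>2 / 2 * (?w q A * (?X A)\<^sup>2)" by (rule mult_left_mono) simp
        moreover have "\<bar>?Z A\<bar> * ?w q A \<le> ?c * 1"
          by (rule mult_mono[OF obs_growth_confined(2)[OF A kp d True] w1(2)[OF A] c0 w1(1)[OF A]])
        ultimately show ?thesis
          using XB Zw unfolding split r_def spE[OF A] a_def using True by simp
      next
        case False
        have "0 \<le> (real d)\<^sup>2 / 2 * (?w q A * (?X A)\<^sup>2)" using w1(1)[OF A, of q] by simp
        then show ?thesis
          using XB Zw unfolding split r_def spE[OF A] using False by simp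
      qed
    qed
    also have "\<dots> = (\<integral>A. R A \<partial>GOE d) + ((\<integral>A. ?c * indicator ?E A \<partial>GOE d) + (\<integral>A. r q A \<partial>GOE d))"
      using id(1) iE ir[OF q] by (simp add: Bochner_Integration.integral_add)
    also have "\<dots> = ?c * measure (GOE d) ?E + (\<integral>A. r q A \<partial>GOE d)"
      using E by (simp add: id(2))
    finally show ?thesis by simp
  qed
  have "a * (\<integral>A. indicator ?E A * (?X A)\<^sup>2 \<partial>GOE d) \<le> ?c * measure (GOE d) ?E + 0"
  proof (rule LIMSEQ_le_const)
    show "(\<lambda>q. ?c * measure (GOE d) ?E + (\<integral>A. r (q + (k + 2)) A \<partial>GOE d)) \<longlonglongrightarrow> ?c * measure (GOE d) ?E + 0"
      using rint by (intro tendsto_add tendsto_const) simp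
    show "\<exists>N. \<forall>n\<ge>N. a * (\<integral>A. indicator ?E A * (?X A)\<^sup>2 \<partial>GOE d) \<le> ?c * measure (GOE d) ?E + (\<integral>A. r (n + (k + 2)) A \<partial>GOE d)"
      using main by (intro exI[of _ 0]) simp
  qed
  moreover have "a > 0" using d by (simp add: a_def)
  ultimately have "(\<integral>A. indicator ?E A * (?X A)\<^sup>2 \<partial>GOE d) \<le> ?c * measure (GOE d) ?E / a"
    by (simp add: pos_le_divide_eq mult.commute)
  also have "\<dots> = 2 * exp 1 * ?c / (real d)\<^sup>2 * measure (GOE d) ?E"
    using d by (simp add: a_def exp_minus field_simps)
  finally show "(\<integral>A. indicator ?E A * (?X A)\<^sup>2 \<partial>GOE d) \<le> 2 * exp 1 * ?c / (real d)\<^sup>2 * measure (GOE d) ?E" .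
qed

section \<open>The limiting loop equations have one solution\<close>

context
  includes fps_syntax
begin

text \<open>
  The moments of the arcsine law on the interval from -\<open>\<kappa>\<close> to \<open>\<kappa>\<close>, by the recursion that integration by
  parts of x^(n+1) sqrt (\<open>\<kappa>\<close>^2 - x^2) gives.
\<close>

fun arcsine_moment :: "real \<Rightarrow> nat \<Rightarrow> real" where
  "arcsine_moment \<kappa> 0 = 1"
| "arcsine_moment \<kappa> (Suc 0) = 0"
| "arcsine_moment \<kappa> (Suc (Suc n)) = \<kappa>\<^sup>2 * real (n + 1) / real (n + 2) * arcsine_moment \<kappa> n"

text \<open>
  The density \<open>rho\<close> is the arcsine density times ((4 + \<open>\<kappa>\<close>^2) / 2 - x^2) / 2.
\<close>

definition limit_moment :: "real \<Rightarrow> nat \<Rightarrow> real" where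
  "limit_moment \<kappa> n = ((4 + \<kappa>\<^sup>2) / 2 * arcsine_moment \<kappa> n - arcsine_moment \<kappa> (n + 2)) / 2"

text \<open>
  The generating function of the arcsine moments is 1 / sqrt (1 - \<open>\<kappa>\<close>^2 X^2).
\<close>

lemma arcsine_fps_square:
  fixes \<kappa> :: real
  defines "S \<equiv> Abs_fps (arcsine_moment \<kappa>)"
  shows "(1 - fps_const (\<kappa>\<^sup>2) * fps_X\<^sup>2) * S\<^sup>2 = 1"
proof -
  let ?c = "fps_const (\<kappa>\<^sup>2)"
  \<comment> \<open>The recursion of the coefficients as a differential equation; it makes (1 - c X^2) S^2 constant.\<close>
  have ode: "(1 - ?c * fps_X\<^sup>2) * fps_deriv S = ?c * fps_X * S"
  proof (rule fps_ext)
    fix n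
    have 1: "((1 - ?c * fps_X\<^sup>2) * fps_deriv S) $ n
        = fps_deriv S $ n - \<kappa>\<^sup>2 * (if n < 2 then 0 else fps_deriv S $ (n - 2))"
      by (simp add: left_diff_distrib mult.assoc fps_X_power_mult_nth del: fps_deriv_nth)
    have 2: "(?c * fps_X * S) $ n = \<kappa>\<^sup>2 * (if n = 0 then 0 else S $ (n - 1))"
      by (simp add: mult.assoc)
    show "((1 - ?c * fps_X\<^sup>2) * fps_deriv S) $ n = (?c * fps_X * S) $ n"
    proof (cases n)
      case 0
      then show ?thesis unfolding 1 2 by (simp add: S_def)
    next
      case (Suc m)
      show ?thesis
      proof (cases m)
        case 0
        then show ?thesis using Suc unfolding 1 2 by (simp add: S_def)
      next
        case (Suc l)
        then show ?thesis using \<open>n = Suc m\<close> unfolding 1 2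
          by (simp add: S_def) (simp add: field_simps)
      qed
    qed
  qed
  let ?P = "(1 - ?c * fps_X\<^sup>2) * S\<^sup>2"
  have "fps_deriv ?P = - (2 * ?c * fps_X) * S\<^sup>2 + 2 * S * ((1 - ?c * fps_X\<^sup>2) * fps_deriv S)"
    by (simp add: power2_eq_square algebra_simps)
  also have "\<dots> = 0" unfolding ode by (simp add: power2_eq_square algebra_simps)
  finally have "fps_deriv ?P = 0" .
  then have "?P = fps_const (?P $ 0)" by (simp only: fps_deriv_eq_0_iff)
  also have "?P $ 0 = 1" by (simp add: S_def power2_eq_square)
  finally show ?thesis by simp
qed

lemma conv_moments_fps:
  "(fps_X * (Abs_fps t)\<^sup>2) $ n = conv_moments t n"
proof (cases n)
  case 0
  then show ?thesis by (simp add: conv_moments_def)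
next
  case (Suc m)
  then show ?thesis
    by (simp add: conv_moments_def power2_eq_square)
       (simp add: fps_mult_nth atLeast0AtMost flip: lessThan_Suc_atMost)
qed

text \<open>
  With w = 1/z and G(z) = w T(w), the bracket on the left is - w (2 G(z) - z) and the right-hand side
  is w^4 times the quartic Q of the introduction. The loop equations say that all coefficients of
  (1 - \<open>\<kappa>\<close>^2 X^2) (T - X^2 T^2) from the third on vanish.
\<close>

lemma loop_equation_fps:
  fixes t :: "nat \<Rightarrow> 'a::field"
  assumes t0: "t 0 = 1" and loop: "\<And>k. loop_defect (\<kappa>\<^sup>2) t k = 0"
  defines "T \<equiv> Abs_fps t"
  shows "(1 - 2 * fps_X\<^sup>2 * T)\<^sup>2 * (1 - fps_const (\<kappa>\<^sup>2) * fps_X\<^sup>2)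
     = 1 - fps_const (4 + \<kappa>\<^sup>2) * fps_X\<^sup>2 - fps_const (4 * t 1) * fps_X ^ 3
         + fps_const (4 * (1 + \<kappa>\<^sup>2 - t 2)) * fps_X ^ 4"
proof -
  let ?c = "fps_const (\<kappa>\<^sup>2)"
  have key: "(1 - ?c * fps_X\<^sup>2) * (T - fps_X\<^sup>2 * T\<^sup>2) = 1 + fps_const (t 1) * fps_X
      + fps_const (t 2 - 1 - \<kappa>\<^sup>2) * fps_X\<^sup>2"
  proof (rule fps_ext)
    fix n
    have sq: "(fps_X\<^sup>2 * T\<^sup>2) $ n = (if n = 0 then 0 else conv_moments t (n - 1))" for n
      using conv_moments_fps[of t "n - 1"] unfolding T_def
      by (simp add: power2_eq_square mult.assoc)
    have lhs: "((1 - ?c * fps_X\<^sup>2) * (T - fps_X\<^sup>2 * T\<^sup>2)) $ n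
       = (T - fps_X\<^sup>2 * T\<^sup>2) $ n - \<kappa>\<^sup>2 * (if n < 2 then 0 else (T - fps_X\<^sup>2 * T\<^sup>2) $ (n - 2))"
      by (simp add: left_diff_distrib mult.assoc fps_X_power_mult_nth)
    have D: "(T - fps_X\<^sup>2 * T\<^sup>2) $ n = t n - (if n = 0 then 0 else conv_moments t (n - 1))" for n
      using sq by (simp add: T_def)
    consider "n = 0" | "n = 1" | "n = 2" | k where "n = k + 3"
      by (metis One_nat_def Suc_1 add.commute numeral_3_eq_3 not0_implies_Suc plus_1_eq_Suc add_Suc)
    then show "((1 - ?c * fps_X\<^sup>2) * (T - fps_X\<^sup>2 * T\<^sup>2)) $ n = (1 + fps_const (t 1) * fps_X
      + fps_const (t 2 - 1 - \<kappa>\<^sup>2) * fps_X\<^sup>2) $ n"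
    proof cases
      case (4 k)
      then show ?thesis using loop[of k] unfolding lhs D
        by (simp add: loop_defect_def fps_X_power_iff algebra_simps numeral_eq_Suc)
    qed (unfold lhs D, simp_all add: t0 fps_X_power_iff conv_moments_def power2_eq_square)
  qed
  have "(1 - 2 * fps_X\<^sup>2 * T)\<^sup>2 * (1 - ?c * fps_X\<^sup>2)
     = (1 - ?c * fps_X\<^sup>2) - 4 * fps_X\<^sup>2 * ((1 - ?c * fps_X\<^sup>2) * (T - fps_X\<^sup>2 * T\<^sup>2))"
    by (simp add: power2_eq_square algebra_simps)
  also have "\<dots> = 1 - fps_const (4 + \<kappa>\<^sup>2) * fps_X\<^sup>2 - fps_const (4 * t 1) * fps_X ^ 3
         + fps_const (4 * (1 + \<kappa>\<^sup>2 - t 2)) * fps_X ^ 4"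
    unfolding key
    by (simp add: algebra_simps power2_eq_square power3_eq_cube power4_eq_xxxx numeral_fps_const flip: fps_const_add fps_const_mult fps_const_sub)
  finally show ?thesis .
qed

text \<open>
  The roots have sum 0, so if a is a double root outside the disc, the other two cannot both lie in
  the disc. The one outside is multiple as well, and it cannot equal a, as the fourth root
  would then be the simple root -3a, outside the disc. So it equals the fourth root, which is -a.
\<close>

lemma quartic_roots_pair_up:
  fixes a b c d :: complex and \<kappa> :: real
  assumes a: "norm a > \<kappa>" and ab: "a = b" and e1: "a + b + c + d = 0"
    and c: "norm c > \<kappa> \<Longrightarrow> c = a \<or> c = b \<or> c = d"
    and d: "norm d > \<kappa> \<Longrightarrow> d = a \<or> d = b \<or> d = c"
    and k: "\<kappa> > 0"
  shows "c = - a \<and> d = - a"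
proof -
  have "c + d = (a + b + c + d) - 2 * a" using ab by simp
  then have cd: "c + d = - 2 * a" unfolding e1 by simp
  have "2 * norm a \<le> norm c + norm d"
    using norm_triangle_ineq[of c d] unfolding cd by (simp add: norm_mult)
  then have "norm c > \<kappa> \<or> norm d > \<kappa>" using a by linarith
  moreover have a0: "a \<noteq> 0" using a k by auto
  have False if "c = a" "norm c > \<kappa>"
  proof -
    have "d = (c + d) - a" using that(1) by simp
    then have "d = - 3 * a" unfolding cd by simp
    moreover have "norm d > \<kappa>" unfolding calculation using a k by (simp add: norm_mult)
    ultimately show False using d that ab a0 by auto
  qed
  moreover have False if "d = a" "norm d > \<kappa>"
  proof -
    have "c = (c + d) - a" using that(1) by simp
    then have "c = - 3 * a" unfolding cd by simp
    moreover have "norm c > \<kappa>" unfolding calculation using a k by (simp add: norm_mult)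
    ultimately show False using c that ab a0 by auto
  qed
  ultimately have "c = d" using c d ab by auto
  then show ?thesis using cd by simp
qed

lemma quartic_squares_agree:
  fixes a b c d :: complex and \<kappa> :: real
  assumes k: "\<kappa> > 0" and n: "norm a > \<kappa>" and e1: "a + b + c + d = 0"
    and a: "norm a > \<kappa> \<Longrightarrow> a = b \<or> a = c \<or> a = d"
    and b: "norm b > \<kappa> \<Longrightarrow> b = a \<or> b = c \<or> b = d"
    and c: "norm c > \<kappa> \<Longrightarrow> c = a \<or> c = b \<or> c = d"
    and d: "norm d > \<kappa> \<Longrightarrow> d = a \<or> d = b \<or> d = c"
  shows "b\<^sup>2 = a\<^sup>2 \<and> c\<^sup>2 = a\<^sup>2 \<and> d\<^sup>2 = a\<^sup>2"
proof -
  consider "a = b" | "a = c" | "a = d" using a n by blast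
  then show ?thesis
  proof cases
    case 1
    from quartic_roots_pair_up[OF n 1 e1 c d k] 1 show ?thesis by simp
  next
    case 2
    have e: "a + c + b + d = 0" using e1 by (simp add: ac_simps)
    have "b = - a \<and> d = - a" by (rule quartic_roots_pair_up[OF n 2 e _ _ k]) (use b d in blast)+
    then show ?thesis using 2 by simp
  next
    case 3
    have e: "a + d + b + c = 0" using e1 by (simp add: ac_simps)
    have "b = - a \<and> c = - a" by (rule quartic_roots_pair_up[OF n 3 e _ _ k]) (use b c in blast)+
    then show ?thesis using 3 by simp
  qed
qed

lemma extremal_average:
  fixes p q r s K :: real
  assumes "p + q + r + s = 2 * (4 + K)" "p \<le> K" "q \<le> K" "r \<le> K" "s \<le> K" "K \<le> 4"
  shows "p = 4 \<and> q = 4 \<and> r = 4 \<and> s = 4 \<and> K = 4"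
proof -
  have "4 * K \<ge> 2 * (4 + K)" using assms by argo
  then have "K = 4" using assms(6) by argo
  then show ?thesis using assms by argo
qed

text \<open>
  Either some root lies outside the disc, and the roots are a, a, -a, -a; or all roots have modulus at
  most \<open>\<kappa>\<close>, and then the sum of their squares can only be 2 (4 + \<open>\<kappa>\<close>^2) if \<open>\<kappa>\<close> = 2 and all squares equal
  4. In both cases all squares of roots agree.
\<close>

lemma quartic_double_outside:
  fixes a b c d :: complex and \<kappa> :: real
  assumes k: "0 < \<kappa>" "\<kappa> \<le> 2"
    and e1: "a + b + c + d = 0"
    and e2: "a\<^sup>2 + b\<^sup>2 + c\<^sup>2 + d\<^sup>2 = of_real (2 * (4 + \<kappa>\<^sup>2))"
    and a: "norm a > \<kappa> \<Longrightarrow> a = b \<or> a = c \<or> a = d"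
    and b: "norm b > \<kappa> \<Longrightarrow> b = a \<or> b = c \<or> b = d"
    and c: "norm c > \<kappa> \<Longrightarrow> c = a \<or> c = b \<or> c = d"
    and d: "norm d > \<kappa> \<Longrightarrow> d = a \<or> d = b \<or> d = c"
  shows "a * b * c + a * b * d + a * c * d + b * c * d = 0 \<and>
         a * b * c * d = of_real (((4 + \<kappa>\<^sup>2) / 2)\<^sup>2)"
proof -
  have fin: ?thesis if x: "a\<^sup>2 = x" "b\<^sup>2 = x" "c\<^sup>2 = x" "d\<^sup>2 = x" for x
  proof -
    have "x = (a\<^sup>2 + b\<^sup>2 + c\<^sup>2 + d\<^sup>2) / 4" unfolding x by simp
    also have "\<dots> = of_real ((4 + \<kappa>\<^sup>2) / 2)" unfolding e2 by (simp add: field_simps)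
    finally have x': "x = of_real ((4 + \<kappa>\<^sup>2) / 2)" .
    then have x0: "x \<noteq> 0" by (metis add_nonneg_pos add.commute divide_eq_0_iff less_irrefl of_real_eq_0_iff zero_le_power2 zero_less_numeral zero_neq_numeral)
    have "b = a \<or> b = - a" "c = a \<or> c = - a" "d = a \<or> d = - a"
      using x power2_eq_iff by metis+
    moreover have "a \<noteq> 0" using x x0 by auto
    ultimately have "(b = - a \<and> c = - a \<and> d = a) \<or> (b = - a \<and> c = a \<and> d = - a) \<or> (b = a \<and> c = - a \<and> d = - a)"
      using e1 by (auto simp: algebra_simps add_eq_0_iff2)
    moreover have "a ^ 4 = x\<^sup>2" using x by (metis power2_eq_square power4_eq_xxxx mult.assoc)
    ultimately show ?thesis using x' by (auto simp: power4_eq_xxxx)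
  qed
  consider "norm a > \<kappa>" | "norm b > \<kappa>" | "norm c > \<kappa>" | "norm d > \<kappa>"
    | "norm a \<le> \<kappa>" "norm b \<le> \<kappa>" "norm c \<le> \<kappa>" "norm d \<le> \<kappa>" by linarith
  then show ?thesis
  proof cases
    case 1
    show ?thesis
      by (rule fin[of "a\<^sup>2"]) (use quartic_squares_agree[OF k(1) 1 e1 a b c d] in auto)
  next
    case 2
    have "b + a + c + d = 0" using e1 by (simp add: ac_simps)
    moreover have "norm a > \<kappa> \<Longrightarrow> a = b \<or> a = c \<or> a = d" "norm c > \<kappa> \<Longrightarrow> c = b \<or> c = a \<or> c = d"
      "norm d > \<kappa> \<Longrightarrow> d = b \<or> d = a \<or> d = c" using a c d by blast+
    ultimately have "a\<^sup>2 = b\<^sup>2 \<and> c\<^sup>2 = b\<^sup>2 \<and> d\<^sup>2 = b\<^sup>2"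
      using quartic_squares_agree[OF k(1) 2 _ b] by blast
    then show ?thesis
      by (intro fin[of "b\<^sup>2"]) auto
  next
    case 3
    have "c + a + b + d = 0" using e1 by (simp add: ac_simps)
    moreover have "norm a > \<kappa> \<Longrightarrow> a = c \<or> a = b \<or> a = d" "norm b > \<kappa> \<Longrightarrow> b = c \<or> b = a \<or> b = d"
      "norm d > \<kappa> \<Longrightarrow> d = c \<or> d = a \<or> d = b" using a b d by blast+
    ultimately have "a\<^sup>2 = c\<^sup>2 \<and> b\<^sup>2 = c\<^sup>2 \<and> d\<^sup>2 = c\<^sup>2"
      using quartic_squares_agree[OF k(1) 3 _ c] by blast
    then show ?thesis
      by (intro fin[of "c\<^sup>2"]) auto
  next
    case 4
    have "d + a + b + c = 0" using e1 by (simp add: ac_simps)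
    moreover have "norm a > \<kappa> \<Longrightarrow> a = d \<or> a = b \<or> a = c" "norm b > \<kappa> \<Longrightarrow> b = d \<or> b = a \<or> b = c"
      "norm c > \<kappa> \<Longrightarrow> c = d \<or> c = a \<or> c = b" using a b c by blast+
    ultimately have "a\<^sup>2 = d\<^sup>2 \<and> b\<^sup>2 = d\<^sup>2 \<and> c\<^sup>2 = d\<^sup>2"
      using quartic_squares_agree[OF k(1) 4 _ d] by blast
    then show ?thesis
      by (intro fin[of "d\<^sup>2"]) auto
  next
    case 5
    have n: "norm (x\<^sup>2) \<le> \<kappa>\<^sup>2" if "norm x \<le> \<kappa>" for x :: complex
      using that by (simp add: norm_power power_mono)
    have r: "Re (x\<^sup>2) \<le> \<kappa>\<^sup>2" if "norm x \<le> \<kappa>" for x :: complex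
      using n[OF that] complex_Re_le_cmod[of "x\<^sup>2"] by linarith
    have re: "Re (a\<^sup>2) + Re (b\<^sup>2) + Re (c\<^sup>2) + Re (d\<^sup>2) = 2 * (4 + \<kappa>\<^sup>2)"
      using arg_cong[OF e2, of Re] by simp
    have k4: "\<kappa>\<^sup>2 \<le> 4" using power_mono[of \<kappa> 2 2] k by simp
    from extremal_average[OF re r[OF 5(1)] r[OF 5(2)] r[OF 5(3)] r[OF 5(4)] k4]
    have "Re (a\<^sup>2) = 4 \<and> Re (b\<^sup>2) = 4 \<and> Re (c\<^sup>2) = 4 \<and> Re (d\<^sup>2) = 4 \<and> \<kappa>\<^sup>2 = 4" .
    moreover have "y = 4" if "Re y = 4" "norm y \<le> 4" for y
    proof -
      have "(Re y)\<^sup>2 + (Im y)\<^sup>2 \<le> 4\<^sup>2"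
        using that(2) cmod_power2[of y] power_mono[of "norm y" 4 2] by simp
      then show ?thesis using that(1) by (auto simp: complex_eq_iff)
    qed
    ultimately show ?thesis using n[OF 5(1)] n[OF 5(2)] n[OF 5(3)] n[OF 5(4)]
      by (intro fin[of 4]) auto
  qed
qed

text \<open>
  A root is multiple iff the derivative vanishes there, so the hypothesis is the one of
  \<open>quartic_double_outside\<close> for the factorized polynomial.
\<close>

lemma quartic_coeffs_determined:
  fixes \<kappa> b c :: real
  assumes k: "0 < \<kappa>" "\<kappa> \<le> 2"
    and double: "\<And>z::complex. norm z > \<kappa> \<Longrightarrow> z ^ 4 - of_real (4 + \<kappa>\<^sup>2) * z\<^sup>2 + of_real b * z + of_real c = 0
      \<Longrightarrow> 4 * z ^ 3 - 2 * of_real (4 + \<kappa>\<^sup>2) * z + of_real b = 0"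
  shows "b = 0" "c = ((4 + \<kappa>\<^sup>2) / 2)\<^sup>2"
proof -
  define w where "w = complex_of_real (4 + \<kappa>\<^sup>2)"
  define Q where "Q = [:of_real c, of_real b, - w, 0, 1::complex:]"
  have deg: "degree Q = 4" by (simp add: Q_def)
  obtain as where as: "Polynomial.smult (coeff Q (degree Q)) (\<Prod>a\<leftarrow>as. [:- a, 1:]) = Q" "length as = degree Q"
    using fundamental_theorem_algebra_factorized[of Q] by blast
  obtain p q r s where pq: "as = [p, q, r, s]"
    using as(2) unfolding deg by (auto simp: numeral_eq_Suc length_Suc_conv)
  have "coeff Q (degree Q) = 1" unfolding deg by (simp add: Q_def numeral_eq_Suc)
  then have "Q = (\<Prod>a\<leftarrow>as. [:- a, 1:])" using as(1) by simp
  then have Q: "Q = [:- p, 1:] * [:- q, 1:] * [:- r, 1:] * [:- s, 1:]" 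
    unfolding pq by (simp only: list.map prod_list.Cons prod_list.Nil mult_1_right mult.assoc)
  have co: "p + q + r + s = 0" "p * q + p * r + p * s + q * r + q * s + r * s = - w"
    "p * q * r + p * q * s + p * r * s + q * r * s = - of_real b" "p * q * r * s = of_real c"
  proof -
    have e: "coeff Q i = coeff ([:- p, 1:] * [:- q, 1:] * [:- r, 1:] * [:- s, 1:]) i" for i
      using Q by simp
    show "p + q + r + s = 0" using e[of 3] by (simp add: Q_def numeral_eq_Suc algebra_simps add_eq_0_iff2)
    show "p * q + p * r + p * s + q * r + q * s + r * s = - w"
      using e[of 2] by (simp add: Q_def numeral_eq_Suc algebra_simps)
    show "p * q * r + p * q * s + p * r * s + q * r * s = - of_real b"
      using e[of 1] by (simp add: Q_def algebra_simps eq_neg_iff_add_eq_0)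
    show "p * q * r * s = of_real c"
      using e[of 0] by (simp add: Q_def algebra_simps)
  qed
  have poly4: "z ^ 4 - w * z\<^sup>2 + of_real b * z + of_real c = poly Q z" for z
    by (simp add: Q_def algebra_simps power2_eq_square power4_eq_xxxx)
  have poly3: "4 * z ^ 3 - 2 * w * z + of_real b = poly (pderiv Q) z" for z
    by (simp add: Q_def pderiv_pCons algebra_simps power2_eq_square power3_eq_cube)
  have dbl: "poly (pderiv Q) z = 0" if "norm z > \<kappa>" "poly Q z = 0" for z
    using double[OF that(1)] that(2) unfolding w_def[symmetric] poly4 poly3 .
  have pd: "poly (pderiv Q) z = (z - q) * (z - r) * (z - s) + (z - p) * (z - r) * (z - s)
      + (z - p) * (z - q) * (z - s) + (z - p) * (z - q) * (z - r)" for z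
    unfolding Q pderiv_mult by (simp add: pderiv_pCons algebra_simps)
  have pq0: "poly Q z = (z - p) * (z - q) * (z - r) * (z - s)" for z
    unfolding Q by (simp add: algebra_simps)
  have "p * q * r + p * q * s + p * r * s + q * r * s = 0 \<and>
         p * q * r * s = of_real (((4 + \<kappa>\<^sup>2) / 2)\<^sup>2)"
  proof (rule quartic_double_outside[OF k co(1)])
    have "p\<^sup>2 + q\<^sup>2 + r\<^sup>2 + s\<^sup>2 = (p + q + r + s)\<^sup>2 - 2 * (p * q + p * r + p * s + q * r + q * s + r * s)"
      by (simp add: power2_eq_square algebra_simps)
    also have "\<dots> = of_real (2 * (4 + \<kappa>\<^sup>2))" unfolding co w_def by simp
    finally show "p\<^sup>2 + q\<^sup>2 + r\<^sup>2 + s\<^sup>2 = of_real (2 * (4 + \<kappa>\<^sup>2))" .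
    show "p = q \<or> p = r \<or> p = s" if "norm p > \<kappa>" using dbl[OF that] by (simp add: pd pq0)
    show "q = p \<or> q = r \<or> q = s" if "norm q > \<kappa>" using dbl[OF that] by (simp add: pd pq0)
    show "r = p \<or> r = q \<or> r = s" if "norm r > \<kappa>" using dbl[OF that] by (simp add: pd pq0)
    show "s = p \<or> s = q \<or> s = r" if "norm s > \<kappa>" using dbl[OF that] by (simp add: pd pq0)
  qed
  then have "complex_of_real b = 0" "complex_of_real c = complex_of_real (((4 + \<kappa>\<^sup>2) / 2)\<^sup>2)"
    using co(3,4) by simp_all
  then show "b = 0" "c = ((4 + \<kappa>\<^sup>2) / 2)\<^sup>2"
    by (simp_all only: of_real_eq_iff of_real_eq_0_iff)
qed

text \<open>
  At a zero of the quartic outside the disc the analytic square root F of the left-hand side of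
  \<open>loop_equation_fps\<close> vanishes, hence the derivative of F^2 vanishes there too.
\<close>

lemma loop_fps_analytic:
  fixes t :: "nat \<Rightarrow> real" and \<kappa> :: real
  assumes k: "\<kappa> > 0" and t0: "t 0 = 1" and bd: "\<And>m. \<bar>t m\<bar> \<le> \<kappa> ^ m"
    and loop: "\<And>k. loop_defect (\<kappa>\<^sup>2) t k = 0"
    and z: "norm z > \<kappa>"
    and root: "z ^ 4 - of_real (4 + \<kappa>\<^sup>2) * z\<^sup>2 + of_real (- 4 * t 1) * z
      + of_real (4 * (1 + \<kappa>\<^sup>2 - t 2)) = 0"
  shows "4 * z ^ 3 - 2 * of_real (4 + \<kappa>\<^sup>2) * z + of_real (- 4 * t 1) = (0::complex)"
proof -
  define \<tau> where "\<tau> n = complex_of_real (t n)" for n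
  define F where "F = 1 - fps_const 2 * (fps_X\<^sup>2 * Abs_fps \<tau>)"
  define u where "u = fps_const (complex_of_real (4 + \<kappa>\<^sup>2))"
  have dl: "loop_defect ((of_real \<kappa>)\<^sup>2) \<tau> k = of_real (loop_defect (\<kappa>\<^sup>2) t k)" for k
    by (simp add: loop_defect_def conv_moments_def \<tau>_def)
  have fe: "F\<^sup>2 * (1 - fps_const ((of_real \<kappa>)\<^sup>2) * fps_X\<^sup>2)
    = 1 - fps_const (4 + (of_real \<kappa>)\<^sup>2) * fps_X\<^sup>2 - fps_const (4 * \<tau> 1) * fps_X ^ 3
         + fps_const (4 * (1 + (of_real \<kappa>)\<^sup>2 - \<tau> 2)) * fps_X ^ 4"
    using loop_equation_fps[of \<tau> "of_real \<kappa>"] t0 loop dl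
    by (simp add: F_def \<tau>_def mult.assoc numeral_fps_const)
  \<comment> \<open>A radius between |1/z| and 1/\<open>\<kappa>\<close>, within which the generating function converges.\<close>
  define r where "r = (1 / norm z + 1 / \<kappa>) / 2"
  have zk: "1 / norm z < 1 / \<kappa>" using z k by (simp add: frac_less2)
  have r: "norm (inverse z) < r" "0 < r" "r < 1 / \<kappa>"
  proof -
    have ni: "norm (inverse z) = 1 / norm z" by (simp add: norm_divide inverse_eq_divide)
    have "1 / norm z \<ge> 0" "1 / \<kappa> > 0" using k by simp_all
    then show "norm (inverse z) < r" "0 < r" "r < 1 / \<kappa>" using zk by (simp_all add: ni r_def add_nonneg_pos)
  qed
  have "summable (\<lambda>n. \<tau> n * of_real r ^ n)"
  proof (rule summable_comparison_test')
    show "summable (\<lambda>n. (\<kappa> * r) ^ n)"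
      using r k by (intro summable_geometric) (simp add: field_simps)
    show "norm (\<tau> n * of_real r ^ n) \<le> (\<kappa> * r) ^ n" for n
      using bd[of n] r by (simp add: \<tau>_def norm_mult norm_power power_mult_distrib mult_right_mono)
  qed
  from conv_radius_geI[OF this] have "fps_conv_radius (Abs_fps \<tau>) \<ge> r"
    using r by (simp add: fps_conv_radius_def)
  moreover have "fps_conv_radius F \<ge> fps_conv_radius (Abs_fps \<tau>)"
  proof -
    have "fps_conv_radius (Abs_fps \<tau>) \<le> fps_conv_radius (fps_X\<^sup>2 * Abs_fps \<tau>)"
      using fps_conv_radius_mult[of "fps_X\<^sup>2" "Abs_fps \<tau>"] by simp
    also have "\<dots> \<le> fps_conv_radius (fps_const 2 * (fps_X\<^sup>2 * Abs_fps \<tau>))"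
      using fps_conv_radius_mult[of "fps_const 2" "fps_X\<^sup>2 * Abs_fps \<tau>"] by simp
    also have "\<dots> \<le> fps_conv_radius F"
      using fps_conv_radius_diff[of 1 "fps_const 2 * (fps_X\<^sup>2 * Abs_fps \<tau>)"] by (simp add: F_def)
    finally show ?thesis .
  qed
  ultimately have rad: "fps_conv_radius F \<ge> r" by simp
  define f where "f = eval_fps F"
  define P where "P w = 1 - (4 + (of_real \<kappa>)\<^sup>2) * w\<^sup>2 - (4 * \<tau> 1) * w ^ 3
         + (4 * (1 + (of_real \<kappa>)\<^sup>2 - \<tau> 2)) * w ^ 4" for w
  have ev: "(f w)\<^sup>2 * (1 - (of_real \<kappa>)\<^sup>2 * w\<^sup>2) = P w" if "norm w < r" for w
  proof -
    have "ereal (norm w) < ereal r" using that by simp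
    then have w: "ereal (norm w) < fps_conv_radius F" using rad by (rule less_le_trans)
    have m: "fps_conv_radius (fps_const c * fps_X ^ n :: complex fps) = \<infinity>" for c n
      using fps_conv_radius_mult[of "fps_const c" "fps_X ^ n :: complex fps"] by simp
    have inf: "fps_conv_radius (1 - fps_const c * fps_X\<^sup>2 :: complex fps) = \<infinity>" for c
      using fps_conv_radius_diff[of 1 "fps_const c * fps_X\<^sup>2 :: complex fps"] m by simp
    have inf': "fps_conv_radius (1 - fps_const c * fps_X\<^sup>2 - fps_const e * fps_X ^ 3 :: complex fps) = \<infinity>" for c e
      using fps_conv_radius_diff[of "1 - fps_const c * fps_X\<^sup>2" "fps_const e * fps_X ^ 3 :: complex fps"]
      unfolding m inf by simp
    have w2: "ereal (norm w) < fps_conv_radius (F\<^sup>2)"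
      using w fps_conv_radius_power[of F 2] by (rule less_le_trans)
    have "eval_fps (F\<^sup>2 * (1 - fps_const ((of_real \<kappa>)\<^sup>2) * fps_X\<^sup>2)) w = (f w)\<^sup>2 * (1 - (of_real \<kappa>)\<^sup>2 * w\<^sup>2)"
      using w w2 by (subst eval_fps_mult) (auto simp: inf m f_def eval_fps_power eval_fps_diff eval_fps_mult)
    moreover have "eval_fps (F\<^sup>2 * (1 - fps_const ((of_real \<kappa>)\<^sup>2) * fps_X\<^sup>2)) w = P w"
      unfolding fe by (simp add: inf inf' m P_def eval_fps_add eval_fps_diff eval_fps_mult)
    ultimately show ?thesis by simp
  qed
  define w where "w = inverse z"
  have z0: "z \<noteq> 0" using z k by auto
  have w: "norm w < r" "w \<noteq> 0" "z = inverse w" using r z0 by (auto simp: w_def)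
  have wz: "w ^ 3 * z ^ 3 = 1" "w ^ 3 * z = w\<^sup>2" "w ^ 4 * z ^ 4 = 1" "w ^ 4 * z\<^sup>2 = w\<^sup>2" "w ^ 4 * z = w ^ 3"
  proof -
    have 1: "w * z = 1" using w by simp
    show "w ^ 3 * z ^ 3 = 1" "w ^ 4 * z ^ 4 = 1" by (simp_all only: power_mult_distrib[symmetric] 1 power_one)
    have "w ^ 3 * z = w\<^sup>2 * (w * z)" "w ^ 4 * z\<^sup>2 = w\<^sup>2 * (w * z)\<^sup>2" "w ^ 4 * z = w ^ 3 * (w * z)"
      by (simp_all add: power2_eq_square power3_eq_cube power4_eq_xxxx)
    then show "w ^ 3 * z = w\<^sup>2" "w ^ 4 * z\<^sup>2 = w\<^sup>2" "w ^ 4 * z = w ^ 3" by (simp_all add: 1)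
  qed
  have Pz: "P w = w ^ 4 * (z ^ 4 - of_real (4 + \<kappa>\<^sup>2) * z\<^sup>2 + of_real (- 4 * t 1) * z
      + of_real (4 * (1 + \<kappa>\<^sup>2 - t 2)))"
  proof -
    have "w ^ 4 * (z ^ 4 - A * z\<^sup>2 + B * z + C) = w ^ 4 * z ^ 4 - A * (w ^ 4 * z\<^sup>2) + B * (w ^ 4 * z) + C * w ^ 4" for A B C
      by (simp add: algebra_simps)
    then have eq: "w ^ 4 * (z ^ 4 - A * z\<^sup>2 + B * z + C) = 1 - A * w\<^sup>2 + B * w ^ 3 + C * w ^ 4" for A B C
      unfolding wz .
    show ?thesis unfolding eq by (simp add: P_def \<tau>_def)
  qed
  have P0: "P w = 0" unfolding Pz root by simp
  have nz: "1 - (of_real \<kappa>)\<^sup>2 * w\<^sup>2 \<noteq> 0"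
  proof
    assume "1 - (of_real \<kappa>)\<^sup>2 * w\<^sup>2 = 0"
    then have "(of_real \<kappa> * w)\<^sup>2 = 1" by (simp add: power_mult_distrib)
    then have "norm (of_real \<kappa> * w) = 1"
      by (metis norm_minus_cancel norm_one power2_eq_1_iff)
    then have "\<kappa> * norm w = 1" using k by (simp add: norm_mult)
    moreover have "\<kappa> * norm w < \<kappa> * (1 / \<kappa>)" using w(1) r k by (intro mult_strict_left_mono) auto
    ultimately show False using k by simp
  qed
  have fw: "f w = 0" using ev[OF w(1)] P0 nz by simp
  have "ereal (norm w) < ereal r" using w(1) by simp
  then have "ereal (norm w) < fps_conv_radius F" using rad by (rule less_le_trans)
  then have df: "(f has_field_derivative eval_fps (fps_deriv F) w) (at w)"
    unfolding f_def by (rule has_field_derivative_eval_fps)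
  have "((\<lambda>w. (f w)\<^sup>2 * (1 - (of_real \<kappa>)\<^sup>2 * w\<^sup>2)) has_field_derivative 0) (at w)"
    by (auto intro!: derivative_eq_intros df simp: fw)
  then have "(P has_field_derivative 0) (at w)"
    by (rule has_field_derivative_transform_within_open[of _ _ _ "ball 0 r"]) (use ev w(1) in auto)
  moreover define E where "E = - (4 + (of_real \<kappa>)\<^sup>2) * (2 * w) - (4 * \<tau> 1) * (3 * w\<^sup>2)
         + (4 * (1 + (of_real \<kappa>)\<^sup>2 - \<tau> 2)) * (4 * w ^ 3)"
  have "(P has_field_derivative E) (at w)"
  proof -
    have "((\<lambda>w. 1 - A * w\<^sup>2 - B * w ^ 3 + C * w ^ 4) has_field_derivative (- A * (2 * w) - B * (3 * w\<^sup>2) + C * (4 * w ^ 3))) (at w)" for A B C :: complex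
      by (auto intro!: derivative_eq_intros)
    from this[of "4 + (of_real \<kappa>)\<^sup>2" "4 * \<tau> 1" "4 * (1 + (of_real \<kappa>)\<^sup>2 - \<tau> 2)"]
    show ?thesis unfolding P_def[abs_def] E_def .
  qed
  ultimately have E0: "E = 0" by (metis DERIV_unique)
  have idt: "w ^ 3 * (4 * z ^ 3 - 2 * of_real (4 + \<kappa>\<^sup>2) * z + of_real (- 4 * t 1)) = 4 * P w - w * E"
  proof -
    have "w ^ 3 * (4 * z ^ 3 - 2 * A * z + B) = 4 * (w ^ 3 * z ^ 3) - 2 * A * (w ^ 3 * z) + B * w ^ 3" for A B
      by (simp add: algebra_simps)
    then have "w ^ 3 * (4 * z ^ 3 - 2 * A * z + B) = 4 * 1 - 2 * A * w\<^sup>2 + B * w ^ 3" for A B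
      unfolding wz .
    note 1 = this[of "of_real (4 + \<kappa>\<^sup>2)" "of_real (- 4 * t 1)"]
    have 2: "4 * 1 - 2 * A * w\<^sup>2 + - 4 * \<tau> 1 * w ^ 3 = 4 * (1 - A * w\<^sup>2 - 4 * \<tau> 1 * w ^ 3 + C * w ^ 4)
       - w * (- A * (2 * w) - 4 * \<tau> 1 * (3 * w\<^sup>2) + C * (4 * w ^ 3))" for A C
      by (simp add: algebra_simps power2_eq_square power3_eq_cube power4_eq_xxxx)
    have 3: "complex_of_real (4 + \<kappa>\<^sup>2) = 4 + (of_real \<kappa>)\<^sup>2" "of_real (- 4 * t 1) = - 4 * \<tau> 1"
      by (simp_all add: \<tau>_def)
    show ?thesis unfolding 1 unfolding P_def E_def 3 by (rule 2)
  qed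
  then have fin: "w ^ 3 * (4 * z ^ 3 - 2 * of_real (4 + \<kappa>\<^sup>2) * z + of_real (- 4 * t 1)) = 0"
    unfolding E0 P0 by (simp only: mult_zero_right diff_zero)
  have nz3: "X = 0" if "w ^ 3 * X = 0" for X
    using that w(2) by simp
  show ?thesis using fin by (rule nz3)
qed

text \<open>
  With the quartic known to be a perfect square, the equation for the generating function T becomes
  (1 - 2 X^2 T)^2 = ((1 - ((4 + \<open>\<kappa>\<close>^2) / 2) X^2) S)^2 with S the generating function of the arcsine
  moments, and the constant coefficients decide the sign of the square root.
\<close>

lemma loop_equation_unique_solution:
  fixes t :: "nat \<Rightarrow> real" and \<kappa> :: real
  assumes k: "0 < \<kappa>" "\<kappa> \<le> 2" and t0: "t 0 = 1" and bd: "\<And>m. \<bar>t m\<bar> \<le> \<kappa> ^ m"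
    and loop: "\<And>k. loop_defect (\<kappa>\<^sup>2) t k = 0"
  shows "t n = limit_moment \<kappa> n"
proof -
  define T where "T = Abs_fps t"
  define S where "S = Abs_fps (arcsine_moment \<kappa>)"
  define w where "w = (4 + \<kappa>\<^sup>2) / 2"
  have c: "- 4 * t 1 = 0" "4 * (1 + \<kappa>\<^sup>2 - t 2) = w\<^sup>2"
  proof -
    note root = loop_fps_analytic[OF k(1) t0 bd loop]
    show "- 4 * t 1 = 0" by (rule quartic_coeffs_determined(1)[OF k root])
    show "4 * (1 + \<kappa>\<^sup>2 - t 2) = w\<^sup>2"
      unfolding w_def by (rule quartic_coeffs_determined(2)[OF k root])
  qed
  have "(1 - 2 * fps_X\<^sup>2 * T)\<^sup>2 * (1 - fps_const (\<kappa>\<^sup>2) * fps_X\<^sup>2)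
      = 1 - fps_const (2 * w) * fps_X\<^sup>2 + fps_const (w\<^sup>2) * fps_X ^ 4"
    using loop_equation_fps[OF t0 loop] c by (simp add: T_def w_def)
  also have "\<dots> = (1 - fps_const w * fps_X\<^sup>2)\<^sup>2"
  proof -
    have "1 - 2 * a * x\<^sup>2 + a\<^sup>2 * x ^ 4 = (1 - a * x\<^sup>2)\<^sup>2" for a x :: "real fps"
      by (simp add: power2_eq_square power4_eq_xxxx algebra_simps)
    from this[of "fps_const w" fps_X] show ?thesis by (simp add: numeral_fps_const)
  qed
  finally have "(1 - 2 * fps_X\<^sup>2 * T)\<^sup>2 * ((1 - fps_const (\<kappa>\<^sup>2) * fps_X\<^sup>2) * S\<^sup>2)
      = ((1 - fps_const w * fps_X\<^sup>2) * S)\<^sup>2" by (simp add: power_mult_distrib mult.assoc)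
  then have "(1 - 2 * fps_X\<^sup>2 * T)\<^sup>2 = ((1 - fps_const w * fps_X\<^sup>2) * S)\<^sup>2"
    unfolding S_def arcsine_fps_square by simp
  then consider "1 - 2 * fps_X\<^sup>2 * T = (1 - fps_const w * fps_X\<^sup>2) * S"
    | "1 - 2 * fps_X\<^sup>2 * T = - ((1 - fps_const w * fps_X\<^sup>2) * S)"
    using power2_eq_iff by blast
  then show ?thesis
  proof cases
    case 1
    have "(1 - 2 * fps_X\<^sup>2 * T) $ (n + 2) = - 2 * t n"
      by (simp add: mult.assoc numeral_fps_const fps_X_power_mult_nth T_def)
    moreover have "((1 - fps_const w * fps_X\<^sup>2) * S) $ (n + 2) = arcsine_moment \<kappa> (n + 2) - w * arcsine_moment \<kappa> n"
      by (simp add: left_diff_distrib mult.assoc fps_X_power_mult_nth S_def)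
    ultimately show ?thesis unfolding 1 by (simp add: limit_moment_def w_def)
  next
    case 2
    have "(1 - 2 * fps_X\<^sup>2 * T) $ 0 = (- ((1 - fps_const w * fps_X\<^sup>2) * S)) $ 0" unfolding 2 ..
    then show ?thesis by (simp add: S_def)
  qed
qed

end

section \<open>The operator norm and the eigenvalues\<close>

definition sqnorm :: "nat \<Rightarrow> real Matrix.vec \<Rightarrow> real" where
  "sqnorm d v = (\<Sum>i<d. (v $ i)\<^sup>2)"

lemma sqnorm_nonneg: "sqnorm d v \<ge> 0"
  unfolding sqnorm_def by (rule sum_nonneg) simp

lemma euclid_norm_eq: "v \<in> carrier_vec d \<Longrightarrow> euclid_norm v = sqrt (sqnorm d v)"
  by (auto simp: euclid_norm_def sqnorm_def scalar_prod_def atLeast0LessThan power2_eq_square)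

lemma sqnorm_eq_0:
  assumes "v \<in> carrier_vec d" "sqnorm d v = 0"
  shows "v = 0\<^sub>v d"
proof (rule eq_vecI)
  fix i assume i: "i < dim_vec (0\<^sub>v d)"
  have "\<forall>i\<in>{..<d}. (v $ i)\<^sup>2 = 0"
    using assms(2) unfolding sqnorm_def by (subst (asm) sum_nonneg_eq_0_iff) auto
  then show "v $ i = 0\<^sub>v d $ i" using i by simp
qed (use assms in simp)

lemma mult_mat_vec_index:
  fixes A :: "real mat"
  assumes "A \<in> carrier_mat d d" "v \<in> carrier_vec d" "i < d"
  shows "(A *\<^sub>v v) $ i = (\<Sum>j<d. A $$ (i, j) * v $ j)"
proof -
  have "(A *\<^sub>v v) $ i = row A i \<bullet> v" using assms by simp
  also have "\<dots> = (\<Sum>j<d. A $$ (i, j) * v $ j)"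
    using assms by (simp add: scalar_prod_def atLeast0LessThan)
  finally show ?thesis .
qed

lemma sqnorm_pow_le_trace:
  assumes A: "A \<in> sym_mats d" and v: "v \<in> carrier_vec d"
  shows "sqnorm d ((A ^\<^sub>m m) *\<^sub>v v) \<le> power_trace A (2 * m) * sqnorm d v"
proof -
  have C: "A ^\<^sub>m m \<in> carrier_mat d d" using sym_matsD(1)[OF A] by simp
  have "sqnorm d ((A ^\<^sub>m m) *\<^sub>v v) = (\<Sum>i<d. (\<Sum>j<d. (A ^\<^sub>m m) $$ (i, j) * v $ j)\<^sup>2)"
    unfolding sqnorm_def by (rule sum.cong[OF refl]) (simp only: mult_mat_vec_index[OF C v] lessThan_iff)
  also have "\<dots> \<le> (\<Sum>i<d. (\<Sum>j<d. ((A ^\<^sub>m m) $$ (i, j))\<^sup>2) * sqnorm d v)"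
    unfolding sqnorm_def by (rule sum_mono) (rule Cauchy_Schwarz_ineq_sum)
  also have "\<dots> = power_trace A (m + m) * sqnorm d v"
    unfolding power_trace_add[OF A] sum_distrib_right power2_eq_square ..
  finally show ?thesis by (simp add: mult_2)
qed

text \<open>
  As A is symmetric, |A^m v|^2 is the scalar product of v and A^(2m) v.
\<close>

lemma sqnorm_pow_log_convex:
  assumes A: "A \<in> sym_mats d" and v: "v \<in> carrier_vec d"
  shows "(sqnorm d ((A ^\<^sub>m m) *\<^sub>v v))\<^sup>2 \<le> sqnorm d v * sqnorm d ((A ^\<^sub>m (2 * m)) *\<^sub>v v)"
proof -
  note A' = sym_matsD(1)[OF A]
  have C: "A ^\<^sub>m m \<in> carrier_mat d d" for m using A' by simp
  let ?B = "A ^\<^sub>m m" and ?D = "A ^\<^sub>m (m + m)"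
  have "sqnorm d (?B *\<^sub>v v) = (\<Sum>k<d. (\<Sum>i<d. ?B $$ (k, i) * v $ i) * (\<Sum>j<d. ?B $$ (k, j) * v $ j))"
    unfolding sqnorm_def power2_eq_square
    by (rule sum.cong[OF refl]) (simp only: mult_mat_vec_index[OF C v] lessThan_iff)
  also have "\<dots> = (\<Sum>k<d. \<Sum>i<d. \<Sum>j<d. v $ i * (?B $$ (k, i) * ?B $$ (k, j) * v $ j))"
    unfolding sum_product by (intro sum.cong refl) (simp only: mult_ac)
  also have "\<dots> = (\<Sum>i<d. \<Sum>j<d. \<Sum>k<d. v $ i * (?B $$ (k, i) * ?B $$ (k, j) * v $ j))"
    by (subst sum.swap) (rule sum.cong[OF refl], rule sum.swap)
  also have "\<dots> = (\<Sum>i<d. v $ i * (?D *\<^sub>v v) $ i)"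
  proof (rule sum.cong[OF refl])
    fix i assume "i \<in> {..<d}"
    then have i: "i < d" by simp
    have D: "?D $$ (i, j) = (\<Sum>k<d. ?B $$ (k, i) * ?B $$ (k, j))" if "j < d" for j
      unfolding pow_mat_add_index[OF A' i that]
      by (rule sum.cong[OF refl]) (simp only: pow_mat_symmetric[OF A i] lessThan_iff)
    show "(\<Sum>j<d. \<Sum>k<d. v $ i * (?B $$ (k, i) * ?B $$ (k, j) * v $ j)) = v $ i * (?D *\<^sub>v v) $ i"
      unfolding mult_mat_vec_index[OF C v i] sum_distrib_left
      by (intro sum.cong refl) (simp add: D sum_distrib_left sum_distrib_right mult.assoc)
  qed
  finally have "(sqnorm d (?B *\<^sub>v v))\<^sup>2 = (\<Sum>i<d. v $ i * (?D *\<^sub>v v) $ i)\<^sup>2" by simp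
  also have "\<dots> \<le> sqnorm d v * sqnorm d (?D *\<^sub>v v)"
    unfolding sqnorm_def by (rule Cauchy_Schwarz_ineq_sum)
  finally show ?thesis by (simp add: mult_2)
qed

text \<open>
  Repeated squaring: the ratio |A^n v|^2 / |v|^2 grows at least like the n-th power of
  |A v|^2 / |v|^2 along the powers n of 2, while it is at most tr (A^(2n)) \<open>\<le>\<close> d \<open>\<kappa>\<close>^(2n).
\<close>

lemma confined_imp_contraction:
  assumes A: "A \<in> sym_mats d" and v: "v \<in> carrier_vec d" and k: "\<kappa> > 0" and c: "confined \<kappa> A"
  shows "sqnorm d (A *\<^sub>v v) \<le> \<kappa>\<^sup>2 * sqnorm d v"
proof (cases "sqnorm d v = 0")
  case True
  have "sqnorm d ((A ^\<^sub>m 1) *\<^sub>v v) \<le> 0" using sqnorm_pow_le_trace[OF A v, of 1] True by simp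
  then show ?thesis using True sym_matsD(1)[OF A] by simp
next
  case False
  then have n: "sqnorm d v > 0" using sqnorm_nonneg[of d v] by linarith
  define \<rho> where "\<rho> j = sqnorm d ((A ^\<^sub>m (2 ^ j)) *\<^sub>v v) / sqnorm d v" for j
  have \<rho>0: "\<rho> j \<ge> 0" for j unfolding \<rho>_def using sqnorm_nonneg by simp
  have step: "(\<rho> j)\<^sup>2 \<le> \<rho> (Suc j)" for j
  proof -
    have "(sqnorm d ((A ^\<^sub>m (2 ^ j)) *\<^sub>v v))\<^sup>2 / (sqnorm d v)\<^sup>2 \<le> (sqnorm d v * sqnorm d ((A ^\<^sub>m (2 * 2 ^ j)) *\<^sub>v v)) / (sqnorm d v)\<^sup>2"
      by (rule divide_right_mono[OF sqnorm_pow_log_convex[OF A v]]) simp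
    also have "\<dots> = \<rho> (Suc j)" using n by (simp add: \<rho>_def power2_eq_square)
    finally show ?thesis by (simp add: \<rho>_def power_divide)
  qed
  have pw: "(\<rho> 0) ^ (2 ^ j) \<le> \<rho> j" for j
  proof (induction j)
    case (Suc j)
    have "(\<rho> 0) ^ (2 ^ Suc j) = ((\<rho> 0) ^ (2 ^ j))\<^sup>2" by (simp add: power_mult[symmetric] mult.commute)
    also have "\<dots> \<le> (\<rho> j)\<^sup>2" using Suc.IH \<rho>0[of 0] by (intro power_mono) auto
    finally show ?case using step[of j] by linarith
  qed simp
  have up: "\<rho> j \<le> real d * (\<kappa>\<^sup>2) ^ (2 ^ j)" for j
  proof -
    have "\<rho> j \<le> power_trace A (2 * 2 ^ j)"
      using sqnorm_pow_le_trace[OF A v, of "2 ^ j"] n by (simp add: \<rho>_def pos_divide_le_eq)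
    also have "\<dots> = excess \<kappa> (2 ^ j) A * \<kappa> ^ (2 * 2 ^ j)" using k by (simp add: excess_def)
    also have "\<dots> \<le> real d * \<kappa> ^ (2 * 2 ^ j)"
      using excess_le_dim[OF A k c] k by (intro mult_right_mono) auto
    finally show ?thesis by (simp add: power_mult)
  qed
  have "\<rho> 0 \<le> \<kappa>\<^sup>2"
  proof (rule ccontr)
    assume "\<not> \<rho> 0 \<le> \<kappa>\<^sup>2"
    then have x: "\<rho> 0 / \<kappa>\<^sup>2 > 1" using k by simp
    define x where "x = \<rho> 0 / \<kappa>\<^sup>2"
    have xb: "x ^ (2 ^ j) \<le> real d" for j
    proof -
      have "(\<rho> 0) ^ (2 ^ j) \<le> real d * (\<kappa>\<^sup>2) ^ (2 ^ j)" using pw[of j] up[of j] by linarith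
      then show ?thesis using k by (simp add: x_def power_divide pos_divide_le_eq)
    qed
    obtain n where n: "real d < x ^ n" using real_arch_pow[of x "real d"] x by (auto simp: x_def)
    have "x ^ n \<le> x ^ (2 ^ n)" by (rule power_increasing) (use x x_def less_exp[of n] in auto)
    then show False using xb[of n] n by linarith
  qed
  then show ?thesis using n sym_matsD(1)[OF A] by (simp add: \<rho>_def pos_divide_le_eq)
qed

lemma op_norm_le_iff_confined:
  assumes A: "A \<in> sym_mats d" and k: "\<kappa> > 0"
  shows "op_norm A \<le> \<kappa> \<longleftrightarrow> confined \<kappa> A"
proof
  note A' = sym_matsD(1)[OF A]
  have dim: "dim_col A = d" using A' by simp
  have Av: "A *\<^sub>v v \<in> carrier_vec d" if "v \<in> carrier_vec d" for v using A' that by simp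
  have ratio: "euclid_norm (A *\<^sub>v v) / euclid_norm v = sqrt (sqnorm d (A *\<^sub>v v) / sqnorm d v)" if "v \<in> carrier_vec d" for v
    unfolding euclid_norm_eq[OF that] euclid_norm_eq[OF Av[OF that]] real_sqrt_divide ..
  {
    assume c: "confined \<kappa> A"
    show "op_norm A \<le> \<kappa>" unfolding op_norm_def dim
    proof (rule cSUP_least)
      show "carrier_vec d \<noteq> ({} :: real Matrix.vec set)" using zero_carrier_vec by blast
      fix v :: "real Matrix.vec" assume v: "v \<in> carrier_vec d"
      have "sqnorm d (A *\<^sub>v v) / sqnorm d v \<le> \<kappa>\<^sup>2"
      proof (cases "sqnorm d v = 0")
        case False
        then have "sqnorm d v > 0" using sqnorm_nonneg[of d v] by linarith
        then show ?thesis using confined_imp_contraction[OF A v k c] by (simp add: pos_divide_le_eq)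
      qed simp
      then have "sqrt (sqnorm d (A *\<^sub>v v) / sqnorm d v) \<le> sqrt (\<kappa>\<^sup>2)" by (rule real_sqrt_le_mono)
      then show "euclid_norm (A *\<^sub>v v) / euclid_norm v \<le> \<kappa>" unfolding ratio[OF v] using k by simp
    qed
  }
  assume o: "op_norm A \<le> \<kappa>"
  have bdd: "bdd_above ((\<lambda>v. euclid_norm (A *\<^sub>v v) / euclid_norm v) ` carrier_vec d)"
  proof (rule bdd_aboveI2)
    fix v :: "real Matrix.vec" assume v: "v \<in> carrier_vec d"
    have A1: "A ^\<^sub>m 1 = A" using A' by simp
    have "sqnorm d (A *\<^sub>v v) / sqnorm d v \<le> power_trace A 2"
    proof (cases "sqnorm d v = 0")
      case False
      then have "sqnorm d v > 0" using sqnorm_nonneg[of d v] by linarith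
      then show ?thesis using sqnorm_pow_le_trace[OF A v, of 1] unfolding A1 by (simp add: pos_divide_le_eq)
    qed (use power_trace_even_nonneg[OF A, of 1] in simp)
    then show "euclid_norm (A *\<^sub>v v) / euclid_norm v \<le> sqrt (power_trace A 2)"
      unfolding ratio[OF v] by (rule real_sqrt_le_mono)
  qed
  show "confined \<kappa> A" unfolding confined_def
  proof
    fix e assume e: "e \<in># eigenvalue_mset A"
    have cp0: "char_poly A \<noteq> 0" using degree_monic_char_poly[OF A'] by auto
    have "poly (char_poly A) e = 0" using e cp0 unfolding eigenvalue_mset_def by simp
    then have "eigenvalue A e" using eigenvalue_root_char_poly[OF A'] by simp
    then obtain v where v: "v \<in> carrier_vec d" "v \<noteq> 0\<^sub>v d" "A *\<^sub>v v = e \<cdot>\<^sub>v v"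
      using A' unfolding eigenvalue_def eigenvector_def by auto
    have n: "sqnorm d v \<noteq> 0" using sqnorm_eq_0[OF v(1)] v(2) by blast
    have "sqnorm d (A *\<^sub>v v) = (\<Sum>i<d. (e * v $ i)\<^sup>2)"
      unfolding sqnorm_def v(3) by (rule sum.cong[OF refl]) (use v(1) in simp)
    also have "\<dots> = e\<^sup>2 * sqnorm d v" unfolding sqnorm_def sum_distrib_left power_mult_distrib ..
    finally have "euclid_norm (A *\<^sub>v v) / euclid_norm v = \<bar>e\<bar>" unfolding ratio[OF v(1)] using n by simp
    moreover have "euclid_norm (A *\<^sub>v v) / euclid_norm v \<le> op_norm A"
      unfolding op_norm_def dim by (rule cSUP_upper[OF v(1) bdd])
    ultimately show "\<bar>e\<bar> \<le> \<kappa>" using o by linarith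
  qed
qed

section \<open>The limit measure and the method of moments\<close>

lemma interior_pos:
  fixes \<kappa> x :: real
  assumes "x \<in> {-\<kappa><..<\<kappa>}"
  shows "\<kappa>\<^sup>2 - x\<^sup>2 > 0"
proof -
  have "\<bar>x\<bar> < \<bar>\<kappa>\<bar>" using assms by auto
  then have "\<bar>x\<bar>\<^sup>2 < \<bar>\<kappa>\<bar>\<^sup>2" by (intro power_strict_mono) auto
  then show ?thesis by simp
qed

lemma sqrt_circle_deriv:
  fixes \<kappa> x :: real
  assumes "x \<in> {-\<kappa><..<\<kappa>}"
  shows "((\<lambda>x. sqrt (\<kappa>\<^sup>2 - x\<^sup>2)) has_real_derivative - x / sqrt (\<kappa>\<^sup>2 - x\<^sup>2)) (at x)"
proof -
  have "((\<lambda>x. \<kappa>\<^sup>2 - x\<^sup>2) has_real_derivative (- (2 * x))) (at x)"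
    by (auto intro!: derivative_eq_intros)
  from DERIV_chain2[OF DERIV_real_sqrt[OF interior_pos[OF assms]] this]
  show ?thesis by (rule DERIV_cong) (simp add: field_simps)
qed

lemma arcsine_integral_0:
  fixes \<kappa> :: real
  assumes k: "\<kappa> > 0"
  shows "((\<lambda>x. 1 / (pi * sqrt (\<kappa>\<^sup>2 - x\<^sup>2))) has_integral 1) {-\<kappa>..\<kappa>}"
proof -
  have "((\<lambda>x. 1 / (pi * sqrt (\<kappa>\<^sup>2 - x\<^sup>2))) has_integral (arcsin (\<kappa> / \<kappa>) / pi - arcsin (- \<kappa> / \<kappa>) / pi)) {-\<kappa>..\<kappa>}"
  proof (rule fundamental_theorem_of_calculus_interior)
    show "- \<kappa> \<le> \<kappa>" using k by simp
    show "continuous_on {-\<kappa>..\<kappa>} (\<lambda>x. arcsin (x / \<kappa>) / pi)"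
      by (intro continuous_intros) (use k in \<open>auto simp: divide_simps\<close>)
    fix x assume x: "x \<in> {-\<kappa><..<\<kappa>}"
    have b: "- 1 < x / \<kappa>" "x / \<kappa> < 1" using x k by (auto simp: divide_simps)
    have "((\<lambda>x. arcsin (x / \<kappa>) / pi) has_real_derivative (inverse (sqrt (1 - (x / \<kappa>)\<^sup>2)) * (1 / \<kappa>) / pi)) (at x)"
      by (rule DERIV_cdivide[OF DERIV_chain2[OF DERIV_arcsin[OF b] DERIV_cdivide[OF DERIV_ident]]])
    moreover have "inverse (sqrt (1 - (x / \<kappa>)\<^sup>2)) * (1 / \<kappa>) / pi = 1 / (pi * sqrt (\<kappa>\<^sup>2 - x\<^sup>2))"
    proof -
      have "1 - (x / \<kappa>)\<^sup>2 = (\<kappa>\<^sup>2 - x\<^sup>2) / \<kappa>\<^sup>2" using k by (simp add: power_divide diff_divide_distrib)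
      then have "sqrt (1 - (x / \<kappa>)\<^sup>2) = sqrt (\<kappa>\<^sup>2 - x\<^sup>2) / \<kappa>" using k by (simp add: real_sqrt_divide)
      then show ?thesis using k by (simp add: inverse_eq_divide)
    qed
    ultimately show "((\<lambda>x. arcsin (x / \<kappa>) / pi) has_vector_derivative 1 / (pi * sqrt (\<kappa>\<^sup>2 - x\<^sup>2))) (at x)"
      by (simp add: has_real_derivative_iff_has_vector_derivative)
  qed
  moreover have "arcsin (\<kappa> / \<kappa>) / pi - arcsin (- \<kappa> / \<kappa>) / pi = 1" using k by simp
  ultimately show ?thesis by simp
qed

lemma arcsine_integral_1:
  fixes \<kappa> :: real
  assumes k: "\<kappa> > 0"
  shows "((\<lambda>x. x / (pi * sqrt (\<kappa>\<^sup>2 - x\<^sup>2))) has_integral 0) {-\<kappa>..\<kappa>}"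
proof -
  have "((\<lambda>x. x / (pi * sqrt (\<kappa>\<^sup>2 - x\<^sup>2))) has_integral (- sqrt (\<kappa>\<^sup>2 - \<kappa>\<^sup>2) / pi - (- sqrt (\<kappa>\<^sup>2 - (-\<kappa>)\<^sup>2) / pi))) {-\<kappa>..\<kappa>}"
  proof (rule fundamental_theorem_of_calculus_interior)
    show "- \<kappa> \<le> \<kappa>" using k by simp
    show "continuous_on {-\<kappa>..\<kappa>} (\<lambda>x. - sqrt (\<kappa>\<^sup>2 - x\<^sup>2) / pi)" by (intro continuous_intros) auto
    fix x assume x: "x \<in> {-\<kappa><..<\<kappa>}"
    show "((\<lambda>x. - sqrt (\<kappa>\<^sup>2 - x\<^sup>2) / pi) has_vector_derivative x / (pi * sqrt (\<kappa>\<^sup>2 - x\<^sup>2))) (at x)"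
      unfolding has_real_derivative_iff_has_vector_derivative[symmetric]
      by (rule DERIV_cong[OF DERIV_cdivide[OF DERIV_minus[OF sqrt_circle_deriv[OF x]]]]) simp
  qed
  then show ?thesis by simp
qed

text \<open>
  The fundamental theorem of calculus for x^(n+1) sqrt (\<open>\<kappa>\<close>^2 - x^2), which vanishes at both ends.
\<close>

lemma arcsine_integral_step:
  fixes \<kappa> :: real
  assumes k: "\<kappa> > 0" and I: "((\<lambda>x. x ^ n / (pi * sqrt (\<kappa>\<^sup>2 - x\<^sup>2))) has_integral a) {-\<kappa>..\<kappa>}"
  shows "((\<lambda>x. x ^ (n + 2) / (pi * sqrt (\<kappa>\<^sup>2 - x\<^sup>2))) has_integral (\<kappa>\<^sup>2 * real (n + 1) / real (n + 2) * a)) {-\<kappa>..\<kappa>}"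
proof -
  let ?s = "\<lambda>x. sqrt (\<kappa>\<^sup>2 - x\<^sup>2)"
  let ?g = "\<lambda>x. real (n + 1) * \<kappa>\<^sup>2 * (x ^ n / (pi * ?s x)) - real (n + 2) * (x ^ (n + 2) / (pi * ?s x))"
  have "(?g has_integral (\<kappa> ^ (n + 1) * sqrt (\<kappa>\<^sup>2 - \<kappa>\<^sup>2) / pi - (- \<kappa>) ^ (n + 1) * sqrt (\<kappa>\<^sup>2 - (- \<kappa>)\<^sup>2) / pi)) {-\<kappa>..\<kappa>}"
  proof (rule fundamental_theorem_of_calculus_interior)
    show "- \<kappa> \<le> \<kappa>" using k by simp
    show "continuous_on {-\<kappa>..\<kappa>} (\<lambda>x. x ^ (n + 1) * ?s x / pi)" by (intro continuous_intros) auto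
    fix x assume x: "x \<in> {-\<kappa><..<\<kappa>}"
    have p: "((\<lambda>x. x ^ (n + 1)) has_real_derivative (real (n + 1) * x ^ n)) (at x)"
      using DERIV_pow[of "n + 1" x] by simp
    define S where "S = ?s x"
    have S: "S > 0" "S * S = \<kappa>\<^sup>2 - x\<^sup>2" using interior_pos[OF x] by (simp_all add: S_def)
    \<comment> \<open>Here a, X, c and y stand for n + 1, x^n, \<open>\<kappa>\<close>^2 and x^2.\<close>
    have id: "(a * X * (c - y) / S - X * y / S) / pi = a * c * (X / (pi * S)) - (a + 1) * (X * y / (pi * S))" for a X c y :: real
      using S(1) by (simp add: field_simps)
    have "real (n + 1) * x ^ n * S = real (n + 1) * x ^ n * (S * S) / S" using S(1) by simp
    then have 1: "real (n + 1) * x ^ n * S = real (n + 1) * x ^ n * (\<kappa>\<^sup>2 - x\<^sup>2) / S" unfolding S(2) .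
    have 2: "- x / S * x ^ (n + 1) = - (x ^ n * x\<^sup>2 / S)" by (simp add: power2_eq_square)
    have 3: "x ^ (n + 2) = x ^ n * x\<^sup>2" "real (n + 2) = real (n + 1) + 1"
      by (simp_all add: power_add power2_eq_square)
    have "(real (n + 1) * x ^ n * S + - x / S * x ^ (n + 1)) / pi = ?g x"
      unfolding 1 2 3 S_def[symmetric] using id[of "real (n + 1)" "x ^ n" "\<kappa>\<^sup>2" "x\<^sup>2"] by simp
    then have "(real (n + 1) * x ^ n * ?s x + - x / ?s x * x ^ (n + 1)) / pi = ?g x" unfolding S_def .
    then show "((\<lambda>x. x ^ (n + 1) * ?s x / pi) has_vector_derivative ?g x) (at x)"
      unfolding has_real_derivative_iff_has_vector_derivative[symmetric]
      using DERIV_cdivide[OF DERIV_mult[OF p sqrt_circle_deriv[OF x]], of pi] by (simp only:)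
  qed
  then have g: "(?g has_integral 0) {-\<kappa>..\<kappa>}" by simp
  have "((\<lambda>x. (real (n + 1) * \<kappa>\<^sup>2 * (x ^ n / (pi * ?s x)) - ?g x) / real (n + 2)) has_integral ((real (n + 1) * \<kappa>\<^sup>2 * a - 0) / real (n + 2))) {-\<kappa>..\<kappa>}"
    by (intro has_integral_divide has_integral_diff has_integral_mult_right I g)
  moreover have "(\<lambda>x. (real (n + 1) * \<kappa>\<^sup>2 * (x ^ n / (pi * ?s x)) - ?g x) / real (n + 2)) = (\<lambda>x. x ^ (n + 2) / (pi * ?s x))"
    by (rule ext) (simp del: of_nat_add)
  ultimately show ?thesis by (simp add: mult_ac)
qed

lemma arcsine_integral:
  fixes \<kappa> :: real
  assumes k: "\<kappa> > 0"
  shows "((\<lambda>x. x ^ n / (pi * sqrt (\<kappa>\<^sup>2 - x\<^sup>2))) has_integral arcsine_moment \<kappa> n) {-\<kappa>..\<kappa>}"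
proof (induction n rule: nat_less_induct)
  case (1 n)
  consider "n = 0" | "n = 1" | m where "n = m + 2"
    by (metis One_nat_def add_2_eq_Suc' not0_implies_Suc)
  then show ?case
  proof cases
    case 1
    then show ?thesis using arcsine_integral_0[OF k] by simp
  next
    case 2
    then show ?thesis using arcsine_integral_1[OF k] by simp
  next
    case (3 m)
    then have "((\<lambda>x. x ^ m / (pi * sqrt (\<kappa>\<^sup>2 - x\<^sup>2))) has_integral arcsine_moment \<kappa> m) {-\<kappa>..\<kappa>}" using 1 by simp
    from arcsine_integral_step[OF k this] show ?thesis unfolding 3 by simp
  qed
qed

lemma rho_moment:
  fixes \<kappa> :: real
  assumes k: "\<kappa> > 0"
  shows "((\<lambda>x. x ^ n * (indicator {-\<kappa><..<\<kappa>} x * rho \<kappa> x)) has_integral limit_moment \<kappa> n) UNIV"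
proof -
  let ?s = "\<lambda>x. sqrt (\<kappa>\<^sup>2 - x\<^sup>2)"
  have "((\<lambda>x. ((4 + \<kappa>\<^sup>2) / 2 * (x ^ n / (pi * ?s x)) - x ^ (n + 2) / (pi * ?s x)) / 2) has_integral limit_moment \<kappa> n) {-\<kappa>..\<kappa>}"
    unfolding limit_moment_def by (intro has_integral_divide has_integral_diff has_integral_mult_right arcsine_integral[OF k])
  moreover have "((4 + \<kappa>\<^sup>2) / 2 * (x ^ n / (pi * ?s x)) - x ^ (n + 2) / (pi * ?s x)) / 2 = x ^ n * rho \<kappa> x" for x
  proof (cases "?s x = 0")
    case False
    then show ?thesis by (simp add: rho_def field_simps power2_eq_square)
  qed (simp add: rho_def)
  ultimately have "((\<lambda>x. x ^ n * rho \<kappa> x) has_integral limit_moment \<kappa> n) {-\<kappa>..\<kappa>}" by simp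
  then have "((\<lambda>x. x ^ n * rho \<kappa> x) has_integral limit_moment \<kappa> n) {-\<kappa><..<\<kappa>}"
    by (simp add: has_integral_Icc_iff_Ioo)
  then have "((\<lambda>x. if x \<in> {-\<kappa><..<\<kappa>} then x ^ n * rho \<kappa> x else 0) has_integral limit_moment \<kappa> n) UNIV"
    by (simp only: has_integral_restrict_UNIV)
  moreover have "(\<lambda>x. if x \<in> {-\<kappa><..<\<kappa>} then x ^ n * rho \<kappa> x else 0) = (\<lambda>x. x ^ n * (indicator {-\<kappa><..<\<kappa>} x * rho \<kappa> x))"
    by (auto simp: indicator_def)
  ultimately show ?thesis by simp
qed

lemma rho_density_measurable: "(\<lambda>x. indicator {-\<kappa><..<\<kappa>} x * rho \<kappa> x) \<in> borel_measurable borel"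
  unfolding rho_def by measurable

text \<open>
  For \<open>\<kappa>\<close> greater than 2 the numerator of the density would be negative near the ends of the interval.
\<close>

lemma rho_density_nonneg:
  assumes k: "0 < \<kappa>" "\<kappa> \<le> 2"
  shows "0 \<le> indicator {-\<kappa><..<\<kappa>} x * rho \<kappa> x"
proof (cases "x \<in> {-\<kappa><..<\<kappa>}")
  case True
  have "x\<^sup>2 < \<kappa>\<^sup>2" using interior_pos[OF True] by simp
  moreover have "\<kappa>\<^sup>2 \<le> 4" using power_mono[of \<kappa> 2 2] k by simp
  ultimately have "0 \<le> 4 + \<kappa>\<^sup>2 - 2 * x\<^sup>2" by linarith
  then show ?thesis using interior_pos[OF True] by (simp add: rho_def)
qed simp

lemma limit_moment_0: "limit_moment \<kappa> 0 = 1"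
  by (simp add: limit_moment_def numeral_2_eq_2 field_simps)

lemma mu_limit_prob:
  assumes k: "0 < \<kappa>" "\<kappa> \<le> 2"
  shows "prob_space (mu_limit \<kappa>)"
proof (rule prob_spaceI)
  have "(\<integral>\<^sup>+x. ennreal (indicator {-\<kappa><..<\<kappa>} x * rho \<kappa> x) \<partial>lborel) = ennreal 1"
    using nn_integral_has_integral_lborel[OF rho_density_measurable rho_density_nonneg[OF k]] rho_moment[OF k(1), of 0]
    by (simp add: limit_moment_0)
  then show "emeasure (mu_limit \<kappa>) (space (mu_limit \<kappa>)) = 1"
    unfolding mu_limit_def using rho_density_measurable by (subst emeasure_density) auto
qed

lemma mu_limit_real_distribution:
  assumes k: "0 < \<kappa>" "\<kappa> \<le> 2"
  shows "real_distribution (mu_limit \<kappa>)"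
proof -
  interpret prob_space "mu_limit \<kappa>" by (rule mu_limit_prob[OF k])
  show ?thesis by unfold_locales (simp_all add: mu_limit_def)
qed

lemma mu_limit_support:
  assumes k: "0 < \<kappa>" "\<kappa> \<le> 2"
  shows "AE x in mu_limit \<kappa>. \<bar>x\<bar> \<le> \<kappa>"
  unfolding mu_limit_def using rho_density_measurable
  by (subst AE_density) (auto simp: indicator_def)

lemma mu_limit_moment:
  assumes k: "0 < \<kappa>" "\<kappa> \<le> 2"
  shows "(\<integral>x. x ^ n \<partial>mu_limit \<kappa>) = limit_moment \<kappa> n"
proof -
  let ?f = "\<lambda>x. indicator {-\<kappa><..<\<kappa>} x * rho \<kappa> x"
  interpret real_distribution "mu_limit \<kappa>" by (rule mu_limit_real_distribution[OF k])
  have m: "?f \<in> borel_measurable lborel" using rho_density_measurable by simp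
  have "integrable (mu_limit \<kappa>) (\<lambda>x. x ^ n)"
  proof (rule integrable_const_bound[of _ "\<kappa> ^ n"])
    show "AE x in mu_limit \<kappa>. norm (x ^ n) \<le> \<kappa> ^ n"
      using mu_limit_support[OF k] by eventually_elim (auto simp: power_abs intro: power_mono)
  qed (simp add: mu_limit_def)
  then have "integrable lborel (\<lambda>x. ?f x * x ^ n)"
    unfolding mu_limit_def by (subst (asm) integrable_density) (use m rho_density_nonneg[OF k] in auto)
  then have i: "integrable lborel (\<lambda>x. x ^ n * ?f x)" by (simp only: mult.commute)
  have "(\<integral>x. x ^ n \<partial>mu_limit \<kappa>) = (\<integral>x. ?f x * x ^ n \<partial>lborel)"
    unfolding mu_limit_def by (subst integral_density) (use m rho_density_nonneg[OF k] in auto)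
  also have "\<dots> = (\<integral>x. x ^ n * ?f x \<partial>lborel)" by (simp only: mult.commute)
  also have "\<dots> = limit_moment \<kappa> n"
    using has_integral_unique[OF has_integral_integral_lborel[OF i] rho_moment[OF k(1)]] .
  finally show ?thesis .
qed

text \<open>
  On the common compact support, the continuous step functions that characterize weak convergence are
  uniform limits of polynomials.
\<close>

lemma moments_imp_weak_conv:
  fixes \<mu> :: "nat \<Rightarrow> real measure" and \<nu> :: "real measure"
  assumes rd: "\<And>n. real_distribution (\<mu> n)" "real_distribution \<nu>"
    and supp: "\<And>n. AE x in \<mu> n. \<bar>x\<bar> \<le> K" "AE x in \<nu>. \<bar>x\<bar> \<le> K"
    and mom: "\<And>k. (\<lambda>n. \<integral>x. x ^ k \<partial>\<mu> n) \<longlonglongrightarrow> (\<integral>x. x ^ k \<partial>\<nu>)"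
  shows "weak_conv_m \<mu> \<nu>"
proof (rule integral_cts_step_conv_imp_weak_conv[OF rd])
  fix x y :: real assume xy: "x < y"
  let ?f = "cts_step x y"
  have fc: "continuous_on UNIV ?f" using cts_step_uniformly_continuous[OF xy] by (rule uniformly_continuous_imp_continuous)
  have fm: "?f \<in> borel_measurable borel" by (rule borel_measurable_continuous_onI[OF fc])
  have ipow: "integrable M (\<lambda>x. x ^ k)" if "real_distribution M" "AE x in M. \<bar>x\<bar> \<le> K" for M :: "real measure" and k :: nat
  proof -
    interpret real_distribution M by fact
    show ?thesis
    proof (rule integrable_const_bound[of _ "K ^ k"])
      show "AE x in M. norm (x ^ k) \<le> K ^ k"
        using that(2) by eventually_elim (auto simp: power_abs intro: power_mono)
    qed simp
  qed
  show "(\<lambda>n. integral\<^sup>L (\<mu> n) ?f) \<longlonglongrightarrow> integral\<^sup>L \<nu> ?f"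
  proof (rule LIMSEQ_I)
    fix e :: real assume e: "0 < e"
    have "compact {-K..K}" "continuous_on {-K..K} ?f" "0 < e / 3"
      using fc e by (auto intro: continuous_on_subset)
    from Stone_Weierstrass_real_polynomial_function[OF this] obtain g where
      g: "real_polynomial_function g" "\<And>z. z \<in> {-K..K} \<Longrightarrow> \<bar>?f z - g z\<bar> < e / 3" by blast
    obtain a N where gs: "g = (\<lambda>z. \<Sum>i\<le>N. a i * z ^ i)" using g(1) real_polynomial_function_iff_sum by blast
    have ig: "integrable M g" and ev: "integral\<^sup>L M g = (\<Sum>i\<le>N. a i * (\<integral>z. z ^ i \<partial>M))"
      and cl: "\<bar>integral\<^sup>L M ?f - integral\<^sup>L M g\<bar> \<le> e / 3"
      if M: "real_distribution M" "AE x in M. \<bar>x\<bar> \<le> K" for M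
    proof -
      interpret real_distribution M by fact
      note ip = ipow[OF M]
      show ig: "integrable M g" unfolding gs by (intro Bochner_Integration.integrable_sum integrable_mult_right ip)
      show "integral\<^sup>L M g = (\<Sum>i\<le>N. a i * (\<integral>z. z ^ i \<partial>M))"
        unfolding gs by (simp add: Bochner_Integration.integral_sum ip)
      have if_: "integrable M ?f" by (rule integrable_cts_step[OF xy])
      have "\<bar>integral\<^sup>L M ?f - integral\<^sup>L M g\<bar> = \<bar>\<integral>z. ?f z - g z \<partial>M\<bar>" using if_ ig by simp
      also have "\<dots> \<le> (\<integral>z. \<bar>?f z - g z\<bar> \<partial>M)" by (rule integral_abs_bound)
      also have "\<dots> \<le> (\<integral>z. e / 3 \<partial>M)"
      proof (rule integral_mono_AE)
        show "AE z in M. \<bar>?f z - g z\<bar> \<le> e / 3"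
          using M(2)
        proof eventually_elim
          case (elim z)
          then have "z \<in> {-K..K}" by auto
          from g(2)[OF this] show ?case by (rule less_imp_le)
        qed
      qed (use if_ ig in auto)
      also have "\<dots> = e / 3" using prob_space by simp
      finally show "\<bar>integral\<^sup>L M ?f - integral\<^sup>L M g\<bar> \<le> e / 3" .
    qed
    have "(\<lambda>n. integral\<^sup>L (\<mu> n) g) \<longlonglongrightarrow> integral\<^sup>L \<nu> g"
      unfolding ev[OF rd(1) supp(1)] ev[OF rd(2) supp(2)] by (intro tendsto_sum tendsto_mult tendsto_const mom)
    from LIMSEQ_D[OF this, of "e / 3"] e obtain n0 where
      n0: "\<And>n. n \<ge> n0 \<Longrightarrow> \<bar>integral\<^sup>L (\<mu> n) g - integral\<^sup>L \<nu> g\<bar> < e / 3" by auto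
    have "norm (integral\<^sup>L (\<mu> n) ?f - integral\<^sup>L \<nu> ?f) < e" if "n \<ge> n0" for n
    proof -
      have tri: "\<bar>a - p\<bar> < e" if "\<bar>b - q\<bar> < e / 3" "\<bar>a - b\<bar> \<le> e / 3" "\<bar>p - q\<bar> \<le> e / 3" for a b p q :: real
      proof -
        have "\<bar>a - p\<bar> = \<bar>(a - b) + (b - q) - (p - q)\<bar>" by simp
        also have "\<dots> \<le> \<bar>a - b\<bar> + \<bar>b - q\<bar> + \<bar>p - q\<bar>"
          by (intro order.trans[OF abs_triangle_ineq4] add_mono abs_triangle_ineq order.refl)
        finally show ?thesis using that by linarith
      qed
      show ?thesis unfolding real_norm_def
        by (rule tri[OF n0[OF that] cl[OF rd(1)[of n] supp(1)[of n]] cl[OF rd(2) supp(2)]])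
    qed
    then show "\<exists>no. \<forall>n\<ge>no. norm (integral\<^sup>L (\<mu> n) ?f - integral\<^sup>L \<nu> ?f) < e" by blast
  qed
qed

section \<open>Almost sure convergence of the empirical spectral distributions\<close>

lemma compact_moment_box: "compact (PiE UNIV (\<lambda>m. {- (\<kappa> ^ m)..\<kappa> ^ m}) :: (nat \<Rightarrow> real) set)"
proof -
  have "compactin (product_topology (\<lambda>_. euclidean) UNIV) (PiE UNIV (\<lambda>m. {- (\<kappa> ^ m)..\<kappa> ^ m}) :: (nat \<Rightarrow> real) set)"
    unfolding compactin_PiE by (simp add: compactin_euclidean_iff)
  then show ?thesis by (simp add: euclidean_product_topology compactin_euclidean_iff)
qed

text \<open>
  All sequences of normalized traces lie in one compact box, and \<open>loop_equation_unique_solution\<close>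
  identifies every limit point.
\<close>

lemma moments_converge:
  fixes \<kappa> :: real and t :: "nat \<Rightarrow> nat \<Rightarrow> real"
  assumes k: "0 < \<kappa>" "\<kappa> \<le> 2"
    and t0: "\<And>n. t n 0 = 1" and bd: "\<And>n m. \<bar>t n m\<bar> \<le> \<kappa> ^ m"
    and loop: "\<And>k. (\<lambda>n. loop_stat \<kappa> k (Suc n) (t n)) \<longlonglongrightarrow> 0"
  shows "(\<lambda>n. t n m) \<longlonglongrightarrow> limit_moment \<kappa> m"
proof (rule ccontr)
  assume "\<not> (\<lambda>n. t n m) \<longlonglongrightarrow> limit_moment \<kappa> m"
  then obtain e where e: "e > 0" and "\<forall>N. \<exists>n\<ge>N. \<not> \<bar>t n m - limit_moment \<kappa> m\<bar> < e"
    unfolding LIMSEQ_iff real_norm_def by blast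
  then have "infinite {n. \<not> \<bar>t n m - limit_moment \<kappa> m\<bar> < e}"
    unfolding infinite_nat_iff_unbounded_le by blast
  from infinite_enumerate[OF this] obtain r :: "nat \<Rightarrow> nat" where
    r: "strict_mono r" "\<And>n. \<not> \<bar>t (r n) m - limit_moment \<kappa> m\<bar> < e" by blast
  let ?K = "PiE UNIV (\<lambda>m. {- (\<kappa> ^ m)..\<kappa> ^ m}) :: (nat \<Rightarrow> real) set"
  have K: "t n \<in> ?K" for n
  proof (rule PiE_I)
    show "t n i \<in> {- (\<kappa> ^ i)..\<kappa> ^ i}" for i using abs_le_D1[OF bd[of n i]] abs_le_D2[OF bd[of n i]] by simp
  qed simp
  have "seq_compact ?K" using compact_moment_box[of \<kappa>] by (simp add: compact_eq_seq_compact_metric)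
  then obtain l s where l: "l \<in> ?K" and s: "strict_mono s" and lim: "((\<lambda>n. t (r n)) \<circ> s) \<longlonglongrightarrow> l"
    by (rule seq_compactE[of _ "\<lambda>n. t (r n)"]) (use K in blast)+
  define q where "q n = r (s n)" for n
  have q: "strict_mono q" unfolding q_def using r(1) s by (auto simp: strict_mono_def)
  have coord: "(\<lambda>n. t (q n) i) \<longlonglongrightarrow> l i" for i
  proof -
    have "isCont (\<lambda>f::nat \<Rightarrow> real. f i) l"
      using continuous_on_product_coordinates[of i] continuous_on_eq_continuous_at[of UNIV] by blast
    from isCont_tendsto_compose[OF this lim] show ?thesis by (simp add: q_def o_def)
  qed
  have l0: "l 0 = 1" using coord[of 0] t0 by (simp add: LIMSEQ_const_iff)
  have lb: "\<bar>l i\<bar> \<le> \<kappa> ^ i" for i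
  proof -
    have "l i \<in> {- (\<kappa> ^ i)..\<kappa> ^ i}" using l by (rule PiE_mem) simp
    then show ?thesis by (auto simp: abs_le_iff)
  qed
  have ld: "loop_defect (\<kappa>\<^sup>2) l k = 0" for k
  proof -
    have "(\<lambda>n. loop_defect (\<kappa>\<^sup>2) (t (q n)) k) \<longlonglongrightarrow> loop_defect (\<kappa>\<^sup>2) l k"
      unfolding loop_defect_def conv_moments_def by (intro tendsto_intros coord)
    moreover have "(\<lambda>n. loop_stat \<kappa> k (Suc (q n)) (t (q n)) - (\<kappa>\<^sup>2 * real k * t (q n) (k - 1) - real (k + 2) * t (q n) (k + 1)) * inverse (real (Suc (q n)))) \<longlonglongrightarrow>
       0 - (\<kappa>\<^sup>2 * real k * l (k - 1) - real (k + 2) * l (k + 1)) * 0"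
    proof (intro tendsto_diff tendsto_mult tendsto_const coord)
      show "(\<lambda>n. loop_stat \<kappa> k (Suc (q n)) (t (q n))) \<longlonglongrightarrow> 0"
        using LIMSEQ_subseq_LIMSEQ[OF loop[of k] q] by (simp add: o_def)
      show "(\<lambda>n. inverse (real (Suc (q n)))) \<longlonglongrightarrow> 0"
        using LIMSEQ_subseq_LIMSEQ[OF LIMSEQ_inverse_real_of_nat q] by (simp add: o_def)
    qed
    then have "(\<lambda>n. loop_defect (\<kappa>\<^sup>2) (t (q n)) k) \<longlonglongrightarrow> 0"
      by (simp add: loop_stat_def loop_linear_def loop_defect_def divide_inverse algebra_simps)
    ultimately show ?thesis by (rule LIMSEQ_unique)
  qed
  have "l m = limit_moment \<kappa> m" by (rule loop_equation_unique_solution[OF k l0 lb ld])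
  with coord[of m] have "(\<lambda>n. t (q n) m) \<longlonglongrightarrow> limit_moment \<kappa> m" by simp
  from LIMSEQ_D[OF this e] obtain N where "\<bar>t (q N) m - limit_moment \<kappa> m\<bar> < e" by auto
  then show False using r(2)[of "s N"] by (simp add: q_def)
qed

lemma sum_mset_eq_weighted_sum:
  fixes f :: "'a \<Rightarrow> real"
  assumes "finite B" "set_mset E \<subseteq> B"
  shows "(\<Sum>e\<in>#E. f e) = (\<Sum>x\<in>B. real (count E x) * f x)"
  using assms(2)
proof (induction E)
  case (add y E)
  have "(\<Sum>x\<in>B. real (count (add_mset y E) x) * f x) = (\<Sum>x\<in>B. real (count E x) * f x + (if x = y then f x else 0))"
    by (rule sum.cong) (auto simp: distrib_right)
  also have "\<dots> = (\<Sum>x\<in>B. real (count E x) * f x) + f y"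
    using add.prems assms(1) by (simp add: sum.distrib)
  finally show ?case using add by simp
qed simp

lemma esd_integral:
  assumes A: "A \<in> sym_mats d" and d: "d \<ge> 1" and f: "f \<in> borel_measurable borel"
  shows "(\<integral>x. f x \<partial>esd A) = (\<Sum>e\<in>#eigenvalue_mset A. f e) / real d"
proof -
  have dim: "dim_row A = d" using sym_matsD(1)[OF A] by simp
  let ?S = "set_mset (eigenvalue_mset A)" and ?c = "\<lambda>x. real (count (eigenvalue_mset A) x) / real (dim_row A)"
  have "(\<integral>x. f x \<partial>esd A) = (\<integral>x. f x \<partial>point_measure ?S (\<lambda>x. ennreal (?c x)))"
    unfolding esd_def by (rule integral_distr) (use f in \<open>auto simp: measurable_def space_point_measure sets_point_measure\<close>)
  also have "\<dots> = (\<Sum>x\<in>?S. ?c x *\<^sub>R f x)"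
    by (rule lebesgue_integral_point_measure_finite) auto
  also have "\<dots> = (\<Sum>x\<in>?S. real (count (eigenvalue_mset A) x) * f x) / real d"
    unfolding dim sum_divide_distrib by (rule sum.cong) auto
  also have "\<dots> = (\<Sum>e\<in>#eigenvalue_mset A. f e) / real d"
    by (subst sum_mset_eq_weighted_sum[of ?S]) auto
  finally show ?thesis .
qed

lemma esd_real_distribution:
  assumes A: "A \<in> sym_mats d" and d: "d \<ge> 1"
  shows "real_distribution (esd A)"
proof -
  have dim: "dim_row A = d" using sym_matsD(1)[OF A] by simp
  let ?S = "set_mset (eigenvalue_mset A)" and ?c = "\<lambda>x. real (count (eigenvalue_mset A) x) / real (dim_row A)"
  have "(\<Sum>x\<in>?S. ?c x) = (\<Sum>x\<in>?S. real (count (eigenvalue_mset A) x) * 1) / real d"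
    unfolding dim sum_divide_distrib by simp
  also have "\<dots> = (\<Sum>e\<in>#eigenvalue_mset A. 1) / real d" by (subst sum_mset_eq_weighted_sum[of ?S]) auto
  also have "\<dots> = 1" using power_trace_eq_sum_mset(2)[OF A] d by simp
  finally have s: "(\<Sum>x\<in>?S. ?c x) = 1" .
  have "prob_space (point_measure ?S (\<lambda>x. ennreal (?c x)))"
  proof (rule prob_spaceI)
    have "emeasure (point_measure ?S (\<lambda>x. ennreal (?c x))) ?S = (\<Sum>x\<in>?S. ennreal (?c x))"
      by (rule emeasure_point_measure_finite) auto
    also have "\<dots> = ennreal (\<Sum>x\<in>?S. ?c x)" by (rule sum_ennreal) simp
    finally show "emeasure (point_measure ?S (\<lambda>x. ennreal (?c x))) (space (point_measure ?S (\<lambda>x. ennreal (?c x)))) = 1"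
      using s by (simp add: space_point_measure)
  qed
  then have "prob_space (esd A)" unfolding esd_def
    by (rule prob_space.prob_space_distr) (auto simp: measurable_def space_point_measure sets_point_measure)
  then interpret prob_space "esd A" .
  show ?thesis by unfold_locales (simp_all add: esd_def)
qed

lemma esd_moment:
  assumes A: "A \<in> sym_mats d" and d: "d \<ge> 1"
  shows "(\<integral>x. x ^ m \<partial>esd A) = norm_trace A m"
proof -
  have dim: "dim_row A = d" using sym_matsD(1)[OF A] by simp
  have "(\<integral>x. x ^ m \<partial>esd A) = (\<Sum>e\<in>#eigenvalue_mset A. e ^ m) / real d" by (rule esd_integral[OF A d]) simp
  then show ?thesis unfolding norm_trace_def dim power_trace_eq_sum_mset(1)[OF A] .
qed

lemma esd_support:
  assumes A: "A \<in> sym_mats d" and c: "confined \<kappa> A"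
  shows "AE x in esd A. \<bar>x\<bar> \<le> \<kappa>"
  unfolding esd_def
proof (subst AE_distr_iff)
  show "AE x in point_measure (set_mset (eigenvalue_mset A)) (\<lambda>x. ennreal (real (count (eigenvalue_mset A) x) / real (dim_row A))). \<bar>x\<bar> \<le> \<kappa>"
    by (rule AE_I2) (use c in \<open>auto simp: space_point_measure confined_def\<close>)
qed (auto simp: measurable_def space_point_measure sets_point_measure)

lemma norm_trace_0:
  assumes A: "A \<in> sym_mats d" and d: "d \<ge> 1"
  shows "norm_trace A 0 = 1"
proof -
  have dim: "dim_row A = d" using sym_matsD(1)[OF A] by simp
  then show ?thesis using d by (simp add: norm_trace_def power_trace_def)
qed

lemma esd_weak_conv:
  fixes \<kappa> :: real and A :: "nat \<Rightarrow> real mat"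
  assumes k: "0 < \<kappa>" "\<kappa> \<le> 2"
    and A: "\<And>n. A n \<in> sym_mats (Suc n)" and c: "\<And>n. confined \<kappa> (A n)"
    and loop: "\<And>k. (\<lambda>n. loop_obs \<kappa> k (A n)) \<longlonglongrightarrow> 0"
  shows "weak_conv_m (\<lambda>n. esd (A n)) (mu_limit \<kappa>)"
proof (rule moments_imp_weak_conv)
  have d: "Suc n \<ge> 1" for n by simp
  have dim: "dim_row (A n) = Suc n" for n using sym_matsD(1)[OF A[of n]] by simp
  show "real_distribution (esd (A n))" for n by (rule esd_real_distribution[OF A d])
  show "real_distribution (mu_limit \<kappa>)" by (rule mu_limit_real_distribution[OF k])
  show "AE x in esd (A n). \<bar>x\<bar> \<le> \<kappa>" for n by (rule esd_support[OF A c])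
  show "AE x in mu_limit \<kappa>. \<bar>x\<bar> \<le> \<kappa>" by (rule mu_limit_support[OF k])
  fix m
  have "(\<lambda>n. norm_trace (A n) m) \<longlonglongrightarrow> limit_moment \<kappa> m"
  proof (rule moments_converge[OF k])
    show "norm_trace (A n) 0 = 1" for n by (rule norm_trace_0[OF A d])
    show "\<bar>norm_trace (A n) m\<bar> \<le> \<kappa> ^ m" for n m by (rule norm_trace_bound_confined[OF A k(1) d c])
    show "(\<lambda>n. loop_stat \<kappa> k (Suc n) (norm_trace (A n))) \<longlonglongrightarrow> 0" for k
      using loop[of k] unfolding loop_obs_def dim .
  qed
  then show "(\<lambda>n. \<integral>x. x ^ m \<partial>esd (A n)) \<longlonglongrightarrow> (\<integral>x. x ^ m \<partial>mu_limit \<kappa>)"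
    unfolding esd_moment[OF A d] mu_limit_moment[OF k] .
qed

lemma P_cond_eq:
  assumes k: "\<kappa> > 0"
  shows "P_cond \<kappa> d = uniform_measure (GOE d) (confined_set \<kappa> d)"
proof -
  have "{A \<in> space (GOE d). op_norm A \<le> \<kappa>} = confined_set \<kappa> d"
    unfolding confined_set_def space_GOE using op_norm_le_iff_confined[OF _ k] by blast
  then show ?thesis by (simp add: P_cond_def)
qed

lemma measurable_loop_obs_square:
  "(\<lambda>A. ennreal ((loop_obs \<kappa> k A)\<^sup>2)) \<in> borel_measurable (sym_mat_algebra d)"
  by (intro measurable_compose[OF _ measurable_ennreal] borel_measurable_power tame_measurable tame_loop_obs)

text \<open>
  Dividing \<open>loop_second_moment\<close> by the probability of the ball.
\<close>

lemma P_cond_second_moment: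
  assumes d: "d \<ge> 1" and k: "\<kappa> > 0" and P: "prob_space (P_cond \<kappa> d)"
  shows "(\<integral>\<^sup>+A. ennreal ((loop_obs \<kappa> k A)\<^sup>2) \<partial>P_cond \<kappa> d) \<le> ennreal (2 * exp 1 * growth_const \<kappa> k / (real d)\<^sup>2)"
    and "AE A in P_cond \<kappa> d. confined \<kappa> A"
proof -
  let ?G = "GOE d" and ?E = "confined_set \<kappa> d" and ?C = "2 * exp 1 * growth_const \<kappa> k / (real d)\<^sup>2"
  interpret G: prob_space ?G by (rule prob_space_GOE[OF d])
  have E: "?E \<in> sets ?G" unfolding space_GOE by (rule sets_confined[OF k])
  have C: "?C \<ge> 0" using growth_const_nonneg[of \<kappa> k] by simp
  have "emeasure (uniform_measure ?G ?E) (space ?G) = 1"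
    using prob_space.emeasure_space_1[OF P] unfolding P_cond_eq[OF k] by simp
  moreover have "emeasure (uniform_measure ?G ?E) (space ?G) = emeasure ?G ?E / emeasure ?G ?E"
    unfolding emeasure_uniform_measure[OF E sets.top] sets.Int_space_eq2[OF E] ..
  \<comment> \<open>The ball has positive probability, as otherwise its conditional law would be the null measure.\<close>
  ultimately have "emeasure ?G ?E / emeasure ?G ?E = 1" by simp
  then have "emeasure ?G ?E \<noteq> 0" by (rule contrapos_pn) (simp add: divide_ennreal_def)
  then have pos: "measure ?G ?E > 0" by (simp add: G.emeasure_eq_measure zero_less_measure_iff)
  have mX: "(\<lambda>A. ennreal ((loop_obs \<kappa> k A)\<^sup>2)) \<in> borel_measurable ?G"
    unfolding measurable_cong_sets[OF space_GOE(2) refl] by (rule measurable_loop_obs_square)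
  have "(\<integral>\<^sup>+A. ennreal ((loop_obs \<kappa> k A)\<^sup>2) \<partial>P_cond \<kappa> d)
      = (\<integral>\<^sup>+A. ennreal ((loop_obs \<kappa> k A)\<^sup>2) * indicator ?E A \<partial>?G) / emeasure ?G ?E"
    unfolding P_cond_eq[OF k] by (rule nn_integral_uniform_measure[OF mX E])
  also have "(\<integral>\<^sup>+A. ennreal ((loop_obs \<kappa> k A)\<^sup>2) * indicator ?E A \<partial>?G) = (\<integral>\<^sup>+A. ennreal (indicator ?E A * (loop_obs \<kappa> k A)\<^sup>2) \<partial>?G)"
    by (rule nn_integral_cong) (simp add: indicator_def)
  also have "\<dots> = ennreal (\<integral>A. indicator ?E A * (loop_obs \<kappa> k A)\<^sup>2 \<partial>?G)"
    by (rule nn_integral_eq_integral[OF loop_second_moment(1)[OF d k]]) simp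
  also have "\<dots> / emeasure ?G ?E \<le> ennreal (?C * measure ?G ?E) / emeasure ?G ?E"
    by (rule divide_right_mono_ennreal[OF ennreal_leI[OF loop_second_moment(2)[OF d k]]])
  also have "\<dots> = ennreal ?C"
  proof -
    have "ennreal (?C * measure ?G ?E) / ennreal (measure ?G ?E) = ennreal (?C * measure ?G ?E / measure ?G ?E)"
      by (rule divide_ennreal[OF mult_nonneg_nonneg[OF C measure_nonneg] pos])
    also have "?C * measure ?G ?E / measure ?G ?E = ?C" by (rule nonzero_mult_div_cancel_right) (use pos in simp)
    finally show ?thesis unfolding G.emeasure_eq_measure .
  qed
  finally show "(\<integral>\<^sup>+A. ennreal ((loop_obs \<kappa> k A)\<^sup>2) \<partial>P_cond \<kappa> d) \<le> ennreal ?C" .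
  show "AE A in P_cond \<kappa> d. confined \<kappa> A"
    unfolding P_cond_eq[OF k] by (rule AE_uniform_measureI[OF E]) (auto simp: confined_set_def)
qed

text \<open>
  The expected sum of the squares is finite. By linearity of the
  expectation this holds for every coupling of the X n.
\<close>

lemma AE_square_summable_tendsto_0:
  fixes X :: "nat \<Rightarrow> 'w \<Rightarrow> real"
  assumes X: "\<And>n. X n \<in> borel_measurable M"
    and le: "\<And>n. (\<integral>\<^sup>+\<omega>. ennreal ((X n \<omega>)\<^sup>2) \<partial>M) \<le> ennreal (c n)" and c: "summable c" "\<And>n. 0 \<le> c n"
  shows "AE \<omega> in M. (\<lambda>n. X n \<omega>) \<longlonglongrightarrow> 0"
proof -
  have m: "(\<lambda>\<omega>. ennreal ((X n \<omega>)\<^sup>2)) \<in> borel_measurable M" for n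
    by (intro measurable_compose[OF _ measurable_ennreal] borel_measurable_power X)
  have "(\<integral>\<^sup>+\<omega>. (\<Sum>n. ennreal ((X n \<omega>)\<^sup>2)) \<partial>M) = (\<Sum>n. \<integral>\<^sup>+\<omega>. ennreal ((X n \<omega>)\<^sup>2) \<partial>M)"
    by (rule nn_integral_suminf) (rule m)
  also have "\<dots> \<le> (\<Sum>n. ennreal (c n))" by (rule suminf_le[OF le summableI summableI])
  also have "\<dots> < \<infinity>" using ennreal_suminf_neq_top[OF c] by (simp add: less_top)
  finally have "(\<integral>\<^sup>+\<omega>. (\<Sum>n. ennreal ((X n \<omega>)\<^sup>2)) \<partial>M) \<noteq> \<infinity>" by simp
  then have "AE \<omega> in M. (\<Sum>n. ennreal ((X n \<omega>)\<^sup>2)) \<noteq> \<infinity>"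
    by (rule nn_integral_noteq_infinite[rotated]) (rule borel_measurable_suminf_order, rule m)
  then show ?thesis
  proof eventually_elim
    case (elim \<omega>)
    then have "summable (\<lambda>n. (X n \<omega>)\<^sup>2)" by (intro summable_suminf_not_top) auto
    from tendsto_real_sqrt[OF summable_LIMSEQ_zero[OF this]] have "(\<lambda>n. \<bar>X n \<omega>\<bar>) \<longlonglongrightarrow> 0" by simp
    then show ?case by (rule tendsto_rabs_zero_cancel)
  qed
qed

theorem theorem2p2:
  fixes \<kappa> :: real and M :: "'w measure" and W :: "nat \<Rightarrow> 'w \<Rightarrow> real mat"
  assumes "0 < \<kappa>" and "\<kappa> \<le> 2"
    and "prob_space M"
    and "\<And>d. d \<ge> 1 \<Longrightarrow> W d \<in> M \<rightarrow>\<^sub>M sym_mat_algebra d"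
    and "\<And>d. d \<ge> 1 \<Longrightarrow> distr M (sym_mat_algebra d) (W d) = P_cond \<kappa> d"
  shows "prob_space (mu_limit \<kappa>) \<and>
         (AE \<omega> in M. weak_conv_m (\<lambda>d. esd (W d \<omega>)) (mu_limit \<kappa>))"
proof
  note k = assms(1,2)
  show "prob_space (mu_limit \<kappa>)" by (rule mu_limit_prob[OF k])
  interpret prob_space M by fact
  have d: "Suc n \<ge> 1" for n by simp
  note W = assms(4)[OF d] and law = assms(5)[OF d]
  have P: "prob_space (P_cond \<kappa> (Suc n))" for n
    unfolding law[symmetric] by (rule prob_space_distr[OF W])
  have sym: "W (Suc n) \<omega> \<in> sym_mats (Suc n)" if "\<omega> \<in> space M" for n \<omega>
    using measurable_space[OF W that] unfolding space_sym_mat_algebra .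
  have conf: "AE \<omega> in M. \<forall>n. confined \<kappa> (W (Suc n) \<omega>)"
    unfolding AE_all_countable
  proof
    fix n
    have "AE A in distr M (sym_mat_algebra (Suc n)) (W (Suc n)). confined \<kappa> A"
      unfolding law by (rule P_cond_second_moment(2)[OF d k(1) P])
    then show "AE \<omega> in M. confined \<kappa> (W (Suc n) \<omega>)" by (rule AE_distrD[OF W])
  qed
  have loop: "AE \<omega> in M. \<forall>k. (\<lambda>n. loop_obs \<kappa> k (W (Suc n) \<omega>)) \<longlonglongrightarrow> 0"
    unfolding AE_all_countable
  proof
    fix k
    define c where "c n = 2 * exp 1 * growth_const \<kappa> k / (real (Suc n))\<^sup>2" for n
    show "AE \<omega> in M. (\<lambda>n. loop_obs \<kappa> k (W (Suc n) \<omega>)) \<longlonglongrightarrow> 0"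
    proof (rule AE_square_summable_tendsto_0[of _ _ c])
      show "(\<lambda>\<omega>. loop_obs \<kappa> k (W (Suc n) \<omega>)) \<in> borel_measurable M" for n
        by (rule measurable_compose[OF W tame_measurable[OF tame_loop_obs]])
      show "0 \<le> c n" for n unfolding c_def using growth_const_nonneg[of \<kappa> k] by simp
      have "summable (\<lambda>n. inverse (real (Suc n) ^ 2))"
        using inverse_power_summable[of 2, where 'a = real] by (subst summable_Suc_iff) simp
      then have "summable (\<lambda>n. (2 * exp 1 * growth_const \<kappa> k) * inverse (real (Suc n) ^ 2))" by (rule summable_mult)
      then show "summable c" unfolding c_def divide_inverse .
      fix n
      have "(\<integral>\<^sup>+\<omega>. ennreal ((loop_obs \<kappa> k (W (Suc n) \<omega>))\<^sup>2) \<partial>M)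
          = (\<integral>\<^sup>+A. ennreal ((loop_obs \<kappa> k A)\<^sup>2) \<partial>distr M (sym_mat_algebra (Suc n)) (W (Suc n)))"
        by (rule nn_integral_distr[OF W, symmetric]) (simp add: measurable_loop_obs_square)
      also have "\<dots> \<le> ennreal (c n)"
        unfolding law c_def by (rule P_cond_second_moment(1)[OF d assms(1) P])
      finally show "(\<integral>\<^sup>+\<omega>. ennreal ((loop_obs \<kappa> k (W (Suc n) \<omega>))\<^sup>2) \<partial>M) \<le> ennreal (c n)" .
    qed
  qed
  show "AE \<omega> in M. weak_conv_m (\<lambda>d. esd (W d \<omega>)) (mu_limit \<kappa>)"
    using conf loop AE_space
  proof eventually_elim
    case (elim \<omega>)
    have "weak_conv_m (\<lambda>n. esd (W (Suc n) \<omega>)) (mu_limit \<kappa>)"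
    proof (rule esd_weak_conv[OF k])
      show "W (Suc n) \<omega> \<in> sym_mats (Suc n)" for n by (rule sym[OF elim(3)])
      show "confined \<kappa> (W (Suc n) \<omega>)" for n using elim(1) by (rule spec)
      show "(\<lambda>n. loop_obs \<kappa> k (W (Suc n) \<omega>)) \<longlonglongrightarrow> 0" for k using elim(2) by (rule spec)
    qed
    then have "(\<lambda>n. cdf (esd (W (Suc n) \<omega>)) x) \<longlonglongrightarrow> cdf (mu_limit \<kappa>) x" if "isCont (cdf (mu_limit \<kappa>)) x" for x
      using that unfolding weak_conv_m_def weak_conv_def by (elim allE impE)
    from LIMSEQ_imp_Suc[OF this] show ?case
      unfolding weak_conv_m_def weak_conv_def by (intro allI impI)
  qed
qed

end
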